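(* Let $N\ge 1$, let $\Gamma_N=(\gamma_N^2(i,j))_{i,j=1,\dots,N}$ be a symmetric matrix with nonnegative entries, and put $\gamma_{\max}^2=\max_{i,j}\gamma_N^2(i,j)$. Let $X_N$ be a GUE matrix with variance profile $\Gamma_N$, let $Y_N$ be a deterministic $N\times N$ Hermitian matrix, and $H_N=X_N+Y_N$. (i) There exists a unique function $G_{H_N}^\square:\mathrm D_N(\mathbb C)^+\to \mathrm D_N(\mathbb C)^-$, analytic in each variable, such that for every $\Lambda\in \mathrm D_N(\mathbb C)^+$ $$G_{H_N}^\square(\Lambda)=\Delta\Big[\Big(\Lambda-\mathcal R_N\big(G_{H_N}^\square(\Lambda)\big)-Y_N\Big)^{-1}\Big].$$ (ii) Let $0<\delta<1$ and let $\Lambda\in \mathrm D_N(\mathbb C)^+$ satisfy $$\operatorname{Im}\Lambda\ \ge\ \gamma_{\max}\Big(\frac{2}{N(1-\delta)}\Big)^{1/5}\,\mathbb I_N .$$ Then for any $d>1$, setting $$\varepsilon_N(d)=\sqrt2\,\gamma_{\max}\sqrt{\frac{d\log N}{N}}\,\|(\operatorname{Im}\Lambda)^{-1}\|^2+\Big(1+\frac{\gamma_{\max}^2}{\delta}\|(\operatorname{Im}\Lambda)^{-1}\|^2\Big)\frac{2\gamma_{\max}^3\|(\operatorname{Im}\Lambda)^{-1}\|^4}{N},$$ one has, for $N\ge 1$, $$\mathbb P\Big(\big\|G_{H_N}(\Lambda)-G_{H_N}^\square(\Lambda)\big\|\ge \varepsilon_N(d)\Big)\le 4N^{1-d}.$$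 (iii) If moreover $Y_N$ is diagonal, then for any $\Lambda\in \mathrm D_N(\mathbb C)^+$ satisfying $\operatorname{Im}\Lambda\ge \gamma_{\max}N^{-1/4}(1-\delta)^{-1/6}\,\mathbb I_N$ (with $0<\delta<1$), and any $d>1$, the same probability inequality holds with $$\varepsilon_N(d)=\sqrt2\,\gamma_{\max}\sqrt{\frac{d\log N}{N}}\,\|(\operatorname{Im}\Lambda)^{-1}\|^2+\Big(1+\frac{\gamma_{\max}^2}{\delta}\|(\operatorname{Im}\Lambda)^{-1}\|^2\Big)\gamma_{\max}^4\frac{\|(\operatorname{Im}\Lambda)^{-1}\|^5}{N^{3/2}}.$$
   Context: A GUE matrix of size $N$ with variance profile $\Gamma_N=(\gamma_N^2(i,j))$ (with $\gamma_N(i,j)\ge 0$) is the Hermitian random matrix $X_N=\big(\gamma_N(i,j)x_{i,j}/\sqrt N\big)_{i,j}$, where $x_{j,i}=\overline{x_{i,j}}$, the variables $(x_{i,j})_{i\ge j}$ are independent, $x_{i,i}$ is a centered real Gaussian of variance $1$, and for $i\ne j$ $x_{i,j}$ is a centered complex Gaussian of variance $1$ (real and imaginary parts independent, each of variance $1/2$). $\mathrm D_N(\mathbb C)^+$ (resp. $\mathrm D_N(\mathbb C)^-$) is the set of $N\times N$ complex diagonal matrices all of whose diagonal entries have positive (resp. negative) imaginary part. For a square matrix $A$, $\Delta(A)$ is the diagonal matrix with the same diagonal entries as $A$; $\|A\|$ is the operator norm; $\operatorname{Im}A=(A-A^* )/(2\mathbf i)$; for Hermitian matrices $A\ge B$ means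 $A-B$ is positive semidefinite; $\mathbb I_N$ is the identity. For a diagonal matrix $\Lambda$, $\mathcal R_N(\Lambda)=\mathrm{diag}_{i=1,\dots,N}\big(\sum_{j=1}^N\frac{\gamma_N^2(i,j)}{N}\Lambda(j,j)\big)$. The operator-valued Stieltjes transform of $H_N$ is $G_{H_N}(\Lambda)=\Delta[(\Lambda-H_N)^{-1}]$ for $\Lambda\in \mathrm D_N(\mathbb C)^+$.
   Formalization: Parts (ii) and (iii) additionally assume γ_max > 0: if γ_max = 0 then X_N = 0 and ε_N(d) = 0, so the event has probability 1, while 4N^{1-d} < 1 for example for N = 5, d = 3. *)

theory Defs
  imports "HOL-Probability.Probability" "HOL-Complex_Analysis.Complex_Analysis"
begin

text \<open>
  Throughout, \<open>N = CARD('n)\<close> and an \<open>N \<times> N\<close> complex matrix has type \<open>complex ^ 'n ^ 'n\<close>.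
  The index type is linearly ordered only so that "the entries with \<open>i \<ge> j\<close>" makes sense.
\<close>

definition diagm :: "('n \<Rightarrow> complex) \<Rightarrow> complex ^ 'n ^ 'n" where
  "diagm f = (\<chi> i j. if i = j then f i else 0)"

definition diag_part :: "complex ^ 'n ^ 'n \<Rightarrow> complex ^ 'n ^ 'n" where
  "diag_part A = diagm (\<lambda>i. A $ i $ i)"

definition is_diag :: "complex ^ 'n ^ 'n \<Rightarrow> bool" where
  "is_diag A \<longleftrightarrow> (\<forall>i j. i \<noteq> j \<longrightarrow> A $ i $ j = 0)"

definition Dplus :: "(complex ^ 'n ^ 'n) set" where
  "Dplus = {A. is_diag A \<and> (\<forall>i. Im (A $ i $ i) > 0)}"

definition Dminus :: "(complex ^ 'n ^ 'n) set" where
  "Dminus = {A. is_diag A \<and> (\<forall>i. Im (A $ i $ i) < 0)}"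

definition adjm :: "complex ^ 'n ^ 'n \<Rightarrow> complex ^ 'n ^ 'n" where
  "adjm A = (\<chi> i j. cnj (A $ j $ i))"

definition hermitian :: "complex ^ 'n ^ 'n \<Rightarrow> bool" where
  "hermitian A \<longleftrightarrow> adjm A = A"

definition Im_mat :: "complex ^ 'n ^ 'n \<Rightarrow> complex ^ 'n ^ 'n" where
  "Im_mat A = (\<chi> i j. (A - adjm A) $ i $ j / (2 * \<i>))"

text \<open>The quadratic form of a Hermitian matrix is real, so taking its real part loses nothing.\<close>

definition psd :: "complex ^ 'n ^ 'n \<Rightarrow> bool" where
  "psd A \<longleftrightarrow> hermitian A \<and> (\<forall>v. 0 \<le> Re (\<Sum>i\<in>UNIV. cnj (v $ i) * (A *v v) $ i))"

definition loewner_ge :: "complex ^ 'n ^ 'n \<Rightarrow> complex ^ 'n ^ 'n \<Rightarrow> bool" (infix "\<succeq>\<^sub>L" 50) where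
  "A \<succeq>\<^sub>L B \<longleftrightarrow> psd (A - B)"

text \<open>The norm of \<open>complex ^ 'n\<close> is the Hermitian one, so this is the spectral norm.\<close>

definition opnorm :: "complex ^ 'n ^ 'n \<Rightarrow> real" where
  "opnorm A = onorm ((*v) A)"

text \<open>
  Below, the matrix \<open>\<Gamma>\<close> of variances is the primary datum and \<open>\<gamma> i j = sqrt (\<Gamma> $ i $ j)\<close>.
\<close>

definition variance_profile :: "real ^ 'n ^ 'n \<Rightarrow> bool" where
  "variance_profile \<Gamma> \<longleftrightarrow> (\<forall>i j. 0 \<le> \<Gamma> $ i $ j) \<and> transpose \<Gamma> = \<Gamma>"

definition gamma_max :: "real ^ 'n ^ 'n \<Rightarrow> real" where
  "gamma_max \<Gamma> = sqrt (Max (range (\<lambda>(i, j). \<Gamma> $ i $ j)))"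

text \<open>
  Diagonal entries are real by the symmetry condition. The indexed independence notion includes
  measurability of every \<open>x i j\<close> with \<open>j \<le> i\<close>.
\<close>

definition gue_entries ::
  "'a measure \<Rightarrow> ('n::{finite,linorder} \<Rightarrow> 'n \<Rightarrow> 'a \<Rightarrow> complex) \<Rightarrow> bool" where
  "gue_entries M x \<longleftrightarrow>
     prob_space M \<and>
     (\<forall>\<omega>\<in>space M. \<forall>i j. x j i \<omega> = cnj (x i j \<omega>)) \<and>
     prob_space.indep_vars M (\<lambda>_. borel) (\<lambda>(i, j). x i j) {(i, j). j \<le> i} \<and>
     (\<forall>i. distributed M lborel (\<lambda>\<omega>. Re (x i i \<omega>)) (normal_density 0 1)) \<and>
     (\<forall>i j. j < i \<longrightarrow>
        prob_space.indep_var M borel (\<lambda>\<omega>. Re (x i j \<omega>)) borel (\<lambda>\<omega>. Im (x i j \<omega>)) \<and>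
        distributed M lborel (\<lambda>\<omega>. Re (x i j \<omega>)) (normal_density 0 (sqrt (1/2))) \<and>
        distributed M lborel (\<lambda>\<omega>. Im (x i j \<omega>)) (normal_density 0 (sqrt (1/2))))"

definition gue_matrix ::
  "real ^ 'n ^ 'n \<Rightarrow> ('n::finite \<Rightarrow> 'n \<Rightarrow> 'a \<Rightarrow> complex) \<Rightarrow> 'a \<Rightarrow> complex ^ 'n ^ 'n" where
  "gue_matrix \<Gamma> x \<omega> =
     (\<chi> i j. complex_of_real (sqrt (\<Gamma> $ i $ j)) * x i j \<omega> / complex_of_real (sqrt (real CARD('n))))"

definition R_map :: "real ^ 'n ^ 'n \<Rightarrow> complex ^ 'n ^ 'n \<Rightarrow> complex ^ 'n ^ 'n" where
  "R_map \<Gamma> L =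
     diagm (\<lambda>i. \<Sum>j\<in>UNIV. complex_of_real (\<Gamma> $ i $ j / real CARD('n)) * L $ j $ j)"

definition stieltjes :: "complex ^ 'n ^ 'n \<Rightarrow> complex ^ 'n ^ 'n \<Rightarrow> complex ^ 'n ^ 'n" where
  "stieltjes H L = diag_part (matrix_inv (L - H))"

definition analytic_in_each_variable ::
  "(complex ^ 'n ^ 'n \<Rightarrow> complex ^ 'n ^ 'n) \<Rightarrow> bool" where
  "analytic_in_each_variable G \<longleftrightarrow>
     (\<forall>L\<in>Dplus. \<forall>k i j.
        (\<lambda>z. G (diagm (\<lambda>l. if l = k then z else L $ l $ l)) $ i $ j) analytic_on {z. Im z > 0})"

text \<open>
  \<open>G\<close> is only meaningful on \<open>Dplus\<close>: the extensional function space \<open>\<rightarrow>\<^sub>E\<close> fixes its values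
  elsewhere to \<open>undefined\<close>, so that uniqueness as a HOL function is uniqueness on \<open>Dplus\<close>.
\<close>

definition fixed_point_solution ::
  "real ^ 'n ^ 'n \<Rightarrow> complex ^ 'n ^ 'n \<Rightarrow> (complex ^ 'n ^ 'n \<Rightarrow> complex ^ 'n ^ 'n) \<Rightarrow> bool" where
  "fixed_point_solution \<Gamma> Y G \<longleftrightarrow>
     G \<in> Dplus \<rightarrow>\<^sub>E Dminus \<and>
     analytic_in_each_variable G \<and>
     (\<forall>L\<in>Dplus. G L = diag_part (matrix_inv (L - R_map \<Gamma> (G L) - Y)))"

definition G_box :: "real ^ 'n ^ 'n \<Rightarrow> complex ^ 'n ^ 'n \<Rightarrow> complex ^ 'n ^ 'n \<Rightarrow> complex ^ 'n ^ 'n" where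
  "G_box \<Gamma> Y = (THE G. fixed_point_solution \<Gamma> Y G)"

definition inv_Im_norm :: "complex ^ 'n ^ 'n \<Rightarrow> real" where
  "inv_Im_norm L = opnorm (matrix_inv (Im_mat L))"

definition eps_general :: "real ^ 'n ^ 'n \<Rightarrow> complex ^ 'n ^ 'n \<Rightarrow> real \<Rightarrow> real \<Rightarrow> real" where
  "eps_general \<Gamma> L \<delta> d =
     sqrt 2 * gamma_max \<Gamma> * sqrt (d * ln (real CARD('n)) / real CARD('n)) * inv_Im_norm L ^ 2
     + (1 + gamma_max \<Gamma> ^ 2 / \<delta> * inv_Im_norm L ^ 2)
       * (2 * gamma_max \<Gamma> ^ 3 * inv_Im_norm L ^ 4 / real CARD('n))"

definition eps_diagonal :: "real ^ 'n ^ 'n \<Rightarrow> complex ^ 'n ^ 'n \<Rightarrow> real \<Rightarrow> real \<Rightarrow> real" where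
  "eps_diagonal \<Gamma> L \<delta> d =
     sqrt 2 * gamma_max \<Gamma> * sqrt (d * ln (real CARD('n)) / real CARD('n)) * inv_Im_norm L ^ 2
     + (1 + gamma_max \<Gamma> ^ 2 / \<delta> * inv_Im_norm L ^ 2)
       * (gamma_max \<Gamma> ^ 4 * (inv_Im_norm L ^ 5 / real CARD('n) powr (3/2)))"

end

theory Submission
  imports Defs
begin

text \<open>
  Let \<open>\<sigma>\<close> be the variance profile divided by \<open>N\<close>. Two solutions \<open>g\<close>, \<open>g'\<close> of the fixed point equation at the
  diagonal parameters \<open>l\<close>, \<open>l'\<close> with resolvents \<open>A\<close>, \<open>A'\<close> satisfy
  \<open>g i - g' i = (\<Sum>j. A i j * A' j i * (l' j - l j + (\<Sum>k. \<sigma> j k * (g k - g' k))))\<close>, while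
  \<open>p = - Im g\<close> satisfies \<open>p i = (\<Sum>j. \<bar>A i j\<bar>^2 * (Im (l j) + (\<Sum>k. \<sigma> j k * p k)))\<close>. Cauchy--Schwarz and a
  maximum principle bound \<open>\<bar>g i - g' i\<bar>\<close> by a multiple of \<open>sqrt (p i * p' i)\<close>; this yields uniqueness
  and the Lipschitz constant of the solution. Existence is Brouwer's theorem, and complex differentiability
  follows because the linearized equation is injective.

  The law of the matrix \<open>X\<close> is stable: \<open>a X + b X'\<close> has the law of \<open>X\<close> for an independent copy \<open>X'\<close> and
  \<open>a^2 + b^2 = 1\<close>. Splitting \<open>X\<close> into \<open>n\<close> small independent steps and estimating
  \<open>cosh \<bar>z + D\<bar>\<close> for each martingale increment \<open>D\<close> (Pinelis' method) gives, as \<open>n\<close> grows, Gaussian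
  concentration of complex-valued functions of \<open>X\<close>, with a gradient bound for the real and imaginary part together
  and hence without loss of a factor. The same splitting gives the Poincare inequality and
  integration by parts. The latter shows that the mean of the resolvent solves the fixed point equation up to a
  covariance, which is small by the Poincare inequality; moving this error into the spectral parameter and using
  the Lipschitz bound controls the bias.
\<close>

no_notation fps_nth (infixl "$" 75)

section \<open>Dissipative matrices\<close>

text \<open>The main obstacle is stability of the fixed point equation on the whole upper
  half-plane, where contraction arguments fail. The weights \<open>sqrt (p i * p' i)\<close> come
  from the solutions themselves, so the resulting estimate is free of \<open>\<sigma>\<close> and of
  the dimension.

  Gaussianity enters only through stability of the law, a fourth moment and the covariances; the
  joint density of the matrix is never written down.

  Origin of the constants: let s be the norm of the inverse of Im L, c = 1/s and v = gamma_max^2/N.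
  A diagonal resolvent entry concentrates with variance v/c^4, so deviations of size sqrt 2
  gamma_max sqrt (d ln N / N) s^2 have probability at most 2 N^(-d), and a union bound over the N
  entries costs a factor N. If the mean solves its equation up to \<open>\<theta>\<close>, the
  spectral parameter is shifted by at most gamma_max^2 \<open>\<theta>\<close>. The hypothesis on Im
  L leaves a fraction \<open>\<delta>\<close> of the imaginary part after this shift, whence the
  \<open>\<delta>\<close> in the bound. With \<open>\<theta>\<close> of order gamma_max^3 s^4 / N
  this demands a bound on (gamma_max s)^5, with gamma_max^4 s^5 / N^(3/2) for diagonal Y one on
  (gamma_max s)^6: these are the exponents 1/5 and 1/6.\<close>

definition dissipative :: "real \<Rightarrow> complex ^ 'n ^ 'n \<Rightarrow> bool" where
  "dissipative c W \<longleftrightarrow> (\<forall>v. c * (norm v)\<^sup>2 \<le> Im (\<Sum>i\<in>UNIV. cnj (v $ i) * (W *v v) $ i))"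

lemma norm_vec_power2: "(norm (v :: 'b::real_normed_vector ^ 'n))\<^sup>2 = (\<Sum>i\<in>UNIV. (norm (v $ i))\<^sup>2)"
  by (simp add: norm_vec_def L2_set_def sum_nonneg)

lemma norm_matrix_power2:
  "(norm (A :: complex ^ 'n ^ 'm))\<^sup>2 = (\<Sum>i\<in>UNIV. \<Sum>j\<in>UNIV. (cmod (A $ i $ j))\<^sup>2)"
  by (simp add: norm_vec_power2)

lemma cmod_sum_mult_le_norm:
  fixes u v :: "complex ^ 'n"
  shows "cmod (\<Sum>i\<in>UNIV. u $ i * v $ i) \<le> norm u * norm v"
proof -
  have "cmod (\<Sum>i\<in>UNIV. u $ i * v $ i) \<le> (\<Sum>i\<in>UNIV. cmod (u $ i) * cmod (v $ i))"
    by (rule order_trans[OF norm_sum]) (simp add: norm_mult)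
  also have "\<dots> \<le> norm u * norm v"
    unfolding norm_vec_def using L2_set_mult_ineq by (metis (no_types, lifting) abs_norm_cancel sum.cong)
  finally show ?thesis .
qed

lemma matrix_inv_both:
  assumes "invertible (A :: complex ^ 'n ^ 'n)"
  shows "A ** matrix_inv A = mat 1" "matrix_inv A ** A = mat 1"
  using someI_ex[OF assms[unfolded invertible_def]] unfolding matrix_inv_def by auto

lemma matrix_inv_eqI:
  assumes "A ** B = mat 1"
  shows "matrix_inv A = (B :: complex ^ 'n ^ 'n)"
proof -
  have "invertible A" using assms invertible_right_inverse by blast
  have "B = matrix_inv A ** (A ** B)"
    by (simp add: matrix_mul_assoc matrix_inv_both[OF \<open>invertible A\<close>])
  then show ?thesis using assms by simp
qed

text \<open>Cauchy--Schwarz bounds the quadratic form by \<open>norm v * norm (W *v v)\<close>;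
  cancel one factor \<open>norm v\<close>. Invertibility and the bound 1/c on the inverse follow,
  without any normality of \<open>W\<close>.\<close>

lemma dissipative_norm_le:
  assumes "dissipative c W" shows "c * norm v \<le> norm (W *v v)"
proof (cases "v = 0")
  case False
  have "c * (norm v)\<^sup>2 \<le> Im (\<Sum>i\<in>UNIV. cnj (v $ i) * (W *v v) $ i)"
    using assms unfolding dissipative_def by blast
  also have "\<dots> \<le> cmod (\<Sum>i\<in>UNIV. (\<chi> i. cnj (v $ i)) $ i * (W *v v) $ i)"
    by (rule order_trans[OF abs_ge_self order_trans[OF abs_Im_le_cmod]]) simp
  also have "\<dots> \<le> norm (\<chi> i. cnj (v $ i)) * norm (W *v v)"
    by (rule cmod_sum_mult_le_norm)
  also have "norm (\<chi> i. cnj (v $ i)) = norm v"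
    by (simp add: norm_vec_def)
  finally have "norm v * (c * norm v) \<le> norm v * norm (W *v v)"
    by (simp add: power2_eq_square mult_ac)
  then show ?thesis using False by simp
qed simp

lemma dissipative_invertible:
  assumes "dissipative c W" "c > 0" shows "invertible W"
proof -
  have "inj ((*v) W)"
  proof (rule injI)
    fix u v assume "W *v u = W *v v"
    then have "W *v (u - v) = 0" by (simp add: matrix_vector_mult_diff_distrib)
    then have "c * norm (u - v) \<le> 0" using dissipative_norm_le[OF assms(1), of "u - v"] by simp
    then show "u = v" using assms(2) by (simp add: mult_le_0_iff)
  qed
  then show ?thesis by (simp add: invertible_left_inverse matrix_left_invertible_injective)
qed

lemma dissipative_inv_norm_le:
  assumes "dissipative c W" "c > 0" shows "norm (matrix_inv W *v v) \<le> norm v / c"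
proof -
  have "W *v (matrix_inv W *v v) = v"
    by (simp add: matrix_vector_mul_assoc matrix_inv_both dissipative_invertible[OF assms])
  then show ?thesis using dissipative_norm_le[OF assms(1), of "matrix_inv W *v v"] assms(2)
    by (simp add: field_simps)
qed

lemma matrix_vector_mult_axis: "(A :: complex ^ 'n ^ 'm) *v axis k 1 = column k A"
  by (simp add: vec_eq_iff matrix_vector_mult_def column_def axis_def if_distrib cong: if_cong)

lemma norm_axis_one_complex: "norm (axis k 1 :: complex ^ 'n) = 1"
proof -
  have "(norm (axis k 1 :: complex ^ 'n))\<^sup>2 = 1"
    unfolding norm_vec_power2 axis_def by (simp add: if_distrib[where f = norm] if_distrib[where f = "\<lambda>x. x\<^sup>2"] cong: if_cong)
  then show ?thesis by (simp add: power2_eq_1_iff)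
qed

lemma norm_column_le:
  assumes "\<And>v. norm (A *v v) \<le> C * norm v"
  shows "norm (column j (A :: complex ^ 'n ^ 'n)) \<le> C"
  using assms[of "axis j 1"] by (simp add: matrix_vector_mult_axis norm_axis_one_complex)

text \<open>The norm of the matrix type is the Frobenius norm. Its square is the sum over the
  columns, and left multiplication acts on each column separately, so an operator bound on
  \<open>A\<close> costs no dimensional factor.\<close>

lemma norm_matrix_matrix_mult_le:
  fixes A B :: "complex ^ 'n ^ 'n"
  assumes "\<And>v. norm (A *v v) \<le> C * norm v"
  shows "norm (A ** B) \<le> C * norm B"
proof -
  have C: "0 \<le> C" using order_trans[OF norm_ge_zero assms[of "axis undefined 1"]] by (simp add: norm_axis_one_complex)
  have sq: "(norm D)\<^sup>2 = (\<Sum>j\<in>UNIV. (norm (column j D))\<^sup>2)" for D :: "complex ^ 'n ^ 'n"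
    unfolding norm_matrix_power2 by (subst sum.swap) (simp add: norm_vec_power2 column_def)
  have col: "column j (A ** B) = A *v column j B" for j
    by (simp add: vec_eq_iff column_def matrix_matrix_mult_def matrix_vector_mult_def)
  have "(norm (A ** B))\<^sup>2 = (\<Sum>j\<in>UNIV. (norm (A *v column j B))\<^sup>2)"
    by (simp add: sq col)
  also have "\<dots> \<le> (\<Sum>j\<in>UNIV. (C * norm (column j B))\<^sup>2)"
    by (intro sum_mono power_mono assms) simp
  also have "\<dots> = (C * norm B)\<^sup>2"
    by (simp add: power_mult_distrib sq sum_distrib_left)
  finally show ?thesis using C by (metis mult_nonneg_nonneg norm_ge_zero power2_le_imp_le)
qed

lemma norm_transpose: "norm (transpose A) = norm (A :: complex ^ 'n ^ 'n)"
proof -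
  have "(norm (transpose A))\<^sup>2 = (norm A)\<^sup>2"
    unfolding norm_matrix_power2 transpose_def by (simp, rule sum.swap)
  then show ?thesis by simp
qed

lemma cmod_entry_le_norm: "cmod (A $ i $ j) \<le> norm (A :: complex ^ 'n ^ 'm)"
  by (meson component_le_norm_cart order_trans Finite_Cartesian_Product.norm_nth_le)

section \<open>Hermitian matrices and the Ward identity for resolvents\<close>

lemma hermitian_entry: "hermitian B \<Longrightarrow> cnj (B $ i $ j) = B $ j $ i"
  unfolding hermitian_def adjm_def by (simp add: vec_eq_iff)

lemma hermitian_iff_entries: "hermitian B \<longleftrightarrow> (\<forall>i j. cnj (B $ j $ i) = B $ i $ j)"
  unfolding hermitian_def adjm_def by (simp add: vec_eq_iff)

lemma hermitian_form_real:
  assumes "hermitian B"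
  shows "Im (\<Sum>i\<in>UNIV. cnj (v $ i) * (B *v v) $ i) = 0"
proof -
  let ?q = "\<Sum>i\<in>UNIV. \<Sum>j\<in>UNIV. cnj (v $ i) * (B $ i $ j * v $ j)"
  have e: "(\<Sum>i\<in>UNIV. cnj (v $ i) * (B *v v) $ i) = ?q"
    by (simp add: matrix_vector_mult_def sum_distrib_left)
  have "cnj ?q = (\<Sum>i\<in>UNIV. \<Sum>j\<in>UNIV. cnj (v $ j) * (B $ j $ i * v $ i))"
    by (simp add: hermitian_entry[OF assms] mult_ac)
  also have "\<dots> = ?q" by (rule sum.swap)
  finally have "cnj ?q = ?q" .
  moreover have "Im z = 0" if "cnj z = z" for z
    using that by (simp add: complex_eq_iff)
  ultimately show ?thesis unfolding e by blast
qed

lemma diagm_mult_vec: "(diagm l *v v) $ i = l i * v $ i"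
  by (simp add: matrix_vector_mult_def diagm_def if_distrib[of "\<lambda>x. x * _"] cong: if_cong)

lemma Im_form_diagm_minus_hermitian:
  assumes "hermitian B"
  shows "Im (\<Sum>i\<in>UNIV. cnj (v $ i) * ((diagm l - B) *v v) $ i) = (\<Sum>i\<in>UNIV. Im (l i) * (cmod (v $ i))\<^sup>2)"
proof -
  have "(\<Sum>i\<in>UNIV. cnj (v $ i) * ((diagm l - B) *v v) $ i) =
      (\<Sum>i\<in>UNIV. l i * of_real ((cmod (v $ i))\<^sup>2)) - (\<Sum>i\<in>UNIV. cnj (v $ i) * (B *v v) $ i)"
    unfolding complex_norm_square
    by (simp add: matrix_vector_mult_diff_rdistrib diagm_mult_vec algebra_simps sum_subtractf)
  then have "Im (\<Sum>i\<in>UNIV. cnj (v $ i) * ((diagm l - B) *v v) $ i) =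
      Im (\<Sum>i\<in>UNIV. l i * of_real ((cmod (v $ i))\<^sup>2))"
    by (simp only: minus_complex.sel hermitian_form_real[OF assms])
  then show ?thesis by (simp del: of_real_power add: mult.commute)
qed

lemma dissipative_diagm_minus_hermitian:
  assumes "hermitian B" "\<And>i. c \<le> Im (l i)"
  shows "dissipative c (diagm l - B)"
  unfolding dissipative_def Im_form_diagm_minus_hermitian[OF assms(1)] norm_vec_power2 sum_distrib_left
  by (intro allI sum_mono mult_right_mono assms) simp

lemma hermitian_transpose: "hermitian B \<Longrightarrow> hermitian (transpose B)"
  unfolding hermitian_iff_entries transpose_def by simp

lemma transpose_diagm: "transpose (diagm l) = diagm l"
  by (simp add: vec_eq_iff transpose_def diagm_def)

lemma transpose_diff: "transpose (A - B) = transpose A - transpose (B :: complex ^ 'n ^ 'n)"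
  by (simp add: vec_eq_iff transpose_def)

lemma matrix_inv_transpose:
  assumes "invertible (A :: complex ^ 'n ^ 'n)"
  shows "matrix_inv (transpose A) = transpose (matrix_inv A)"
  by (rule matrix_inv_eqI) (metis assms matrix_inv_both(2) matrix_transpose_mul transpose_mat)

lemma ex_positive_lower_bound:
  fixes f :: "'n::finite \<Rightarrow> real" assumes "\<And>i. f i > 0"
  shows "\<exists>c>0. \<forall>i. c \<le> f i"
  using assms by (intro exI[of _ "Min (range f)"]) (auto simp: Min_gr_iff)

lemma invertible_diagm_minus_hermitian:
  assumes "hermitian B" "\<And>i. Im (l i) > 0" shows "invertible (diagm l - B)"
  using ex_positive_lower_bound[of "\<lambda>i. Im (l i)"] assms dissipative_diagm_minus_hermitian[of B]
    dissipative_invertible by metis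

text \<open>Ward identity: evaluate the quadratic form of \<open>diagm l - B\<close> at the i-th
  column v of \<open>R\<close>. Since this matrix maps v to the i-th unit vector, the form equals
  the conjugate of \<open>v $ i\<close>, while \<open>B\<close> does not contribute to its imaginary
  part.\<close>

lemma Im_resolvent_column:
  fixes B :: "complex ^ 'n ^ 'n"
  assumes "hermitian B" "\<And>i. Im (l i) > 0"
  defines "R \<equiv> matrix_inv (diagm l - B)"
  shows "- Im (R $ i $ i) = (\<Sum>j\<in>UNIV. (cmod (R $ j $ i))\<^sup>2 * Im (l j))"
proof -
  have inv: "invertible (diagm l - B)" by (rule invertible_diagm_minus_hermitian) (use assms in auto)
  define v where "v = R *v axis i 1"
  have vj: "v $ j = R $ j $ i" for j
    unfolding v_def by (simp add: matrix_vector_mult_axis column_def)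
  have Wv: "(diagm l - B) *v v = axis i 1"
    unfolding v_def R_def by (simp add: matrix_vector_mul_assoc matrix_inv_both[OF inv])
  have "(\<Sum>j\<in>UNIV. Im (l j) * (cmod (v $ j))\<^sup>2) = Im (cnj (v $ i))"
    unfolding Im_form_diagm_minus_hermitian[OF assms(1), symmetric] Wv axis_def
    by (simp only: vec_lambda_beta if_distrib if_distribR mult_1_right mult_zero_right cong: if_cong) simp
  then show ?thesis unfolding vj by (simp add: mult.commute)
qed

text \<open>The column version for \<open>transpose B\<close>, which is again Hermitian and has the
  transposed resolvent. Both versions are needed: differences of solutions pair a row of one
  resolvent with a column of another.\<close>

lemma Im_resolvent_row:
  fixes B :: "complex ^ 'n ^ 'n"
  assumes "hermitian B" "\<And>i. Im (l i) > 0"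
  defines "R \<equiv> matrix_inv (diagm l - B)"
  shows "- Im (R $ i $ i) = (\<Sum>j\<in>UNIV. (cmod (R $ i $ j))\<^sup>2 * Im (l j))"
proof -
  have inv: "invertible (diagm l - B)" by (rule invertible_diagm_minus_hermitian) (use assms in auto)
  have "matrix_inv (diagm l - transpose B) = transpose R"
    using matrix_inv_transpose[OF inv] by (simp add: transpose_diff transpose_diagm R_def)
  then show ?thesis using Im_resolvent_column[OF hermitian_transpose[OF assms(1)], of l i] assms(2)
    by (simp add: transpose_def)
qed

text \<open>By the Ward identity this could fail only for a vanishing row, which an invertible
  matrix does not have.\<close>

lemma Im_resolvent_neg:
  fixes B :: "complex ^ 'n ^ 'n"
  assumes "hermitian B" "\<And>i. Im (l i) > 0"
  shows "Im (matrix_inv (diagm l - B) $ i $ i) < 0"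
proof -
  let ?R = "matrix_inv (diagm l - B)"
  have inv: "invertible (diagm l - B)" by (rule invertible_diagm_minus_hermitian) (use assms in auto)
  have "\<exists>j. ?R $ i $ j \<noteq> 0"
  proof (rule ccontr)
    assume "\<not> ?thesis"
    then have "(?R ** (diagm l - B)) $ i $ i = 0" by (simp add: matrix_matrix_mult_def)
    then show False by (simp add: matrix_inv_both[OF inv] mat_def)
  qed
  then obtain j where j: "?R $ i $ j \<noteq> 0" ..
  have "0 < (\<Sum>j\<in>UNIV. (cmod (?R $ i $ j))\<^sup>2 * Im (l j))"
    by (rule sum_pos2[of _ j]) (use j assms(2) in \<open>simp_all add: less_imp_le\<close>)
  then show ?thesis using Im_resolvent_row[OF assms(1), of l i] assms(2) by simp
qed

lemma cmod_entry_dissipative_inv: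
  assumes "dissipative c W" "c > 0"
  shows "cmod (matrix_inv W $ i $ j) \<le> 1 / c"
proof -
  have "cmod (matrix_inv W $ i $ j) \<le> norm (column j (matrix_inv W))"
    using Finite_Cartesian_Product.norm_nth_le[of "column j (matrix_inv W)" i] by (simp add: column_def)
  also have "\<dots> \<le> 1 / c"
    by (rule norm_column_le) (use dissipative_inv_norm_le[OF assms] in simp)
  finally show ?thesis .
qed

section \<open>Perturbation of inverses of dissipative matrices\<close>

lemma matrix_mult_diff_left: "A ** (B - C) = A ** B - A ** (C :: 'b::ring_1 ^ 'k ^ 'm)"
  by (simp add: vec_eq_iff matrix_matrix_mult_def algebra_simps sum_subtractf)

lemma matrix_mult_diff_right: "(A - B) ** C = A ** C - B ** (C :: 'b::ring_1 ^ 'k ^ 'm)"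
  by (simp add: vec_eq_iff matrix_matrix_mult_def algebra_simps sum_subtractf)

lemma resolvent_identity:
  assumes "invertible A" "invertible (B :: complex ^ 'n ^ 'n)"
  shows "matrix_inv A - matrix_inv B = matrix_inv A ** (B - A) ** matrix_inv B"
proof -
  have "matrix_inv A ** (B - A) ** matrix_inv B
      = matrix_inv A ** (B ** matrix_inv B) - (matrix_inv A ** A) ** matrix_inv B"
    by (simp add: matrix_mult_diff_left matrix_mult_diff_right matrix_mul_assoc)
  then show ?thesis by (simp add: matrix_inv_both assms)
qed

lemma dissipative_transpose:
  fixes W :: "complex ^ 'n ^ 'n"
  assumes "dissipative c W" shows "dissipative c (transpose W)"
  unfolding dissipative_def
proof
  fix v :: "complex ^ 'n"
  define u where "u = (\<chi> i. cnj (v $ i))"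
  have "(\<Sum>i\<in>UNIV. cnj (v $ i) * (transpose W *v v) $ i) = (\<Sum>i\<in>UNIV. \<Sum>j\<in>UNIV. cnj (v $ i) * (W $ j $ i * v $ j))"
    by (simp add: matrix_vector_mult_def transpose_def sum_distrib_left)
  also have "\<dots> = (\<Sum>j\<in>UNIV. \<Sum>i\<in>UNIV. cnj (v $ i) * (W $ j $ i * v $ j))"
    by (rule sum.swap)
  also have "\<dots> = (\<Sum>i\<in>UNIV. cnj (u $ i) * (W *v u) $ i)"
    by (simp add: matrix_vector_mult_def u_def sum_distrib_left mult_ac)
  finally have "Im (\<Sum>i\<in>UNIV. cnj (v $ i) * (transpose W *v v) $ i) \<ge> c * (norm u)\<^sup>2"
    using assms unfolding dissipative_def by metis
  moreover have "norm u = norm v" by (simp add: u_def norm_vec_def)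
  ultimately show "c * (norm v)\<^sup>2 \<le> Im (\<Sum>i\<in>UNIV. cnj (v $ i) * (transpose W *v v) $ i)" by simp
qed

lemma norm_dissipative_inv_mult:
  fixes W X :: "complex ^ 'n ^ 'n"
  assumes "dissipative c W" "c > 0"
  shows "norm (matrix_inv W ** X) \<le> norm X / c"
  using norm_matrix_matrix_mult_le[of "matrix_inv W" "1 / c" X] dissipative_inv_norm_le[OF assms] by simp

text \<open>Transposition preserves both the Frobenius norm and dissipativity, and moves the inverse
  to the left.\<close>

lemma norm_mult_dissipative_inv:
  fixes W X :: "complex ^ 'n ^ 'n"
  assumes "dissipative c W" "c > 0"
  shows "norm (X ** matrix_inv W) \<le> norm X / c"
proof -
  have "norm (X ** matrix_inv W) = norm (transpose (X ** matrix_inv W))"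
    by (simp add: norm_transpose)
  also have "transpose (X ** matrix_inv W) = matrix_inv (transpose W) ** transpose X"
    by (simp add: matrix_transpose_mul matrix_inv_transpose dissipative_invertible[OF assms])
  also have "norm \<dots> \<le> norm X / c"
    using norm_dissipative_inv_mult[OF dissipative_transpose[OF assms(1)] assms(2), of "transpose X"]
    by (simp add: norm_transpose)
  finally show ?thesis .
qed

lemma norm_matrix_inv_diff_le:
  fixes A B :: "complex ^ 'n ^ 'n"
  assumes "dissipative a A" "a > 0" "dissipative b B" "b > 0"
  shows "norm (matrix_inv A - matrix_inv B) \<le> norm (A - B) / (a * b)"
proof -
  have "matrix_inv A - matrix_inv B = matrix_inv A ** ((B - A) ** matrix_inv B)"
    using resolvent_identity[of A B] assms dissipative_invertible matrix_mul_assoc by metis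
  then have "norm (matrix_inv A - matrix_inv B) \<le> norm ((B - A) ** matrix_inv B) / a"
    using norm_dissipative_inv_mult[OF assms(1,2)] by metis
  also have "\<dots> \<le> norm (B - A) / b / a"
    using norm_mult_dissipative_inv[OF assms(3,4), of "B - A"] assms(2) by (intro divide_right_mono) auto
  finally show ?thesis by (simp add: norm_minus_commute mult.commute)
qed

lemma continuous_on_matrix_inv_dissipative:
  fixes W :: "'b::metric_space \<Rightarrow> complex ^ 'n ^ 'n"
  assumes "continuous_on S W" "\<And>x. x \<in> S \<Longrightarrow> dissipative c (W x)" "c > 0"
  shows "continuous_on S (\<lambda>x. matrix_inv (W x))"
  unfolding continuous_on_iff
proof (intro ballI allI impI)
  fix y and e :: real assume "y \<in> S" "e > 0"
  moreover have "e * (c * c) > 0" using assms(3) \<open>e > 0\<close> by simp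
  ultimately obtain d where d: "d > 0" "\<And>x. x \<in> S \<Longrightarrow> dist x y < d \<Longrightarrow> dist (W x) (W y) < e * (c * c)"
    using assms(1) unfolding continuous_on_iff by blast
  have "dist (matrix_inv (W x)) (matrix_inv (W y)) < e" if "x \<in> S" "dist x y < d" for x
  proof -
    have "dist (matrix_inv (W x)) (matrix_inv (W y)) \<le> dist (W x) (W y) / (c * c)"
      unfolding dist_norm by (rule norm_matrix_inv_diff_le) (use assms that \<open>y \<in> S\<close> in auto)
    also have "\<dots> < e"
      using d(2)[OF that] assms(3) by (simp add: divide_less_eq)
    finally show ?thesis .
  qed
  then show "\<exists>d>0. \<forall>x'\<in>S. dist x' y < d \<longrightarrow> dist (matrix_inv (W x')) (matrix_inv (W y)) < e"
    using d(1) by blast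
qed

lemma continuous_on_diagm [continuous_intros]:
  assumes "\<And>i. continuous_on S (\<lambda>x. f x i)"
  shows "continuous_on S (\<lambda>x. diagm (f x))"
  unfolding diagm_def
proof (intro continuous_on_vec_lambda)
  show "continuous_on S (\<lambda>x. if i = j then f x i else 0)" for i j
    by (cases "i = j") (simp_all add: assms)
qed

section \<open>The fixed point equation\<close>

lemma sum_sqrt_mult_le:
  fixes a b :: "'b \<Rightarrow> real"
  assumes "\<And>k. k \<in> A \<Longrightarrow> 0 \<le> a k" "\<And>k. k \<in> A \<Longrightarrow> 0 \<le> b k"
  shows "(\<Sum>k\<in>A. sqrt (a k * b k)) \<le> sqrt ((\<Sum>k\<in>A. a k) * (\<Sum>k\<in>A. b k))"
proof -
  have "(\<Sum>k\<in>A. sqrt (a k * b k)) = (\<Sum>k\<in>A. \<bar>sqrt (a k)\<bar> * \<bar>sqrt (b k)\<bar>)"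
    using assms by (simp add: real_sqrt_mult)
  also have "\<dots> \<le> L2_set (\<lambda>k. sqrt (a k)) A * L2_set (\<lambda>k. sqrt (b k)) A"
    by (rule L2_set_mult_ineq)
  also have "\<dots> = sqrt ((\<Sum>k\<in>A. a k) * (\<Sum>k\<in>A. b k))"
    unfolding L2_set_def real_sqrt_mult using assms by simp
  finally show ?thesis .
qed

lemma sqrt_mult_add_le:
  assumes "0 \<le> a" "0 \<le> b" "0 \<le> a'" "0 \<le> b'"
  shows "sqrt (a * b) + sqrt (a' * b') \<le> sqrt ((a + a') * (b + b'))"
  using sum_sqrt_mult_le[of "UNIV :: bool set" "\<lambda>x. if x then a else a'" "\<lambda>x. if x then b else b'"] assms
  by (simp add: UNIV_bool add.commute)

lemma scaled_sqrt: "0 \<le> s \<Longrightarrow> s * sqrt (x * y) = sqrt ((s * x) * (s * y))"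
proof -
  assume "0 \<le> s"
  have "(s * x) * (s * y) = s\<^sup>2 * (x * y)" by (simp add: power2_eq_square)
  then show ?thesis using \<open>0 \<le> s\<close> by (simp add: real_sqrt_mult)
qed

text \<open>
  Compare \<open>w\<close> with the least multiple of \<open>\<lambda>i. sqrt (p i * q i)\<close> dominating it: by Cauchy--Schwarz
  a multiple larger than \<open>c\<close> could be strictly decreased.
\<close>

lemma comparison_principle:
  fixes w p q u v :: "'n::finite \<Rightarrow> real" and \<sigma> A B :: "'n \<Rightarrow> 'n \<Rightarrow> real"
  assumes nn: "\<And>i j. 0 \<le> \<sigma> i j" "\<And>i j. 0 \<le> A i j" "\<And>i j. 0 \<le> B i j"
    and pos: "\<And>i. 0 < p i" "\<And>i. 0 < q i" "\<And>i. 0 < u i" "\<And>i. 0 < v i" and c: "0 \<le> c"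
    and p: "\<And>i. p i = (\<Sum>j\<in>UNIV. A i j * (u j + (\<Sum>k\<in>UNIV. \<sigma> j k * p k)))"
    and q: "\<And>i. q i = (\<Sum>j\<in>UNIV. B i j * (v j + (\<Sum>k\<in>UNIV. \<sigma> j k * q k)))"
    and w: "\<And>i. w i \<le> (\<Sum>j\<in>UNIV. sqrt (A i j * B i j) * (c * sqrt (u j * v j) + (\<Sum>k\<in>UNIV. \<sigma> j k * w k)))"
  shows "w i \<le> c * sqrt (p i * q i)"
proof -
  define r where "r i = w i / sqrt (p i * q i)" for i
  define t where "t = Max (range r)"
  have sp: "0 < sqrt (p i * q i)" for i using pos by simp
  have wt: "w k \<le> t * sqrt (p k * q k)" for k
  proof -
    have "r k \<le> t" unfolding t_def by (rule Max_ge) auto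
    then show ?thesis using sp[of k] by (simp add: r_def field_simps)
  qed
  have "t \<le> c"
  proof (rule ccontr)
    assume "\<not> t \<le> c"
    then have tc: "c < t" by simp
    then have t0: "t > 0" using c by simp
    \<comment> \<open>At the maximal ratio \<open>t\<close> the source coefficient is
      \<open>c = t * \<theta>\<close> with \<open>\<theta> < 1\<close>. Everything can thus be
      measured in units of \<open>t\<close>, with the sources \<open>u\<close> and \<open>v\<close>
      damped by \<open>\<theta>\<close>.\<close>
    define \<theta> where "\<theta> = c / t"
    have th: "0 \<le> \<theta>" "\<theta> < 1" "c = t * \<theta>" using tc t0 c by (auto simp: \<theta>_def)
    have "t \<in> range r" unfolding t_def by (rule Max_in) auto
    then obtain i where "t = r i" by blast
    then have i: "w i = t * sqrt (p i * q i)" using pos(1,2)[of i] by (simp add: r_def)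
    define P where "P j = (\<Sum>k\<in>UNIV. \<sigma> j k * p k)" for j
    define Q where "Q j = (\<Sum>k\<in>UNIV. \<sigma> j k * q k)" for j
    have PQ: "0 \<le> P j" "0 \<le> Q j" for j
      unfolding P_def Q_def using nn pos by (auto intro!: sum_nonneg mult_nonneg_nonneg simp: less_imp_le)
    \<comment> \<open>Damping a positive source strictly lowers a sum that is positive, because a
      positive sum has a nonzero coefficient. It is applied to the equations for \<open>p i\<close>
      and \<open>q i\<close>.\<close>
    have strict: "(\<Sum>j\<in>UNIV. C j * (\<theta> * x j + X j)) < (\<Sum>j\<in>UNIV. C j * (x j + X j))"
      if "\<And>j. 0 \<le> C j" "\<And>j. 0 < x j" "0 < (\<Sum>j\<in>UNIV. C j * (x j + X j))" for C x X :: "'n \<Rightarrow> real"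
    proof -
      have "\<exists>j. C j \<noteq> 0"
      proof (rule ccontr)
        assume "\<not> ?thesis"
        then show False using that(3) by simp
      qed
      then obtain j where "C j \<noteq> 0" ..
      then have j: "C j > 0" using that(1)[of j] by simp
      have le: "\<theta> * x j \<le> x j" for j
        using mult_left_le_one_le[of "x j" \<theta>] that(2)[of j] th by simp
      show ?thesis
      proof (rule sum_strict_mono_ex1)
        show "\<forall>j\<in>UNIV. C j * (\<theta> * x j + X j) \<le> C j * (x j + X j)"
          by (intro ballI mult_left_mono add_right_mono le that(1))
        show "\<exists>j\<in>UNIV. C j * (\<theta> * x j + X j) < C j * (x j + X j)"
          using j that(2)[of j] th by (intro bexI[of _ j]) auto
      qed simp
    qed
    \<comment> \<open>Cauchy--Schwarz twice: over \<open>k\<close> inside the feedback term, then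
      for the two summands source and feedback. A third use over \<open>j\<close> follows
      below.\<close>
    have in1: "c * sqrt (u j * v j) + (\<Sum>k\<in>UNIV. \<sigma> j k * w k)
        \<le> t * sqrt ((\<theta> * u j + P j) * (\<theta> * v j + Q j))" for j
    proof -
      have "(\<Sum>k\<in>UNIV. \<sigma> j k * w k) \<le> (\<Sum>k\<in>UNIV. \<sigma> j k * (t * sqrt (p k * q k)))"
        by (intro sum_mono mult_left_mono wt nn)
      also have "\<dots> = t * (\<Sum>k\<in>UNIV. sqrt ((\<sigma> j k * p k) * (\<sigma> j k * q k)))"
        unfolding sum_distrib_left
        by (intro sum.cong refl) (subst scaled_sqrt[OF nn(1), symmetric], simp only: mult.left_commute)
      also have "\<dots> \<le> t * sqrt (P j * Q j)"
        unfolding P_def Q_def using t0 nn pos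
        by (intro mult_left_mono sum_sqrt_mult_le) (auto intro!: mult_nonneg_nonneg simp: less_imp_le)
      finally have 1: "(\<Sum>k\<in>UNIV. \<sigma> j k * w k) \<le> t * sqrt (P j * Q j)" .
      have "c * sqrt (u j * v j) = t * sqrt ((\<theta> * u j) * (\<theta> * v j))"
        using th by (simp flip: scaled_sqrt)
      then have "c * sqrt (u j * v j) + (\<Sum>k\<in>UNIV. \<sigma> j k * w k)
         \<le> t * (sqrt ((\<theta> * u j) * (\<theta> * v j)) + sqrt (P j * Q j))"
        using 1 by (simp add: distrib_left)
      also have "\<dots> \<le> t * sqrt ((\<theta> * u j + P j) * (\<theta> * v j + Q j))"
        using t0 th pos PQ by (intro mult_left_mono sqrt_mult_add_le) (auto intro!: mult_nonneg_nonneg simp: less_imp_le)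
      finally show ?thesis .
    qed
    have "w i \<le> (\<Sum>j\<in>UNIV. sqrt (A i j * B i j) * (t * sqrt ((\<theta> * u j + P j) * (\<theta> * v j + Q j))))"
      by (rule order_trans[OF w], intro sum_mono mult_left_mono in1) (use nn in auto)
    also have "\<dots> = t * (\<Sum>j\<in>UNIV. sqrt ((A i j * (\<theta> * u j + P j)) * (B i j * (\<theta> * v j + Q j))))"
      unfolding sum_distrib_left by (intro sum.cong refl) (simp add: real_sqrt_mult mult_ac)
    also have "\<dots> \<le> t * sqrt ((\<Sum>j\<in>UNIV. A i j * (\<theta> * u j + P j)) * (\<Sum>j\<in>UNIV. B i j * (\<theta> * v j + Q j)))"
      using t0 th pos PQ nn
      by (intro mult_left_mono sum_sqrt_mult_le) (auto intro!: mult_nonneg_nonneg add_nonneg_nonneg simp: less_imp_le)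
    also have "\<dots> < t * sqrt (p i * q i)"
    proof -
      have "(\<Sum>j\<in>UNIV. A i j * (\<theta> * u j + P j)) < p i"
        using strict[of "A i" u P] nn pos p[of i] pos(1)[of i] by (simp add: P_def)
      moreover have "(\<Sum>j\<in>UNIV. B i j * (\<theta> * v j + Q j)) < q i"
        using strict[of "B i" v Q] nn pos q[of i] pos(2)[of i] by (simp add: Q_def)
      moreover have "0 \<le> (\<Sum>j\<in>UNIV. A i j * (\<theta> * u j + P j))" "0 \<le> (\<Sum>j\<in>UNIV. B i j * (\<theta> * v j + Q j))"
        using th pos PQ nn by (auto intro!: sum_nonneg mult_nonneg_nonneg add_nonneg_nonneg simp: less_imp_le)
      ultimately show ?thesis using t0 by (auto intro!: mult_strict_mono')
    qed
    finally show False using i by simp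
  qed
  then show ?thesis using order_trans[OF wt[of i]] sp[of i] by (simp add: less_imp_le)
qed

lemma diagm_sandwich_entry:
  fixes A B :: "complex ^ 'n ^ 'n"
  shows "(A ** diagm d ** B) $ i $ m = (\<Sum>j\<in>UNIV. A $ i $ j * B $ j $ m * d j)"
proof -
  have "(A ** diagm d) $ i $ j = A $ i $ j * d j" for j
    by (simp add: matrix_matrix_mult_def diagm_def if_distrib cong: if_cong)
  then show ?thesis by (simp add: matrix_matrix_mult_def[of "A ** diagm d"] mult_ac)
qed

text \<open>This is \<open>L - R_map \<Gamma> G - Y\<close> with the diagonal matrices
  \<open>L\<close> and \<open>G\<close> replaced by their diagonals and the factor 1/N absorbed into
  \<open>\<sigma>\<close>.\<close>

definition pencil :: "('n \<Rightarrow> 'n \<Rightarrow> real) \<Rightarrow> complex ^ 'n ^ 'n \<Rightarrow> ('n \<Rightarrow> complex) \<Rightarrow> ('n::finite \<Rightarrow> complex) \<Rightarrow> complex ^ 'n ^ 'n" where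
  "pencil \<sigma> Y l g = diagm (\<lambda>i. l i - (\<Sum>j\<in>UNIV. of_real (\<sigma> i j) * g j)) - Y"

definition dyson_solution :: "('n \<Rightarrow> 'n \<Rightarrow> real) \<Rightarrow> complex ^ 'n ^ 'n \<Rightarrow> ('n \<Rightarrow> complex) \<Rightarrow> ('n::finite \<Rightarrow> complex) \<Rightarrow> bool" where
  "dyson_solution \<sigma> Y l g \<longleftrightarrow> (\<forall>i. Im (g i) < 0 \<and> g i = matrix_inv (pencil \<sigma> Y l g) $ i $ i)"

lemma dyson_solution_neg: "dyson_solution \<sigma> Y l g \<Longrightarrow> Im (g i) < 0"
  unfolding dyson_solution_def by blast

locale dyson =
  fixes \<sigma> :: "'n::finite \<Rightarrow> 'n \<Rightarrow> real" and Y :: "complex ^ 'n ^ 'n"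
  assumes sigma_nonneg: "0 \<le> \<sigma> i j" and hermitian_Y: "hermitian Y"
begin

lemma Im_pencil_diag: "Im (l i - (\<Sum>j\<in>UNIV. of_real (\<sigma> i j) * g j)) = Im (l i) + (\<Sum>j\<in>UNIV. \<sigma> i j * (- Im (g j)))"
  by (simp add: sum_negf)

lemma Im_pencil_diag_ge:
  assumes "\<And>i. Im (g i) \<le> 0"
  shows "Im (l i) \<le> Im (l i - (\<Sum>j\<in>UNIV. of_real (\<sigma> i j) * g j))"
  unfolding Im_pencil_diag using assms sigma_nonneg
  by (intro order_trans[OF _ add_left_mono[OF sum_nonneg]] mult_nonneg_nonneg) auto

lemma dissipative_pencil:
  assumes "\<And>i. c \<le> Im (l i)" "\<And>i. Im (g i) \<le> 0"
  shows "dissipative c (pencil \<sigma> Y l g)"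
  unfolding pencil_def
  by (rule dissipative_diagm_minus_hermitian[OF hermitian_Y]) (rule order_trans[OF assms(1) Im_pencil_diag_ge], rule assms(2))

lemma invertible_pencil:
  assumes "\<And>i. 0 < Im (l i)" "\<And>i. Im (g i) \<le> 0"
  shows "invertible (pencil \<sigma> Y l g)"
  unfolding pencil_def
  by (rule invertible_diagm_minus_hermitian[OF hermitian_Y]) (rule less_le_trans[OF assms(1) Im_pencil_diag_ge], rule assms(2))

text \<open>The Ward identity for the resolvent of \<open>Y\<close> at the diagonal parameter
  occurring in \<open>pencil\<close>, whose imaginary part is the bracket on the right. The unknown
  \<open>- Im g\<close> occurs on both sides with nonnegative coefficients, as
  \<open>comparison_principle\<close> demands.\<close>

lemma Im_dyson:
  assumes "dyson_solution \<sigma> Y l g" "\<And>i. 0 < Im (l i)"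
  defines "A \<equiv> matrix_inv (pencil \<sigma> Y l g)"
  shows "- Im (g i) = (\<Sum>j\<in>UNIV. (cmod (A $ i $ j))\<^sup>2 * (Im (l j) + (\<Sum>k\<in>UNIV. \<sigma> j k * (- Im (g k)))))"
    and "- Im (g i) = (\<Sum>j\<in>UNIV. (cmod (A $ j $ i))\<^sup>2 * (Im (l j) + (\<Sum>k\<in>UNIV. \<sigma> j k * (- Im (g k)))))"
proof -
  have neg: "Im (g i) \<le> 0" for i using assms(1) by (auto dest: dyson_solution_neg intro: less_imp_le)
  have pos: "0 < Im (l i - (\<Sum>j\<in>UNIV. of_real (\<sigma> i j) * g j))" for i
    by (rule less_le_trans[OF assms(2) Im_pencil_diag_ge]) (rule neg)
  have gA: "g i = A $ i $ i" using assms(1) by (simp add: dyson_solution_def A_def)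
  show "- Im (g i) = (\<Sum>j\<in>UNIV. (cmod (A $ i $ j))\<^sup>2 * (Im (l j) + (\<Sum>k\<in>UNIV. \<sigma> j k * (- Im (g k)))))"
    unfolding gA[of] A_def pencil_def
    by (subst Im_resolvent_row[OF hermitian_Y pos]) (simp only: Im_pencil_diag)
  show "- Im (g i) = (\<Sum>j\<in>UNIV. (cmod (A $ j $ i))\<^sup>2 * (Im (l j) + (\<Sum>k\<in>UNIV. \<sigma> j k * (- Im (g k)))))"
    unfolding gA[of] A_def pencil_def
    by (subst Im_resolvent_column[OF hermitian_Y pos]) (simp only: Im_pencil_diag)
qed

lemma pencil_diff:
  "pencil \<sigma> Y l' g' - pencil \<sigma> Y l g =
     diagm (\<lambda>j. (l' j - l j) + (\<Sum>k\<in>UNIV. of_real (\<sigma> j k) * (g k - g' k)))"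
  by (simp add: pencil_def diagm_def vec_eq_iff algebra_simps sum_subtractf)

text \<open>Diagonal entry of the resolvent identity. Two pencils with the same \<open>Y\<close>
  differ by a diagonal matrix, so the double sum collapses.\<close>

lemma dyson_diff:
  assumes "dyson_solution \<sigma> Y l g" "dyson_solution \<sigma> Y l' g'" "\<And>i. 0 < Im (l i)" "\<And>i. 0 < Im (l' i)"
  shows "g i - g' i = (\<Sum>j\<in>UNIV. matrix_inv (pencil \<sigma> Y l g) $ i $ j * matrix_inv (pencil \<sigma> Y l' g') $ j $ i
           * ((l' j - l j) + (\<Sum>k\<in>UNIV. of_real (\<sigma> j k) * (g k - g' k))))"
proof -
  have neg: "Im (g i) \<le> 0" "Im (g' i) \<le> 0" for i
    using assms(1,2) by (auto dest: dyson_solution_neg intro: less_imp_le)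
  let ?A = "matrix_inv (pencil \<sigma> Y l g)" and ?B = "matrix_inv (pencil \<sigma> Y l' g')"
  have "g i - g' i = (?A - ?B) $ i $ i"
    using assms(1,2) by (simp add: dyson_solution_def)
  also have "?A - ?B = ?A ** (pencil \<sigma> Y l' g' - pencil \<sigma> Y l g) ** ?B"
    by (intro resolvent_identity invertible_pencil assms neg)
  finally show ?thesis unfolding pencil_diff diagm_sandwich_entry .
qed

text \<open>\<open>dyson_diff\<close> involves row i of the resolvent of \<open>g\<close> and column
  i of that of \<open>g'\<close>, so the row form of \<open>Im_dyson\<close> serves for
  \<open>g\<close> and the column form for \<open>g'\<close>. The weight
  \<open>sqrt (Im (l i) * Im (l' i))\<close> in the hypothesis turns into the same expression in the
  solutions.\<close>

lemma dyson_stability: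
  assumes sol: "dyson_solution \<sigma> Y l g" "dyson_solution \<sigma> Y l' g'"
    and pos: "\<And>i. 0 < Im (l i)" "\<And>i. 0 < Im (l' i)"
    and c: "0 \<le> c" "\<And>i. cmod (l i - l' i) \<le> c * sqrt (Im (l i) * Im (l' i))"
  shows "cmod (g i - g' i) \<le> c * sqrt (Im (g i) * Im (g' i))"
proof -
  define A where "A = matrix_inv (pencil \<sigma> Y l g)"
  define B where "B = matrix_inv (pencil \<sigma> Y l' g')"
  have "cmod (g i - g' i) \<le> c * sqrt (- Im (g i) * - Im (g' i))"
  proof (rule comparison_principle[where \<sigma> = \<sigma> and u = "\<lambda>i. Im (l i)" and v = "\<lambda>i. Im (l' i)"
        and A = "\<lambda>i j. (cmod (A $ i $ j))\<^sup>2" and B = "\<lambda>i j. (cmod (B $ j $ i))\<^sup>2" and w = "\<lambda>i. cmod (g i - g' i)"])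
    show "- Im (g i) = (\<Sum>j\<in>UNIV. (cmod (A $ i $ j))\<^sup>2 * (Im (l j) + (\<Sum>k\<in>UNIV. \<sigma> j k * (- Im (g k)))))" for i
      unfolding A_def by (rule Im_dyson) fact+
    show "- Im (g' i) = (\<Sum>j\<in>UNIV. (cmod (B $ j $ i))\<^sup>2 * (Im (l' j) + (\<Sum>k\<in>UNIV. \<sigma> j k * (- Im (g' k)))))" for i
      unfolding B_def by (rule Im_dyson) fact+
    show "cmod (g i - g' i) \<le> (\<Sum>j\<in>UNIV. sqrt ((cmod (A $ i $ j))\<^sup>2 * (cmod (B $ j $ i))\<^sup>2) *
        (c * sqrt (Im (l j) * Im (l' j)) + (\<Sum>k\<in>UNIV. \<sigma> j k * cmod (g k - g' k))))" for i
    proof -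
      have "cmod (g i - g' i) = cmod (\<Sum>j\<in>UNIV. A $ i $ j * B $ j $ i
           * ((l' j - l j) + (\<Sum>k\<in>UNIV. of_real (\<sigma> j k) * (g k - g' k))))"
        unfolding A_def B_def using dyson_diff[OF sol pos, of i] by simp
      also have "\<dots> \<le> (\<Sum>j\<in>UNIV. cmod (A $ i $ j * B $ j $ i
           * ((l' j - l j) + (\<Sum>k\<in>UNIV. of_real (\<sigma> j k) * (g k - g' k)))))"
        by (rule norm_sum)
      also have "\<dots> \<le> (\<Sum>j\<in>UNIV. sqrt ((cmod (A $ i $ j))\<^sup>2 * (cmod (B $ j $ i))\<^sup>2) *
        (c * sqrt (Im (l j) * Im (l' j)) + (\<Sum>k\<in>UNIV. \<sigma> j k * cmod (g k - g' k))))"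
      proof (intro sum_mono)
        fix j
        have "cmod ((l' j - l j) + (\<Sum>k\<in>UNIV. of_real (\<sigma> j k) * (g k - g' k)))
            \<le> cmod (l' j - l j) + (\<Sum>k\<in>UNIV. cmod (of_real (\<sigma> j k) * (g k - g' k)))"
          by (rule order_trans[OF norm_triangle_ineq add_left_mono[OF norm_sum]])
        also have "\<dots> \<le> c * sqrt (Im (l j) * Im (l' j)) + (\<Sum>k\<in>UNIV. \<sigma> j k * cmod (g k - g' k))"
          using c(2)[of j] sigma_nonneg by (simp add: norm_mult norm_minus_commute)
        finally show "cmod (A $ i $ j * B $ j $ i * ((l' j - l j) + (\<Sum>k\<in>UNIV. of_real (\<sigma> j k) * (g k - g' k))))
          \<le> sqrt ((cmod (A $ i $ j))\<^sup>2 * (cmod (B $ j $ i))\<^sup>2) *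
            (c * sqrt (Im (l j) * Im (l' j)) + (\<Sum>k\<in>UNIV. \<sigma> j k * cmod (g k - g' k)))"
          by (simp add: norm_mult real_sqrt_mult mult_left_mono)
      qed
      finally show ?thesis .
    qed
  qed (use sol pos c sigma_nonneg in \<open>auto dest: dyson_solution_neg\<close>)
  then show ?thesis by simp
qed

lemma dyson_unique:
  assumes "dyson_solution \<sigma> Y l g" "dyson_solution \<sigma> Y l g'" "\<And>i. 0 < Im (l i)"
  shows "g = g'"
  using dyson_stability[OF assms(1,2,3,3), of 0] by (simp add: fun_eq_iff)

lemma dyson_cmod_le:
  assumes "dyson_solution \<sigma> Y l g" "\<And>i. c \<le> Im (l i)" "0 < c"
  shows "cmod (g i) \<le> 1 / c"
proof -
  have "Im (g i) \<le> 0" for i using assms(1) by (auto dest: dyson_solution_neg intro: less_imp_le)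
  then have "cmod (matrix_inv (pencil \<sigma> Y l g) $ i $ i) \<le> 1 / c"
    by (intro cmod_entry_dissipative_inv dissipative_pencil assms)
  moreover have "g i = matrix_inv (pencil \<sigma> Y l g) $ i $ i"
    using assms(1) unfolding dyson_solution_def by blast
  ultimately show ?thesis by simp
qed

text \<open>One factor \<open>1 / sqrt (a * b)\<close> expresses \<open>e\<close> relative to
  \<open>sqrt (Im (l i) * Im (l' i))\<close>; the other bounds
  \<open>sqrt (Im (g i) * Im (g' i))\<close>, since solutions are at most 1/a and 1/b in modulus.
  The constant is the one of the case \<open>\<sigma> = 0\<close>.\<close>

lemma dyson_lipschitz:
  assumes sol: "dyson_solution \<sigma> Y l g" "dyson_solution \<sigma> Y l' g'"
    and ge: "\<And>i. a \<le> Im (l i)" "\<And>i. b \<le> Im (l' i)" "0 < a" "0 < b"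
    and e: "\<And>i. cmod (l i - l' i) \<le> e"
  shows "cmod (g i - g' i) \<le> e / (a * b)"
proof -
  have e0: "0 \<le> e" using e[of undefined] norm_ge_zero order_trans by blast
  have "e \<le> e / sqrt (a * b) * sqrt (Im (l i) * Im (l' i))" for i
  proof -
    have "a * b \<le> Im (l i) * Im (l' i)" using ge(1,2)[of i] ge(3,4) by (intro mult_mono) auto
    then have "sqrt (a * b) \<le> sqrt (Im (l i) * Im (l' i))" by simp
    then have "e * sqrt (a * b) \<le> e * sqrt (Im (l i) * Im (l' i))" using e0 by (rule mult_left_mono)
    then show ?thesis using ge(3,4) by (simp add: field_simps)
  qed
  then have "cmod (g i - g' i) \<le> e / sqrt (a * b) * sqrt (Im (g i) * Im (g' i))"
    using e e0 ge by (intro dyson_stability[OF sol]) (auto intro: less_le_trans order_trans)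
  also have "\<dots> \<le> e / sqrt (a * b) * sqrt ((1 / a) * (1 / b))"
  proof -
    have "Im (g i) < 0" "Im (g' i) < 0" using sol by (auto dest: dyson_solution_neg)
    moreover have "- Im (g i) \<le> 1 / a" "- Im (g' i) \<le> 1 / b"
      using dyson_cmod_le[OF sol(1) ge(1,3), of i] dyson_cmod_le[OF sol(2) ge(2,4), of i]
        abs_Im_le_cmod[of "g i"] abs_Im_le_cmod[of "g' i"] by linarith+
    ultimately have "- Im (g i) * - Im (g' i) \<le> (1 / a) * (1 / b)"
      using ge by (intro mult_mono) auto
    then show ?thesis using e0 ge by (intro mult_left_mono) auto
  qed
  also have "\<dots> = e / (a * b)"
    using ge by (simp add: real_sqrt_divide real_sqrt_mult field_simps)
  finally show ?thesis .
qed

text \<open>Brouwer needs a compact set, so the half-plane is closed: \<open>S\<close> only asks for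
  a nonpositive imaginary part. Strict negativity returns because every value of \<open>F\<close>
  has it. The radius 1/c comes from the dissipativity of the pencil and makes \<open>S\<close>
  invariant.\<close>

lemma dyson_solution_exists:
  assumes "\<And>i. 0 < Im (l i)"
  shows "\<exists>g. dyson_solution \<sigma> Y l g"
proof -
  obtain c where c: "0 < c" "\<And>i. c \<le> Im (l i)"
    using ex_positive_lower_bound[of "\<lambda>i. Im (l i)"] assms by auto
  define S where "S = {g :: complex ^ 'n. (\<forall>i. cmod (g $ i) \<le> 1 / c) \<and> (\<forall>i. Im (g $ i) \<le> 0)}"
  define F where "F g = (\<chi> i. matrix_inv (pencil \<sigma> Y l (($) g)) $ i $ i)" for g
  have Seq: "S = (\<Inter>i. {g. cmod (g $ i) \<le> 1 / c} \<inter> {g. Im (g $ i) \<le> 0})" by (auto simp: S_def)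
  have closed: "closed S" unfolding Seq
    by (intro closed_INT ballI closed_Int closed_Collect_le continuous_intros)
  have bounded: "bounded S"
  proof (rule boundedI)
    fix g assume "g \<in> S"
    have "norm g \<le> (\<Sum>i\<in>UNIV. norm (g $ i))"
      unfolding norm_vec_def by (rule L2_set_le_sum) simp
    also have "\<dots> \<le> (\<Sum>i\<in>(UNIV :: 'n set). 1 / c)"
      using \<open>g \<in> S\<close> by (intro sum_mono) (simp add: S_def)
    finally show "norm g \<le> (\<Sum>i\<in>(UNIV :: 'n set). 1 / c)" .
  qed
  have convex: "convex S"
  proof (rule convexI)
    fix x y :: "complex ^ 'n" and u v :: real
    assume xy: "x \<in> S" "y \<in> S" and uv: "0 \<le> u" "0 \<le> v" "u + v = 1"
    have "cmod (u *\<^sub>R x $ i + v *\<^sub>R y $ i) \<le> 1 / c" for i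
    proof -
      have "cmod (u *\<^sub>R x $ i + v *\<^sub>R y $ i) \<le> u * cmod (x $ i) + v * cmod (y $ i)"
        using uv norm_triangle_ineq[of "u *\<^sub>R x $ i" "v *\<^sub>R y $ i"] by simp
      also have "\<dots> \<le> u * (1 / c) + v * (1 / c)"
        using xy uv by (intro add_mono mult_left_mono) (auto simp: S_def)
      also have "\<dots> = 1 / c" using uv(3) by (metis distrib_right mult_1)
      finally show ?thesis .
    qed
    moreover have "u * Im (x $ i) + v * Im (y $ i) \<le> 0" for i
      using xy uv by (intro add_nonpos_nonpos mult_nonneg_nonpos) (auto simp: S_def)
    ultimately show "u *\<^sub>R x + v *\<^sub>R y \<in> S" by (simp add: S_def)
  qed
  have neg: "Im (F g $ i) < 0" if "g \<in> S" for g i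
  proof -
    have "0 < Im (l i - (\<Sum>j\<in>UNIV. of_real (\<sigma> i j) * g $ j))" for i
      by (rule less_le_trans[OF assms Im_pencil_diag_ge]) (use that in \<open>simp add: S_def\<close>)
    from Im_resolvent_neg[OF hermitian_Y this] show ?thesis by (simp add: F_def pencil_def)
  qed
  have diss: "dissipative c (pencil \<sigma> Y l (($) g))" if "g \<in> S" for g
    by (rule dissipative_pencil) (use that c in \<open>auto simp: S_def\<close>)
  have "continuous_on S F"
    unfolding F_def pencil_def
    by (intro continuous_on_vec_lambda continuous_intros
         continuous_on_matrix_inv_dissipative[where c = c, OF _ diss[unfolded pencil_def] c(1)])
  moreover have "F \<in> S \<rightarrow> S"
    using neg cmod_entry_dissipative_inv[OF diss c(1)] by (auto simp: S_def F_def intro: less_imp_le)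
  moreover have "S \<noteq> {}" using c(1) by (auto simp: S_def intro!: exI[of _ 0])
  ultimately obtain g where g: "g \<in> S" "F g = g"
    using brouwer[of S F] closed bounded convex by (auto simp: compact_eq_bounded_closed)
  have "dyson_solution \<sigma> Y l (($) g)"
    unfolding dyson_solution_def
  proof (intro allI conjI)
    fix i
    show "Im (g $ i) < 0" using neg[OF g(1), of i] g(2) by simp
    show "g $ i = matrix_inv (pencil \<sigma> Y l (($) g)) $ i $ i"
      by (subst g(2)[symmetric]) (simp add: F_def)
  qed
  then show ?thesis by blast
qed

section \<open>Analytic dependence of the solution on the spectral parameters\<close>

definition dyson_sol :: "('n \<Rightarrow> complex) \<Rightarrow> 'n \<Rightarrow> complex" where
  "dyson_sol l = (SOME g. dyson_solution \<sigma> Y l g)"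

lemma dyson_solution_dyson_sol:
  "(\<And>i. 0 < Im (l i)) \<Longrightarrow> dyson_solution \<sigma> Y l (dyson_sol l)"
  unfolding dyson_sol_def using dyson_solution_exists by (rule someI_ex)

text \<open>The comparison principle with source coefficient 0, where the row and the column
  identity are used for one and the same resolvent.\<close>

lemma dyson_linearization_injective:
  assumes sol: "dyson_solution \<sigma> Y l g" and pos: "\<And>i. 0 < Im (l i)"
  defines "A \<equiv> matrix_inv (pencil \<sigma> Y l g)"
  assumes q: "\<And>i. q i = (\<Sum>j\<in>UNIV. A $ i $ j * A $ j $ i * (\<Sum>k\<in>UNIV. of_real (\<sigma> j k) * q k))"
  shows "q i = 0"
proof -
  have "cmod (q i) \<le> 0 * sqrt (- Im (g i) * - Im (g i))"
  proof (rule comparison_principle[where \<sigma> = \<sigma> and u = "\<lambda>i. Im (l i)" and v = "\<lambda>i. Im (l i)"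
        and A = "\<lambda>i j. (cmod (A $ i $ j))\<^sup>2" and B = "\<lambda>i j. (cmod (A $ j $ i))\<^sup>2" and w = "\<lambda>i. cmod (q i)"])
    show "- Im (g i) = (\<Sum>j\<in>UNIV. (cmod (A $ i $ j))\<^sup>2 * (Im (l j) + (\<Sum>k\<in>UNIV. \<sigma> j k * (- Im (g k)))))" for i
      unfolding A_def by (rule Im_dyson) fact+
    show "- Im (g i) = (\<Sum>j\<in>UNIV. (cmod (A $ j $ i))\<^sup>2 * (Im (l j) + (\<Sum>k\<in>UNIV. \<sigma> j k * (- Im (g k)))))" for i
      unfolding A_def by (rule Im_dyson) fact+
    show "cmod (q i) \<le> (\<Sum>j\<in>UNIV. sqrt ((cmod (A $ i $ j))\<^sup>2 * (cmod (A $ j $ i))\<^sup>2) *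
        (0 * sqrt (Im (l j) * Im (l j)) + (\<Sum>k\<in>UNIV. \<sigma> j k * cmod (q k))))" for i
    proof -
      have "cmod (q i) = cmod (\<Sum>j\<in>UNIV. A $ i $ j * A $ j $ i * (\<Sum>k\<in>UNIV. of_real (\<sigma> j k) * q k))"
        using q[of i] by simp
      also have "\<dots> \<le> (\<Sum>j\<in>UNIV. cmod (A $ i $ j * A $ j $ i * (\<Sum>k\<in>UNIV. of_real (\<sigma> j k) * q k)))"
        by (rule norm_sum)
      also have "\<dots> \<le> (\<Sum>j\<in>UNIV. sqrt ((cmod (A $ i $ j))\<^sup>2 * (cmod (A $ j $ i))\<^sup>2) *
        (0 * sqrt (Im (l j) * Im (l j)) + (\<Sum>k\<in>UNIV. \<sigma> j k * cmod (q k))))"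
      proof (intro sum_mono)
        fix j
        have "cmod (\<Sum>k\<in>UNIV. of_real (\<sigma> j k) * q k) \<le> (\<Sum>k\<in>UNIV. cmod (of_real (\<sigma> j k) * q k))"
          by (rule norm_sum)
        then have "cmod (\<Sum>k\<in>UNIV. of_real (\<sigma> j k) * q k) \<le> (\<Sum>k\<in>UNIV. \<sigma> j k * cmod (q k))"
          using sigma_nonneg by (simp add: norm_mult)
        then show "cmod (A $ i $ j * A $ j $ i * (\<Sum>k\<in>UNIV. of_real (\<sigma> j k) * q k))
          \<le> sqrt ((cmod (A $ i $ j))\<^sup>2 * (cmod (A $ j $ i))\<^sup>2) *
            (0 * sqrt (Im (l j) * Im (l j)) + (\<Sum>k\<in>UNIV. \<sigma> j k * cmod (q k)))"
          by (simp add: norm_mult real_sqrt_mult mult_left_mono)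
      qed
      finally show ?thesis .
    qed
  qed (use sol pos sigma_nonneg in \<open>auto dest: dyson_solution_neg\<close>)
  then show ?thesis by simp
qed

text \<open>
  Difference quotients of the solution solve a perturbation of the linearized equation, whose
  operator is injective, hence bounded below.
\<close>

lemma dyson_sol_holomorphic:
  assumes L: "\<And>i. 0 < Im (L i)"
  shows "(\<lambda>z. dyson_sol (\<lambda>m. if m = k then z else L m) i) holomorphic_on {z. Im z > 0}"
proof -
  define lz where "lz z = (\<lambda>m. if m = k then z else L m)" for z
  define g where "g z = dyson_sol (lz z)" for z
  have "\<exists>D. ((\<lambda>z. g z i) has_field_derivative D) (at z0)" if z0: "Im z0 > 0" for z0 i
  proof -
    obtain c0 where c0: "0 < c0" "\<And>i. c0 \<le> Im (L i)"
      using ex_positive_lower_bound[of "\<lambda>i. Im (L i)"] L by auto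
    \<comment> \<open>On the half-plane \<open>U\<close> all coordinates of the parameter keep
      imaginary part at least \<open>c\<close>, which makes the Lipschitz and resolvent bounds
      uniform near \<open>z0\<close>.\<close>
    define c where "c = min c0 (Im z0 / 2)"
    have c: "0 < c" using c0 z0 by (simp add: c_def)
    define U where "U = {z. Im z > Im z0 / 2}"
    have "open U" unfolding U_def by (rule open_halfspace_Im_gt)
    then have U: "open U" "z0 \<in> U"
      using z0 by (simp_all add: U_def)
    have lzc: "c \<le> Im (lz z m)" if "z \<in> U" for z m
      using that c0(2)[of m] unfolding U_def lz_def c_def by auto
    have lzpos: "0 < Im (lz z m)" if "z \<in> U" for z m
      using lzc[OF that, of m] c by linarith
    have sol: "dyson_solution \<sigma> Y (lz z) (g z)" if "z \<in> U" for z
      unfolding g_def by (rule dyson_solution_dyson_sol) (rule lzpos[OF that])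
    have neg: "Im (g z m) \<le> 0" if "z \<in> U" for z m
      using dyson_solution_neg[OF sol[OF that], of m] by simp
    have lip: "cmod (g z m - g z' m) \<le> cmod (z - z') / (c * c)" if "z \<in> U" "z' \<in> U" for z z' m
      by (rule dyson_lipschitz[OF sol sol lzc lzc c c]) (use that in \<open>auto simp: lz_def\<close>)
    have contg: "continuous_on U (\<lambda>z. g z m)" for m
    proof (rule lipschitz_on_continuous_on[of "1 / (c * c)"], rule lipschitz_onI)
      show "dist (g z m) (g z' m) \<le> 1 / (c * c) * dist z z'" if "z \<in> U" "z' \<in> U" for z z'
        using lip[OF that, of m] by (simp add: dist_norm)
    qed (use c in simp)
    have contl: "continuous_on U (\<lambda>z. lz z m)" for m
      by (cases "m = k") (simp_all add: lz_def continuous_on_id)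
    define A where "A z = matrix_inv (pencil \<sigma> Y (lz z) (g z))" for z
    have "continuous_on U A"
      unfolding A_def
    proof (rule continuous_on_matrix_inv_dissipative[OF _ _ c])
      show "continuous_on U (\<lambda>z. pencil \<sigma> Y (lz z) (g z))"
        unfolding pencil_def by (intro continuous_intros contl contg)
      show "dissipative c (pencil \<sigma> Y (lz z) (g z))" if "z \<in> U" for z
        by (rule dissipative_pencil) (use that lzc neg in auto)
    qed
    then have Acont: "isCont A z0" using U continuous_on_eq_continuous_at by blast
    define K where "K z m j = A z $ m $ j * A z0 $ j $ m" for z m j
    have Klim: "((\<lambda>z. K z m j) \<longlongrightarrow> K z0 m j) (at z0)" for m j
      unfolding K_def using Acont by (auto intro!: tendsto_intros simp: isCont_def)
    \<comment> \<open>Identity minus the linearized feedback at \<open>z0\<close>. In finite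
      dimension injectivity yields both a lower bound, used for the error estimate, and
      surjectivity, used to define the derivative.\<close>
    define T where "T v = (\<chi> m. v $ m - (\<Sum>j\<in>UNIV. K z0 m j * (\<Sum>n\<in>UNIV. of_real (\<sigma> j n) * v $ n)))"
      for v :: "complex ^ 'n"
    have lin: "linear T"
    proof (rule linearI)
      show "T (x + y) = T x + T y" for x y
        by (simp add: T_def vec_eq_iff algebra_simps sum.distrib)
      show "T (r *\<^sub>R x) = r *\<^sub>R T x" for r x
        by (simp add: T_def vec_eq_iff scaleR_right_diff_distrib flip: scaleR_sum_right)
    qed
    have inj: "inj T"
    proof (subst linear_inj_iff_eq_0[OF lin], intro allI impI)
      fix v assume "T v = 0"
      then have Tv: "T v $ m = 0" for m by simp
      have "v $ m = (\<Sum>j\<in>UNIV. A z0 $ m $ j * A z0 $ j $ m * (\<Sum>k\<in>UNIV. of_real (\<sigma> j k) * v $ k))" for m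
        using Tv[of m] unfolding T_def K_def vec_lambda_beta by (rule eq_iff_diff_eq_0[THEN iffD2])
      then have "v $ m = 0" for m
        unfolding A_def by (rule dyson_linearization_injective[OF sol[OF U(2)] lzpos[OF U(2)], where q = "($) v"])
      then show "v = 0" by (simp add: vec_eq_iff)
    qed
    obtain B where B: "0 < B" "\<And>v. B * norm v \<le> norm (T v)"
      using linear_inj_bounded_below_pos[OF lin inj] by blast
    have "surj T" by (rule linear_injective_imp_surjective[OF lin inj]) simp
    \<comment> \<open>The candidate derivative. The source is column \<open>k\<close> of the kernel
      because only coordinate \<open>k\<close> of the parameter moves; the sign stems from the order
      of the parameters in \<open>dyson_diff\<close>.\<close>
    then obtain q0 where q0: "T q0 = (\<chi> m. - K z0 m k)" by (metis surj_def)
    define q where "q z = (\<chi> m. (g z m - g z0 m) / (z - z0))" for z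
    have q_eq: "q z $ m = - K z m k + (\<Sum>j\<in>UNIV. K z m j * (\<Sum>n\<in>UNIV. of_real (\<sigma> j n) * q z $ n))"
      if z: "z \<in> U" "z \<noteq> z0" for z m
    proof -
      have "g z m - g z0 m = (\<Sum>j\<in>UNIV. K z m j * ((lz z0 j - lz z j)
           + (\<Sum>n\<in>UNIV. of_real (\<sigma> j n) * (g z n - g z0 n))))"
        unfolding K_def A_def by (rule dyson_diff) (use z U sol lzpos in auto)
      also have "\<dots> = (\<Sum>j\<in>UNIV. K z m j * ((if j = k then z0 - z else 0)
           + (\<Sum>n\<in>UNIV. of_real (\<sigma> j n) * ((z - z0) * q z $ n))))"
        using z by (intro sum.cong refl) (simp add: lz_def q_def)
      also have "\<dots> = (z - z0) * (- K z m k + (\<Sum>j\<in>UNIV. K z m j * (\<Sum>n\<in>UNIV. of_real (\<sigma> j n) * q z $ n)))"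
      proof -
        have "K z m j * ((if j = k then z0 - z else 0) + (\<Sum>n\<in>UNIV. of_real (\<sigma> j n) * ((z - z0) * q z $ n)))
          = (z - z0) * ((if j = k then - K z m j else 0) + K z m j * (\<Sum>n\<in>UNIV. of_real (\<sigma> j n) * q z $ n))" for j
        proof -
          have "(\<Sum>n\<in>UNIV. of_real (\<sigma> j n) * ((z - z0) * q z $ n)) = (z - z0) * (\<Sum>n\<in>UNIV. of_real (\<sigma> j n) * q z $ n)"
            unfolding sum_distrib_left by (intro sum.cong refl mult.left_commute)
          then show ?thesis by (simp only:) (cases "j = k"; simp add: algebra_simps)
        qed
        then show ?thesis by (simp add: sum.distrib flip: sum_distrib_left)
      qed
      finally show ?thesis using z by (simp add: q_def)
    qed
    have q_le: "cmod (q z $ m) \<le> 1 / (c * c)" if "z \<in> U" "z \<noteq> z0" for z m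
      using lip[OF that(1) U(2), of m] that c by (simp add: q_def norm_divide field_simps)
    \<comment> \<open>Bounds the effect of replacing the kernel \<open>K z\<close> by
      \<open>K z0\<close>. The difference quotients are bounded by the Lipschitz estimate, so
      continuity of the kernel forces this to 0.\<close>
    define E where "E z = (\<Sum>m\<in>UNIV. cmod (K z m k - K z0 m k)
       + (\<Sum>j\<in>UNIV. cmod (K z m j - K z0 m j) * (\<Sum>n\<in>UNIV. \<sigma> j n * (1 / (c * c)))))" for z
    have "((\<lambda>z. E z / B) \<longlongrightarrow> (\<Sum>m\<in>UNIV. cmod (K z0 m k - K z0 m k)
       + (\<Sum>j\<in>UNIV. cmod (K z0 m j - K z0 m j) * (\<Sum>n\<in>UNIV. \<sigma> j n * (1 / (c * c))))) / B) (at z0)"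
      unfolding E_def using B by (intro tendsto_intros Klim) auto
    then have E0: "((\<lambda>z. E z / B) \<longlongrightarrow> 0) (at z0)" by simp
    have "norm (q z - q0) \<le> E z / B" if z: "z \<in> U" "z \<noteq> z0" for z
    proof -
      have T_entry: "T (q z - q0) $ m = - (K z m k - K z0 m k)
          + (\<Sum>j\<in>UNIV. (K z m j - K z0 m j) * (\<Sum>n\<in>UNIV. of_real (\<sigma> j n) * q z $ n))" for m
      proof -
        have "T (q z - q0) $ m = T (q z) $ m + K z0 m k"
          by (simp add: linear_diff[OF lin] q0)
        also have "T (q z) $ m = q z $ m - (\<Sum>j\<in>UNIV. K z0 m j * (\<Sum>n\<in>UNIV. of_real (\<sigma> j n) * q z $ n))"
          by (simp add: T_def)
        finally show ?thesis
          using q_eq[OF z, of m] by (simp add: left_diff_distrib sum_subtractf)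
      qed
      have "B * norm (q z - q0) \<le> norm (T (q z - q0))" by (rule B(2))
      also have "\<dots> \<le> (\<Sum>m\<in>UNIV. norm (T (q z - q0) $ m))"
        unfolding norm_vec_def by (rule L2_set_le_sum) simp
      also have "\<dots> \<le> E z"
        unfolding E_def T_entry
      proof (intro sum_mono order_trans[OF norm_triangle_ineq] add_mono order_trans[OF norm_sum])
        fix m j
        have "cmod (\<Sum>n\<in>UNIV. of_real (\<sigma> j n) * q z $ n) \<le> (\<Sum>n\<in>UNIV. \<sigma> j n * (1 / (c * c)))"
          by (intro order_trans[OF norm_sum] sum_mono)
            (simp only: norm_mult norm_of_real abs_of_nonneg[OF sigma_nonneg] mult_left_mono[OF q_le[OF z] sigma_nonneg])
        then show "cmod ((K z m j - K z0 m j) * (\<Sum>n\<in>UNIV. of_real (\<sigma> j n) * q z $ n))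
          \<le> cmod (K z m j - K z0 m j) * (\<Sum>n\<in>UNIV. \<sigma> j n * (1 / (c * c)))"
          unfolding norm_mult by (rule mult_left_mono) simp
      qed (simp add: norm_minus_commute)
      finally show ?thesis using B(1) by (simp add: field_simps)
    qed
    moreover have "\<forall>\<^sub>F z in at z0. z \<in> U \<and> z \<noteq> z0"
      using U by (auto simp: eventually_at_topological)
    ultimately have "\<forall>\<^sub>F z in at z0. norm (q z - q0) \<le> E z / B"
      by (auto elim: eventually_mono)
    then have "((\<lambda>z. q z - q0) \<longlongrightarrow> 0) (at z0)"
      by (rule Lim_null_comparison[OF _ E0])
    then have "((\<lambda>z. q z $ i) \<longlongrightarrow> q0 $ i) (at z0)"
      by (intro tendsto_vec_nth) (simp add: LIM_zero_iff)
    then show ?thesis unfolding has_field_derivative_iff by (auto simp: q_def)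
  qed
  then have "(\<lambda>z. g z i) holomorphic_on {z. Im z > 0}"
    by (metis (no_types, lifting) field_differentiable_at_within field_differentiable_def holomorphic_onI mem_Collect_eq)
  then show ?thesis by (simp add: g_def lz_def)
qed

end

section \<open>Translation to the matrix equation\<close>

definition scaled_profile :: "real ^ 'n ^ 'n \<Rightarrow> 'n::finite \<Rightarrow> 'n \<Rightarrow> real" where
  "scaled_profile \<Gamma> i j = \<Gamma> $ i $ j / real CARD('n)"

lemma dyson_scaled_profile: "variance_profile \<Gamma> \<Longrightarrow> hermitian Y \<Longrightarrow> dyson (scaled_profile \<Gamma>) Y"
  by unfold_locales (simp_all add: variance_profile_def scaled_profile_def)

lemma is_diag_eq_diagm: "is_diag L \<Longrightarrow> L = diagm (\<lambda>i. L $ i $ i)"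
  by (simp add: is_diag_def diagm_def vec_eq_iff)

lemma diagm_nth: "diagm f $ i $ j = (if i = j then f i else 0)"
  by (simp add: diagm_def)

lemma diff_R_map_eq_pencil:
  assumes "is_diag L"
  shows "L - R_map \<Gamma> G - Y = pencil (scaled_profile \<Gamma>) Y (\<lambda>i. L $ i $ i) (\<lambda>i. G $ i $ i)"
  using assms by (auto simp: pencil_def R_map_def diagm_def scaled_profile_def vec_eq_iff is_diag_def)

lemma fixed_point_imp_dyson_solution:
  assumes "L \<in> Dplus" "G \<in> Dminus" "G = diag_part (matrix_inv (L - R_map \<Gamma> G - Y))"
  shows "dyson_solution (scaled_profile \<Gamma>) Y (\<lambda>i. L $ i $ i) (\<lambda>i. G $ i $ i)"
  unfolding dyson_solution_def
proof (intro allI conjI)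
  fix i
  show "Im (G $ i $ i) < 0" using assms(2) by (simp add: Dminus_def)
  have "L - R_map \<Gamma> G - Y = pencil (scaled_profile \<Gamma>) Y (\<lambda>i. L $ i $ i) (\<lambda>i. G $ i $ i)"
    by (rule diff_R_map_eq_pencil) (use assms(1) in \<open>simp add: Dplus_def\<close>)
  then show "G $ i $ i = matrix_inv (pencil (scaled_profile \<Gamma>) Y (\<lambda>i. L $ i $ i) (\<lambda>i. G $ i $ i)) $ i $ i"
    by (subst assms(3)) (simp add: diag_part_def diagm_nth)
qed

lemma fixed_point_solution_dyson_sol:
  assumes "variance_profile \<Gamma>" "hermitian Y"
  defines "G \<equiv> restrict (\<lambda>L. diagm (dyson.dyson_sol (scaled_profile \<Gamma>) Y (\<lambda>i. L $ i $ i))) Dplus"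
  shows "fixed_point_solution \<Gamma> Y G"
proof -
  interpret dyson "scaled_profile \<Gamma>" Y by (rule dyson_scaled_profile) fact+
  have GL: "G L = diagm (dyson_sol (\<lambda>i. L $ i $ i))" if "L \<in> Dplus" for L
    using that by (simp add: G_def)
  have sol: "dyson_solution (scaled_profile \<Gamma>) Y (\<lambda>i. L $ i $ i) (dyson_sol (\<lambda>i. L $ i $ i))" if "L \<in> Dplus" for L
    by (rule dyson_solution_dyson_sol) (use that in \<open>simp add: Dplus_def\<close>)
  have "G \<in> Dplus \<rightarrow>\<^sub>E Dminus"
  proof
    fix L :: "complex ^ 'a ^ 'a" assume "L \<in> Dplus"
    then show "G L \<in> Dminus"
      using dyson_solution_neg[OF sol[OF \<open>L \<in> Dplus\<close>]] GL by (simp add: Dminus_def is_diag_def diagm_nth)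
  qed (simp add: G_def)
  moreover have "analytic_in_each_variable G"
    unfolding analytic_in_each_variable_def
  proof (intro ballI allI)
    fix L :: "complex ^ 'a ^ 'a" and k i j assume L: "L \<in> Dplus"
    let ?D = "\<lambda>z. diagm (\<lambda>l. if l = k then z else L $ l $ l)"
    have inD: "?D z \<in> Dplus" if "Im z > 0" for z
      using L that by (simp add: Dplus_def is_diag_def diagm_nth)
    have "(\<lambda>z. if i = j then dyson_sol (\<lambda>m. if m = k then z else L $ m $ m) i else 0) holomorphic_on {z. Im z > 0}"
      by (cases "i = j") (use L in \<open>auto intro!: dyson_sol_holomorphic simp: Dplus_def\<close>)
    then have "(\<lambda>z. G (?D z) $ i $ j) holomorphic_on {z. Im z > 0}"
      by (rule holomorphic_transform) (simp add: GL[OF inD] diagm_nth)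
    then show "(\<lambda>z. G (?D z) $ i $ j) analytic_on {z. Im z > 0}"
      by (simp add: analytic_on_open open_halfspace_Im_gt)
  qed
  moreover have "G L = diag_part (matrix_inv (L - R_map \<Gamma> (G L) - Y))" if L: "L \<in> Dplus" for L
  proof -
    have "L - R_map \<Gamma> (G L) - Y = pencil (scaled_profile \<Gamma>) Y (\<lambda>i. L $ i $ i) (dyson_sol (\<lambda>i. L $ i $ i))"
      using L by (subst diff_R_map_eq_pencil) (simp_all add: Dplus_def GL diagm_nth)
    then have "dyson_sol (\<lambda>i. L $ i $ i) = (\<lambda>i. matrix_inv (L - R_map \<Gamma> (G L) - Y) $ i $ i)"
      using sol[OF L] unfolding dyson_solution_def by (intro ext) simp
    then show ?thesis using GL[OF L] unfolding diag_part_def by (simp only:)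
  qed
  ultimately show ?thesis by (simp add: fixed_point_solution_def)
qed

text \<open>Uniqueness is pointwise: at each parameter in \<open>Dplus\<close> two values solve the
  same scalar equation. Neither continuity nor analyticity of the competing solution enters.\<close>

theorem ex1_fixed_point_solution:
  assumes "variance_profile \<Gamma>" "hermitian Y"
  shows "\<exists>!G. fixed_point_solution \<Gamma> Y G"
proof (rule ex_ex1I)
  show "\<exists>G. fixed_point_solution \<Gamma> Y G" using fixed_point_solution_dyson_sol[OF assms] by blast
  fix G G' :: "complex ^ 'a ^ 'a \<Rightarrow> complex ^ 'a ^ 'a"
  assume G: "fixed_point_solution \<Gamma> Y G" and G': "fixed_point_solution \<Gamma> Y G'"
  interpret dyson "scaled_profile \<Gamma>" Y by (rule dyson_scaled_profile) fact+
  have "G L = G' L" for L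
  proof (cases "L \<in> Dplus")
    case True
    have D: "G L \<in> Dminus" "G' L \<in> Dminus"
      using G G' True by (auto simp: fixed_point_solution_def PiE_def)
    have "(\<lambda>i. G L $ i $ i) = (\<lambda>i. G' L $ i $ i)"
    proof (rule dyson_unique)
      show "dyson_solution (scaled_profile \<Gamma>) Y (\<lambda>i. L $ i $ i) (\<lambda>i. G L $ i $ i)"
        by (rule fixed_point_imp_dyson_solution[OF True D(1)]) (use G True in \<open>simp add: fixed_point_solution_def\<close>)
      show "dyson_solution (scaled_profile \<Gamma>) Y (\<lambda>i. L $ i $ i) (\<lambda>i. G' L $ i $ i)"
        by (rule fixed_point_imp_dyson_solution[OF True D(2)]) (use G' True in \<open>simp add: fixed_point_solution_def\<close>)
    qed (use True in \<open>simp add: Dplus_def\<close>)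
    then show ?thesis
      using is_diag_eq_diagm[of "G L"] is_diag_eq_diagm[of "G' L"] D by (simp add: Dminus_def)
  next
    case False
    then show ?thesis using G G' by (auto simp: fixed_point_solution_def PiE_def extensional_def)
  qed
  then show "G = G'" by (rule ext)
qed

lemma dyson_solution_G_box:
  assumes "variance_profile \<Gamma>" "hermitian Y" "L \<in> Dplus"
  shows "dyson_solution (scaled_profile \<Gamma>) Y (\<lambda>i. L $ i $ i) (\<lambda>i. G_box \<Gamma> Y L $ i $ i)"
    and "is_diag (G_box \<Gamma> Y L)"
proof -
  have fp: "fixed_point_solution \<Gamma> Y (G_box \<Gamma> Y)"
    unfolding G_box_def using ex1_fixed_point_solution[OF assms(1,2)] by (rule theI')
  then have D: "G_box \<Gamma> Y L \<in> Dminus" using assms(3) by (auto simp: fixed_point_solution_def PiE_def)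
  then show "is_diag (G_box \<Gamma> Y L)" by (simp add: Dminus_def)
  show "dyson_solution (scaled_profile \<Gamma>) Y (\<lambda>i. L $ i $ i) (\<lambda>i. G_box \<Gamma> Y L $ i $ i)"
    by (rule fixed_point_imp_dyson_solution[OF assms(3) D]) (use fp assms(3) in \<open>simp add: fixed_point_solution_def\<close>)
qed

section \<open>Concentration for stable laws\<close>

text \<open>\<open>cosh\<close> is a power series with nonnegative coefficients in the square of its
  argument, and powers of a nonnegative number are convex; the inequality holds term by
  term.\<close>

lemma cosh_sqrt_interpolate:
  fixes x y u \<theta> :: real
  assumes "0 \<le> \<theta>" "\<theta> \<le> 1" "u\<^sup>2 = (1 - \<theta>) * x\<^sup>2 + \<theta> * y\<^sup>2"
  shows "cosh u \<le> (1 - \<theta>) * cosh x + \<theta> * cosh y"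
proof (rule sums_le)
  let ?c = "\<lambda>x n. if even n then x ^ n /\<^sub>R fact n else (0 :: real)"
  show "?c u sums cosh u" by (rule cosh_converges)
  show "(\<lambda>n. (1 - \<theta>) * ?c x n + \<theta> * ?c y n) sums ((1 - \<theta>) * cosh x + \<theta> * cosh y)"
    by (intro sums_add sums_mult cosh_converges)
  show "?c u n \<le> (1 - \<theta>) * ?c x n + \<theta> * ?c y n" for n
  proof (cases "even n")
    case True
    then obtain k where k: "n = 2 * k" by (elim evenE)
    have "convex_on {0::real..} (\<lambda>x. x ^ k)"
      by (cases "even k") (auto intro: convex_power_odd convex_on_subset[OF convex_power_even])
    then have "((1 - \<theta>) *\<^sub>R x\<^sup>2 + \<theta> *\<^sub>R y\<^sup>2) ^ k \<le> (1 - \<theta>) * (x\<^sup>2) ^ k + \<theta> * (y\<^sup>2) ^ k"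
      using assms by (intro convex_onD) auto
    then have "u ^ n \<le> (1 - \<theta>) * x ^ n + \<theta> * y ^ n"
      by (simp add: k power_mult assms(3))
    then have "inverse (fact n) * u ^ n \<le> inverse (fact n) * ((1 - \<theta>) * x ^ n + \<theta> * y ^ n)"
      by (intro mult_left_mono) auto
    then show ?thesis using True by (simp add: algebra_simps)
  qed simp
qed

text \<open>
  Convexity of \<open>q \<mapsto> cosh (sqrt q)\<close> reduces the estimate to collinear \<open>z\<close> and \<open>D\<close>, where it is the
  addition theorem for \<open>cosh\<close>. The factor in front of the inner product is \<open>0\<close> for \<open>z = 0\<close> by
  division by zero.
\<close>

lemma cosh_norm_add_le:
  fixes z D :: "'b::real_inner"
  shows "cosh (norm (z + D)) \<le> cosh (norm z) * (exp (norm D) - norm D) + sinh (norm z) / norm z * (z \<bullet> D)"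
proof -
  define a where "a = norm z"
  define d where "d = norm D"
  have sd: "d \<le> sinh d" unfolding sinh_field_def exp_minus by (rule real_le_x_sinh) (simp add: d_def)
  have ec: "cosh d + (sinh d - d) = exp d - d" using cosh_plus_sinh[of d] by simp
  show ?thesis
  proof (cases "z = 0 \<or> D = 0")
    case True
    then show ?thesis
    proof
      assume "z = 0"
      then show ?thesis using ec sd by (simp add: d_def)
    qed simp
  next
    case False
    then have pos: "a > 0" "d > 0" by (auto simp: a_def d_def)
    \<comment> \<open>Cosine of the angle between \<open>z\<close> and \<open>D\<close>. The squared
      norm of \<open>z + D\<close> is the convex combination of the opposite and the parallel
      collinear case with weights (1 - c)/2 and (1 + c)/2.\<close>
    define c where "c = (z \<bullet> D) / (a * d)"
    have c1: "\<bar>c\<bar> \<le> 1"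
      using Cauchy_Schwarz_ineq2[of z D] pos by (simp add: c_def a_def d_def abs_mult divide_le_eq)
    have zD: "z \<bullet> D = c * (a * d)" using pos by (simp add: c_def)
    have "(norm (z + D))\<^sup>2 = a\<^sup>2 + 2 * (z \<bullet> D) + d\<^sup>2"
      by (simp add: a_def d_def power2_norm_eq_inner inner_add_left inner_add_right inner_commute)
    also have "\<dots> = (1 - (1 + c) / 2) * (a - d)\<^sup>2 + (1 + c) / 2 * (a + d)\<^sup>2"
      by (simp add: zD power2_eq_square field_simps)
    finally have "cosh (norm (z + D)) \<le> (1 - (1 + c) / 2) * cosh (a - d) + (1 + c) / 2 * cosh (a + d)"
      using c1 by (intro cosh_sqrt_interpolate) auto
    also have "\<dots> = cosh a * cosh d + c * sinh a * sinh d"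
      by (simp add: cosh_add cosh_diff field_simps)
    \<comment> \<open>Only the part linear in \<open>d\<close> matches the inner product, which
      later averages to 0. The excess \<open>sinh d - d\<close> is of third order and joins the
      coefficient of \<open>cosh a\<close>.\<close>
    also have "c * sinh a * sinh d = c * sinh a * d + c * (sinh a * (sinh d - d))"
      by (simp add: algebra_simps)
    also have "c * (sinh a * (sinh d - d)) \<le> 1 * (cosh a * (sinh d - d))"
      using c1 sd pos sinh_le_cosh_real[of a] by (intro mult_mono mult_right_mono) (auto simp: a_def)
    also have "c * sinh a * d = sinh a / a * (z \<bullet> D)"
      using pos by (simp add: zD)
    finally have "cosh (norm (z + D)) \<le> cosh a * (cosh d + (sinh d - d)) + sinh a / a * (z \<bullet> D)"
      by (simp add: algebra_simps)
    then show ?thesis unfolding ec by (simp add: a_def d_def)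
  qed
qed

lemma exp_minus_linear_le:
  fixes d :: real
  assumes "0 \<le> d" "d \<le> b"
  shows "exp d - d \<le> 1 + d\<^sup>2 / 2 + exp b * d ^ 3"
proof -
  obtain t where t: "\<bar>t\<bar> \<le> \<bar>d\<bar>" "exp d = (\<Sum>m<3. (d ^ m) / fact m) + (exp t / fact 3) * d ^ 3"
    using Maclaurin_exp_le[of d 3] by blast
  have "exp t / fact 3 \<le> exp b"
    using t(1) assms by (intro order_trans[OF divide_right_mono[of "exp t" "exp b"]]) (auto simp: fact_numeral)
  then have "(exp t / fact 3) * d ^ 3 \<le> exp b * d ^ 3"
    using assms by (intro mult_right_mono) auto
  then show ?thesis using t(2) by (simp add: eval_nat_numeral)
qed

text \<open>Stability under rotations of two independent copies, realized on the product space,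
  replaces an explicit Gaussian density. The fourth moment controls squared second-order Taylor
  remainders.\<close>

locale stable_law = prob_space M for M :: "'a measure" +
  fixes X :: "'a \<Rightarrow> 'v::euclidean_space"
  assumes X_measurable [measurable]: "X \<in> borel_measurable M"
    and stable: "0 < a \<Longrightarrow> 0 < b \<Longrightarrow> a\<^sup>2 + b\<^sup>2 = 1 \<Longrightarrow>
      distr (M \<Otimes>\<^sub>M M) borel (\<lambda>(u, v). a *\<^sub>R X u + b *\<^sub>R X v) = distr M borel X"
    and integrable_norm4: "integrable M (\<lambda>\<omega>. norm (X \<omega>) ^ 4)"
begin

sublocale pair: pair_prob_space M M ..

text \<open>The heat semigroup of the law of \<open>X\<close>, indexed by standard deviation: the
  squares of the indices add under composition.\<close>

definition smoothing :: "real \<Rightarrow> ('v \<Rightarrow> 'b::{banach, second_countable_topology}) \<Rightarrow> 'v \<Rightarrow> 'b" where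
  "smoothing r f x = (\<integral>\<omega>. f (x + r *\<^sub>R X \<omega>) \<partial>M)"

lemma integrable_bounded:
  fixes f :: "'a \<Rightarrow> 'b::{banach, second_countable_topology}"
  assumes "f \<in> borel_measurable M" "\<And>\<omega>. norm (f \<omega>) \<le> B"
  shows "integrable M f"
  using assms by (intro integrable_const_bound[of _ B]) auto

lemma integrable_pair_bounded:
  fixes f :: "'a \<times> 'a \<Rightarrow> 'b::{banach, second_countable_topology}"
  assumes "f \<in> borel_measurable (M \<Otimes>\<^sub>M M)" "\<And>\<omega>. norm (f \<omega>) \<le> B"
  shows "integrable (M \<Otimes>\<^sub>M M) f"
  using assms by (intro pair.integrable_const_bound[of _ B]) auto

lemma integrable_norm_power:
  assumes "k \<le> 4" shows "integrable M (\<lambda>\<omega>. norm (X \<omega>) ^ k)"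
proof (rule Bochner_Integration.integrable_bound)
  show "integrable M (\<lambda>\<omega>. 1 + norm (X \<omega>) ^ 4)" using integrable_norm4 by simp
  have "t ^ k \<le> 1 + t ^ 4" if "0 \<le> t" for t :: real
  proof (cases "t \<le> 1")
    case True
    then have "t ^ k \<le> 1" using that by (simp add: power_le_one)
    then show ?thesis using that by (simp add: add_increasing2)
  next
    case False
    then have "t ^ k \<le> t ^ 4" using assms by (intro power_increasing) auto
    then show ?thesis by simp
  qed
  then show "AE \<omega> in M. norm (norm (X \<omega>) ^ k) \<le> norm (1 + norm (X \<omega>) ^ 4)" by simp
qed simp

lemma integrable_norm: "integrable M (\<lambda>\<omega>. norm (X \<omega>))"
  using integrable_norm_power[of 1] by simp

text \<open>After division by \<open>sqrt (r\<^sup>2 + t\<^sup>2)\<close> the two coefficients lie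
  on the unit circle, where stability applies. The cases \<open>r = 0\<close> and
  \<open>t = 0\<close> are treated apart because stability is assumed for positive coefficients
  only.\<close>

lemma smoothing_smoothing_integral:
  fixes f :: "'v \<Rightarrow> 'b::{banach, second_countable_topology}"
  assumes f: "f \<in> borel_measurable borel" "\<And>x. norm (f x) \<le> B" and r: "0 \<le> r" "0 \<le> t"
  shows "(\<integral>u. (\<integral>v. f (x + r *\<^sub>R X u + t *\<^sub>R X v) \<partial>M) \<partial>M) = smoothing (sqrt (r\<^sup>2 + t\<^sup>2)) f x"
proof (cases "r = 0 \<or> t = 0")
  case True
  then show ?thesis using r by (auto simp: smoothing_def prob_space)
next
  case False
  note f(1)[measurable]
  define s where "s = sqrt (r\<^sup>2 + t\<^sup>2)"
  define a where "a = r / s"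
  define b where "b = t / s"
  have s: "0 < s" using False by (simp add: s_def sum_power2_gt_zero_iff)
  have pos: "0 < a" "0 < b" using False r s by (auto simp: a_def b_def)
  have "s\<^sup>2 = r\<^sup>2 + t\<^sup>2" by (simp add: s_def)
  then have ab: "a\<^sup>2 + b\<^sup>2 = 1" "r = s * a" "t = s * b"
    using s by (auto simp: a_def b_def power_divide simp flip: add_divide_distrib)
  have "(\<integral>u. (\<integral>v. f (x + r *\<^sub>R X u + t *\<^sub>R X v) \<partial>M) \<partial>M)
      = (\<integral>p. (\<lambda>(u, v). f (x + r *\<^sub>R X u + t *\<^sub>R X v)) p \<partial>(M \<Otimes>\<^sub>M M))"
    by (subst pair.integral_fst'[symmetric]) (auto intro!: integrable_pair_bounded[of _ B] simp: f(2))
  also have "\<dots> = (\<integral>p. f (x + s *\<^sub>R (\<lambda>(u, v). a *\<^sub>R X u + b *\<^sub>R X v) p) \<partial>(M \<Otimes>\<^sub>M M))"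
    by (simp add: ab(2,3) scaleR_add_right add.assoc case_prod_beta)
  also have "\<dots> = (\<integral>y. f (x + s *\<^sub>R y) \<partial>distr (M \<Otimes>\<^sub>M M) borel (\<lambda>(u, v). a *\<^sub>R X u + b *\<^sub>R X v))"
    by (subst integral_distr) auto
  also have "\<dots> = (\<integral>y. f (x + s *\<^sub>R y) \<partial>distr M borel X)"
    unfolding stable[OF pos ab(1)] ..
  also have "\<dots> = smoothing s f x"
    by (subst integral_distr) (auto simp: smoothing_def)
  finally show ?thesis unfolding s_def .
qed

lemma smoothing_smoothing:
  fixes f :: "'v \<Rightarrow> 'b::{banach, second_countable_topology}"
  assumes "f \<in> borel_measurable borel" "\<And>x. norm (f x) \<le> B" "0 \<le> r" "0 \<le> t"
  shows "smoothing r (smoothing t f) x = smoothing (sqrt (r\<^sup>2 + t\<^sup>2)) f x"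
  using smoothing_smoothing_integral[OF assms] by (simp add: smoothing_def add.assoc)

lemma integral_power2_le:
  fixes g :: "'a \<Rightarrow> real"
  assumes "integrable M g" "integrable M (\<lambda>\<omega>. (g \<omega>)\<^sup>2)"
  shows "(\<integral>\<omega>. g \<omega> \<partial>M)\<^sup>2 \<le> (\<integral>\<omega>. (g \<omega>)\<^sup>2 \<partial>M)"
proof -
  have "0 \<le> variance g" by simp
  then show ?thesis using variance_eq[OF assms] by simp
qed

lemma norm_integral_power2_le:
  fixes g :: "'a \<Rightarrow> 'b::{banach, second_countable_topology}"
  assumes "integrable M g" "integrable M (\<lambda>\<omega>. (norm (g \<omega>))\<^sup>2)"
  shows "(norm (\<integral>\<omega>. g \<omega> \<partial>M))\<^sup>2 \<le> (\<integral>\<omega>. (norm (g \<omega>))\<^sup>2 \<partial>M)"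
proof -
  have "(norm (\<integral>\<omega>. g \<omega> \<partial>M))\<^sup>2 \<le> (\<integral>\<omega>. norm (g \<omega>) \<partial>M)\<^sup>2"
    using integral_norm_bound by (intro power_mono) auto
  also have "\<dots> \<le> (\<integral>\<omega>. (norm (g \<omega>))\<^sup>2 \<partial>M)"
    using assms by (intro integral_power2_le) auto
  finally show ?thesis .
qed

lemma variance_le_second_moment:
  fixes Z :: "'a \<Rightarrow> complex"
  assumes [measurable]: "Z \<in> borel_measurable M" and B: "\<And>\<omega>. cmod (Z \<omega>) \<le> B"
  shows "(\<integral>\<omega>. (cmod (Z \<omega> - (\<integral>\<omega>. Z \<omega> \<partial>M)))\<^sup>2 \<partial>M) \<le> (\<integral>\<omega>. (cmod (Z \<omega> - a))\<^sup>2 \<partial>M)"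
proof -
  define m where "m = (\<integral>\<omega>. Z \<omega> \<partial>M)"
  have Zint: "integrable M Z" by (rule integrable_bounded[of _ B]) (auto simp: B)
  have sq: "integrable M (\<lambda>\<omega>. (cmod (Z \<omega> - c))\<^sup>2)" for c
  proof (rule integrable_bounded[where B = "(B + cmod c)\<^sup>2"])
    show "norm ((cmod (Z \<omega> - c))\<^sup>2) \<le> (B + cmod c)\<^sup>2" for \<omega>
      using order_trans[OF norm_triangle_ineq4 add_right_mono[OF B]] by (simp add: power_mono)
  qed simp
  have eq: "(cmod (Z \<omega> - a))\<^sup>2 = (cmod (Z \<omega> - m))\<^sup>2 + 2 * ((m - a) \<bullet> (Z \<omega> - m)) + (cmod (m - a))\<^sup>2" for \<omega>
  proof -
    have "Z \<omega> - a = (Z \<omega> - m) + (m - a)" by simp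
    then show ?thesis
      by (simp only: power2_norm_eq_inner inner_add_left inner_add_right) (simp add: inner_commute)
  qed
  have z: "(\<integral>\<omega>. (m - a) \<bullet> (Z \<omega> - m) \<partial>M) = 0"
  proof -
    have "(\<integral>\<omega>. (m - a) \<bullet> (Z \<omega> - m) \<partial>M) = (m - a) \<bullet> (\<integral>\<omega>. Z \<omega> - m \<partial>M)"
      using Zint by (intro integral_inner_right) auto
    also have "(\<integral>\<omega>. Z \<omega> - m \<partial>M) = 0" using Zint by (simp add: m_def prob_space)
    finally show ?thesis by simp
  qed
  have "(\<integral>\<omega>. (cmod (Z \<omega> - a))\<^sup>2 \<partial>M) = (\<integral>\<omega>. (cmod (Z \<omega> - m))\<^sup>2 \<partial>M) + (cmod (m - a))\<^sup>2"
    unfolding eq using sq[of m] Zint z by (simp add: prob_space)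
  then show ?thesis by (simp add: m_def)
qed

text \<open>
  The last condition says that, to leading order, Gaussian noise of size \<open>r\<close> creates a variance of at
  most \<open>V * r\<^sup>2\<close>; unlike a gradient bound it is trivially inherited by averages.
\<close>

definition noise_bound :: "real \<Rightarrow> real \<Rightarrow> real \<Rightarrow> real \<Rightarrow> ('v \<Rightarrow> complex) \<Rightarrow> bool" where
  "noise_bound B l V C F \<longleftrightarrow>
     0 \<le> l \<and> (\<forall>x. cmod (F x) \<le> B) \<and> (\<forall>x y. cmod (F x - F y) \<le> l * norm (x - y)) \<and>
     (\<forall>x r. 0 \<le> r \<longrightarrow> r \<le> 1 \<longrightarrow>
        (\<integral>\<omega>. (cmod (F (x + r *\<^sub>R X \<omega>) - smoothing r F x))\<^sup>2 \<partial>M) \<le> V * r\<^sup>2 + C * r ^ 3)"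

lemma noise_bound_measurable: "noise_bound B l V C F \<Longrightarrow> F \<in> borel_measurable borel"
proof (rule borel_measurable_continuous_onI, rule lipschitz_on_continuous_on[of l], rule lipschitz_onI)
  show "dist (F x) (F y) \<le> l * dist x y" if "noise_bound B l V C F" for x y
    using that by (simp add: noise_bound_def dist_norm)
  show "0 \<le> l" if "noise_bound B l V C F" using that by (simp add: noise_bound_def)
qed

text \<open>The fluctuation of the averaged function is the average over \<open>v\<close> of the
  fluctuations of \<open>F\<close> at the points \<open>x + t *\<^sub>R X v\<close>. Jensen's
  inequality in \<open>v\<close> and Fubini reduce the claim to the bound for \<open>F\<close> at
  each of these points.\<close>

lemma noise_bound_smoothing:
  assumes nb: "noise_bound B l V C F" and t: "0 \<le> t"
  shows "noise_bound B l V C (smoothing t F)"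
proof -
  note [measurable] = noise_bound_measurable[OF nb]
  have l: "0 \<le> l" and B: "\<And>x. cmod (F x) \<le> B" and lip: "\<And>x y. cmod (F x - F y) \<le> l * norm (x - y)"
    and var: "\<And>x r. 0 \<le> r \<Longrightarrow> r \<le> 1 \<Longrightarrow>
        (\<integral>\<omega>. (cmod (F (x + r *\<^sub>R X \<omega>) - smoothing r F x))\<^sup>2 \<partial>M) \<le> V * r\<^sup>2 + C * r ^ 3"
    using nb by (auto simp: noise_bound_def)
  have Fint: "integrable M (\<lambda>\<omega>. F (x + s *\<^sub>R X \<omega>))" for x s
    by (rule integrable_bounded[of _ B]) (auto simp: B)
  have Bs: "cmod (smoothing s F x) \<le> B" for s x
  proof -
    have "cmod (smoothing s F x) \<le> (\<integral>\<omega>. cmod (F (x + s *\<^sub>R X \<omega>)) \<partial>M)"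
      unfolding smoothing_def by (rule integral_norm_bound)
    also have "\<dots> \<le> (\<integral>\<omega>. B \<partial>M)" using Fint by (intro integral_mono) (auto simp: B)
    finally show ?thesis by (simp add: prob_space)
  qed
  have lips: "cmod (smoothing s F x - smoothing s F y) \<le> l * norm (x - y)" for s x y
  proof -
    have "cmod (smoothing s F x - smoothing s F y) = cmod (\<integral>\<omega>. F (x + s *\<^sub>R X \<omega>) - F (y + s *\<^sub>R X \<omega>) \<partial>M)"
      unfolding smoothing_def using Fint by simp
    also have "\<dots> \<le> (\<integral>\<omega>. cmod (F (x + s *\<^sub>R X \<omega>) - F (y + s *\<^sub>R X \<omega>)) \<partial>M)"
      by (rule integral_norm_bound)
    also have "\<dots> \<le> (\<integral>\<omega>. l * norm (x - y) \<partial>M)"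
    proof (intro integral_mono)
      show "cmod (F (x + s *\<^sub>R X \<omega>) - F (y + s *\<^sub>R X \<omega>)) \<le> l * norm (x - y)" for \<omega>
        using lip[of "x + s *\<^sub>R X \<omega>" "y + s *\<^sub>R X \<omega>"] by simp
    qed (use Fint in auto)
    finally show ?thesis by (simp add: prob_space)
  qed
  have sm [measurable]: "smoothing s F \<in> borel_measurable borel" for s
  proof (rule borel_measurable_continuous_onI, rule lipschitz_on_continuous_on[of l], rule lipschitz_onI)
    show "dist (smoothing s F x) (smoothing s F y) \<le> l * dist x y" for x y
      using lips by (simp add: dist_norm)
  qed (rule l)
  have "(\<integral>\<omega>. (cmod (smoothing t F (x + r *\<^sub>R X \<omega>) - smoothing r (smoothing t F) x))\<^sup>2 \<partial>M) \<le> V * r\<^sup>2 + C * r ^ 3"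
    if r: "0 \<le> r" "r \<le> 1" for x r
  proof -
    define h where "h u v = F (x + t *\<^sub>R X v + r *\<^sub>R X u) - smoothing r F (x + t *\<^sub>R X v)" for u v
    have hb: "cmod (h u v) \<le> B + B" for u v
      unfolding h_def by (rule order_trans[OF norm_triangle_ineq4 add_mono[OF B Bs]])
    have hb2: "(cmod (h u v))\<^sup>2 \<le> (B + B)\<^sup>2" for u v
      by (rule power_mono[OF hb]) simp
    have hm: "h u \<in> borel_measurable M" for u unfolding h_def by measurable
    \<comment> \<open>The two smoothings commute because both compositions are the smoothing of
      index \<open>sqrt (r\<^sup>2 + t\<^sup>2)\<close>.\<close>
    have sw: "smoothing r (smoothing t F) x = smoothing t (smoothing r F) x"
      using smoothing_smoothing[OF noise_bound_measurable[OF nb] B r(1) t, of x]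
        smoothing_smoothing[OF noise_bound_measurable[OF nb] B t r(1), of x] by (simp add: add.commute)
    have "smoothing t F (x + r *\<^sub>R X u) - smoothing r (smoothing t F) x = (\<integral>v. h u v \<partial>M)" for u
    proof -
      have "integrable M (\<lambda>v. F (x + t *\<^sub>R X v + r *\<^sub>R X u))" "integrable M (\<lambda>v. smoothing r F (x + t *\<^sub>R X v))"
        by (auto intro!: integrable_bounded[of _ B] simp: B Bs)
      then have "(\<integral>v. h u v \<partial>M) = (\<integral>v. F (x + t *\<^sub>R X v + r *\<^sub>R X u) \<partial>M) - smoothing t (smoothing r F) x"
        unfolding h_def smoothing_def[of t "smoothing r F"] by simp
      then show ?thesis unfolding sw smoothing_def[of t F] by (simp add: add.assoc add.commute[of "t *\<^sub>R _"])
    qed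
    then have "(\<integral>u. (cmod (smoothing t F (x + r *\<^sub>R X u) - smoothing r (smoothing t F) x))\<^sup>2 \<partial>M)
        = (\<integral>u. (cmod (\<integral>v. h u v \<partial>M))\<^sup>2 \<partial>M)" by simp
    also have "\<dots> \<le> (\<integral>u. (\<integral>v. (cmod (h u v))\<^sup>2 \<partial>M) \<partial>M)"
    proof (rule integral_mono)
      show "integrable M (\<lambda>u. (cmod (\<integral>v. h u v \<partial>M))\<^sup>2)"
      proof (rule integrable_bounded[of _ "(B + B)\<^sup>2"])
        show "(\<lambda>u. (cmod (\<integral>v. h u v \<partial>M))\<^sup>2) \<in> borel_measurable M" unfolding h_def by measurable
        show "norm ((cmod (\<integral>v. h u v \<partial>M))\<^sup>2) \<le> (B + B)\<^sup>2" for u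
        proof -
          have "cmod (\<integral>v. h u v \<partial>M) \<le> (\<integral>v. cmod (h u v) \<partial>M)" by (rule integral_norm_bound)
          also have "\<dots> \<le> (\<integral>v. B + B \<partial>M)"
            using hm hb by (intro integral_mono) (auto intro!: integrable_bounded[of _ "B + B"])
          finally have "cmod (\<integral>v. h u v \<partial>M) \<le> B + B" by (simp add: prob_space)
          then show ?thesis using power_mono[OF _ norm_ge_zero, of "\<integral>v. h u v \<partial>M" "B + B" 2] by simp
        qed
      qed
      show "integrable M (\<lambda>u. \<integral>v. (cmod (h u v))\<^sup>2 \<partial>M)"
      proof (rule integrable_bounded[of _ "(B + B)\<^sup>2"])
        show "(\<lambda>u. \<integral>v. (cmod (h u v))\<^sup>2 \<partial>M) \<in> borel_measurable M" unfolding h_def by measurable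
        show "norm (\<integral>v. (cmod (h u v))\<^sup>2 \<partial>M) \<le> (B + B)\<^sup>2" for u
        proof -
          have "(\<integral>v. (cmod (h u v))\<^sup>2 \<partial>M) \<le> (\<integral>v. (B + B)\<^sup>2 \<partial>M)"
            using hm hb2 by (intro integral_mono) (auto intro!: integrable_bounded[of _ "(B + B)\<^sup>2"])
          then show ?thesis by (simp add: prob_space)
        qed
      qed
      show "(cmod (\<integral>v. h u v \<partial>M))\<^sup>2 \<le> (\<integral>v. (cmod (h u v))\<^sup>2 \<partial>M)" for u
        using hm[of u] hb hb2
        by (intro norm_integral_power2_le integrable_bounded[of _ "B + B"] integrable_bounded[of _ "(B + B)\<^sup>2"]) auto
    qed
    also have "\<dots> = (\<integral>v. (\<integral>u. (cmod (h u v))\<^sup>2 \<partial>M) \<partial>M)"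
    proof (rule pair.Fubini_integral[symmetric])
      show "integrable (M \<Otimes>\<^sub>M M) (\<lambda>(u, v). (cmod (h u v))\<^sup>2)"
      proof (rule integrable_pair_bounded[of _ "(B + B)\<^sup>2"])
        show "(\<lambda>(u, v). (cmod (h u v))\<^sup>2) \<in> borel_measurable (M \<Otimes>\<^sub>M M)" unfolding h_def by measurable
      qed (use hb2 in auto)
    qed
    also have "\<dots> \<le> (\<integral>v. V * r\<^sup>2 + C * r ^ 3 \<partial>M)"
    proof (rule integral_mono)
      show "integrable M (\<lambda>v. \<integral>u. (cmod (h u v))\<^sup>2 \<partial>M)"
      proof (rule integrable_bounded[of _ "(B + B)\<^sup>2"])
        show "(\<lambda>v. \<integral>u. (cmod (h u v))\<^sup>2 \<partial>M) \<in> borel_measurable M" unfolding h_def by measurable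
        show "norm (\<integral>u. (cmod (h u v))\<^sup>2 \<partial>M) \<le> (B + B)\<^sup>2" for v
        proof -
          have [measurable]: "(\<lambda>u. h u v) \<in> borel_measurable M" unfolding h_def by measurable
          have "(\<integral>u. (cmod (h u v))\<^sup>2 \<partial>M) \<le> (\<integral>u. (B + B)\<^sup>2 \<partial>M)"
            using hb2 by (intro integral_mono) (auto intro!: integrable_bounded[of _ "(B + B)\<^sup>2"])
          then show ?thesis by (simp add: prob_space)
        qed
      qed
      show "(\<integral>u. (cmod (h u v))\<^sup>2 \<partial>M) \<le> V * r\<^sup>2 + C * r ^ 3" for v
        unfolding h_def by (rule var[OF r])
    qed simp
    finally show ?thesis by (simp add: prob_space)
  qed
  then show ?thesis using l Bs lips by (simp add: noise_bound_def)
qed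

text \<open>For an l-Lipschitz function the centred increment at noise size r is at most l r times
  the sum being cubed here.\<close>

definition third_moment :: real where
  "third_moment = (\<integral>\<omega>. (norm (X \<omega>) + (\<integral>\<omega>. norm (X \<omega>) \<partial>M)) ^ 3 \<partial>M)"

lemma integrable_third_moment: "integrable M (\<lambda>\<omega>. (norm (X \<omega>) + m) ^ 3)"
proof -
  have "(norm (X \<omega>) + m) ^ 3 = norm (X \<omega>) ^ 3 + 3 * m * norm (X \<omega>) ^ 2 + 3 * m\<^sup>2 * norm (X \<omega>) + m ^ 3" for \<omega>
    by (simp add: power3_eq_cube power2_eq_square algebra_simps)
  then show ?thesis
    using integrable_norm_power[of 3] integrable_norm_power[of 2] integrable_norm by simp
qed

text \<open>In \<open>cosh_norm_add_le\<close> the linear term has mean 0 because the increment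
  \<open>D\<close> is centred. What remains is 1 + |D|^2 / 2 up to third order, and the second
  moment of \<open>D\<close> is the quantity controlled by \<open>noise_bound\<close>.\<close>

lemma cosh_increment_le:
  assumes nb: "noise_bound B l V C F" and r: "0 \<le> r" "r \<le> 1"
  shows "(\<integral>\<omega>. cosh (cmod (z + (F (x + r *\<^sub>R X \<omega>) - smoothing r F x))) \<partial>M)
    \<le> cosh (cmod z) * (1 + V / 2 * r\<^sup>2 + (C / 2 + exp (B + B) * l ^ 3 * third_moment) * r ^ 3)"
proof -
  note [measurable] = noise_bound_measurable[OF nb]
  have l: "0 \<le> l" and B: "\<And>x. cmod (F x) \<le> B" and lip: "\<And>x y. cmod (F x - F y) \<le> l * norm (x - y)"
    and var: "(\<integral>\<omega>. (cmod (F (x + r *\<^sub>R X \<omega>) - smoothing r F x))\<^sup>2 \<partial>M) \<le> V * r\<^sup>2 + C * r ^ 3"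
    using nb r by (auto simp: noise_bound_def)
  have Bs: "cmod (smoothing r F x) \<le> B"
    using noise_bound_smoothing[OF nb r(1)] by (simp add: noise_bound_def)
  define m where "m = (\<integral>\<omega>. norm (X \<omega>) \<partial>M)"
  define D where "D \<omega> = F (x + r *\<^sub>R X \<omega>) - smoothing r F x" for \<omega>
  have [measurable]: "D \<in> borel_measurable M" unfolding D_def by measurable
  have Fint: "integrable M (\<lambda>\<omega>. F (x + r *\<^sub>R X \<omega>))"
    by (rule integrable_bounded[of _ B]) (auto simp: B)
  have DB: "cmod (D \<omega>) \<le> B + B" for \<omega>
    unfolding D_def by (rule order_trans[OF norm_triangle_ineq4 add_mono[OF B Bs]])
  have Dint: "integrable M D" by (rule integrable_bounded[of _ "B + B", OF _ DB]) simp
  have D0: "(\<integral>\<omega>. D \<omega> \<partial>M) = 0"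
    using Fint by (simp add: D_def smoothing_def prob_space)
  have Dlip: "cmod (D \<omega>) \<le> l * r * (norm (X \<omega>) + m)" for \<omega>
  proof -
    have "cmod (D \<omega>) = cmod (\<integral>u. F (x + r *\<^sub>R X \<omega>) - F (x + r *\<^sub>R X u) \<partial>M)"
      using Fint by (simp add: D_def smoothing_def prob_space)
    also have "\<dots> \<le> (\<integral>u. cmod (F (x + r *\<^sub>R X \<omega>) - F (x + r *\<^sub>R X u)) \<partial>M)"
      by (rule integral_norm_bound)
    also have "\<dots> \<le> (\<integral>u. l * r * (norm (X \<omega>) + norm (X u)) \<partial>M)"
    proof (rule integral_mono)
      show "cmod (F (x + r *\<^sub>R X \<omega>) - F (x + r *\<^sub>R X u)) \<le> l * r * (norm (X \<omega>) + norm (X u))" for u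
      proof -
        have "cmod (F (x + r *\<^sub>R X \<omega>) - F (x + r *\<^sub>R X u)) \<le> l * norm (r *\<^sub>R (X \<omega> - X u))"
          using lip[of "x + r *\<^sub>R X \<omega>" "x + r *\<^sub>R X u"] by (simp add: scaleR_diff_right)
        also have "\<dots> = l * r * norm (X \<omega> - X u)" using r by simp
        also have "\<dots> \<le> l * r * (norm (X \<omega>) + norm (X u))"
          using l r by (intro mult_left_mono norm_triangle_ineq4) auto
        finally show ?thesis .
      qed
    qed (use Fint integrable_norm in auto)
    also have "\<dots> = l * r * (norm (X \<omega>) + m)"
      using integrable_norm by (simp add: m_def prob_space)
    finally show ?thesis .
  qed
  have sq: "integrable M (\<lambda>\<omega>. (cmod (D \<omega>))\<^sup>2)"
  proof (rule integrable_bounded[where B = "(B + B)\<^sup>2"])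
    show "norm ((cmod (D \<omega>))\<^sup>2) \<le> (B + B)\<^sup>2" for \<omega>
      using power_mono[OF DB norm_ge_zero, of \<omega> 2] by simp
  qed simp
  define K where "K = exp (B + B) * (l * r) ^ 3"
  have K: "0 \<le> K" using l r by (simp add: K_def)
  have exp_le: "exp (cmod (D \<omega>)) - cmod (D \<omega>) \<le> 1 + (cmod (D \<omega>))\<^sup>2 / 2 + K * (norm (X \<omega>) + m) ^ 3" for \<omega>
  proof -
    have "exp (cmod (D \<omega>)) - cmod (D \<omega>) \<le> 1 + (cmod (D \<omega>))\<^sup>2 / 2 + exp (B + B) * cmod (D \<omega>) ^ 3"
      by (rule exp_minus_linear_le[OF norm_ge_zero DB])
    also have "exp (B + B) * cmod (D \<omega>) ^ 3 \<le> exp (B + B) * (l * r * (norm (X \<omega>) + m)) ^ 3"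
      using Dlip by (intro mult_left_mono power_mono) auto
    finally show ?thesis by (simp add: K_def power_mult_distrib mult.assoc)
  qed
  have "(\<integral>\<omega>. cosh (cmod (z + D \<omega>)) \<partial>M)
     \<le> (\<integral>\<omega>. cosh (cmod z) * (1 + (cmod (D \<omega>))\<^sup>2 / 2 + K * (norm (X \<omega>) + m) ^ 3)
          + sinh (cmod z) / cmod z * (z \<bullet> D \<omega>) \<partial>M)"
  proof (rule integral_mono)
    show "integrable M (\<lambda>\<omega>. cosh (cmod (z + D \<omega>)))"
    proof (rule integrable_bounded[where B = "cosh (cmod z + (B + B))"])
      show "norm (cosh (cmod (z + D \<omega>))) \<le> cosh (cmod z + (B + B))" for \<omega>
        using order_trans[OF norm_triangle_ineq add_left_mono[OF DB]] order_trans[OF norm_ge_zero DB]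
        by (simp add: cosh_real_nonneg_le_iff)
    qed (simp add: cosh_def)
    show "cosh (cmod (z + D \<omega>)) \<le> cosh (cmod z) * (1 + (cmod (D \<omega>))\<^sup>2 / 2 + K * (norm (X \<omega>) + m) ^ 3)
          + sinh (cmod z) / cmod z * (z \<bullet> D \<omega>)" for \<omega>
      by (rule order_trans[OF cosh_norm_add_le], intro add_right_mono mult_left_mono exp_le) simp
  qed (use sq Dint integrable_third_moment in auto)
  also have "\<dots> = cosh (cmod z) * (1 + (\<integral>\<omega>. (cmod (D \<omega>))\<^sup>2 \<partial>M) / 2 + K * third_moment)"
  proof -
    have "(\<integral>\<omega>. z \<bullet> D \<omega> \<partial>M) = 0"
      using Dint D0 by (subst integral_inner_right) auto
    then show ?thesis
      using sq Dint integrable_third_moment[of m] by (simp add: prob_space third_moment_def m_def)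
  qed
  also have "\<dots> \<le> cosh (cmod z) * (1 + (V * r\<^sup>2 + C * r ^ 3) / 2 + K * third_moment)"
    using var unfolding D_def by (intro mult_left_mono add_right_mono add_left_mono divide_right_mono) auto
  also have "\<dots> = cosh (cmod z) * (1 + V / 2 * r\<^sup>2 + (C / 2 + exp (B + B) * l ^ 3 * third_moment) * r ^ 3)"
    by (simp add: K_def power_mult_distrib algebra_simps add_divide_distrib)
  finally show ?thesis unfolding D_def .
qed

text \<open>
  Gaussian noise of size \<open>sqrt k * r\<close> is built up in \<open>k\<close> independent steps of size \<open>r\<close>; the conditional
  expectations of \<open>F\<close> form a martingale with values in the plane.
\<close>

lemma cosh_iterated_le:
  assumes nb: "noise_bound B l V C F" and r: "0 \<le> r" "r \<le> 1"
  defines "\<kappa> \<equiv> V / 2 * r\<^sup>2 + (C / 2 + exp (B + B) * l ^ 3 * third_moment) * r ^ 3"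
  assumes \<kappa>: "0 \<le> 1 + \<kappa>"
  shows "(\<integral>\<omega>. cosh (cmod (z + (F (x + (sqrt k * r) *\<^sub>R X \<omega>) - smoothing (sqrt k * r) F x))) \<partial>M)
    \<le> cosh (cmod z) * (1 + \<kappa>) ^ k"
proof (induction k arbitrary: x z)
  case 0
  show ?case by (simp add: smoothing_def prob_space)
next
  case (Suc k)
  note [measurable] = noise_bound_measurable[OF nb]
  define t where "t = sqrt k * r"
  define G where "G = smoothing t F"
  have t: "0 \<le> t" using r by (simp add: t_def)
  have nbG: "noise_bound B l V C G" unfolding G_def by (rule noise_bound_smoothing[OF nb t])
  note [measurable] = noise_bound_measurable[OF nbG]
  have B: "cmod (F x) \<le> B" "cmod (G x) \<le> B" for x
    using nb nbG by (auto simp: noise_bound_def)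
  \<comment> \<open>Variances add: a first step of size \<open>r\<close>, followed by
    \<open>k\<close> steps of total size \<open>t\<close>.\<close>
  have sq: "sqrt (Suc k) * r = sqrt (r\<^sup>2 + t\<^sup>2)"
  proof -
    have "r\<^sup>2 + t\<^sup>2 = real (Suc k) * r\<^sup>2" by (simp add: t_def power_mult_distrib algebra_simps)
    then show ?thesis using r by (simp add: real_sqrt_mult)
  qed
  define c where "c = smoothing (sqrt (Suc k) * r) F x"
  have cG: "c = smoothing r G x"
    unfolding c_def G_def sq using smoothing_smoothing[OF noise_bound_measurable[OF nb] B(1) r(1) t, of x] by simp
  have cB: "cmod c \<le> B"
    unfolding cG using noise_bound_smoothing[OF nbG r(1)] by (simp add: noise_bound_def)
  define f where "f y = cosh (cmod (z + (F y - c)))" for y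
  define b where "b = cosh (cmod z + (B + B))"
  have zb: "cmod (z + (w - c)) \<le> cmod z + (B + B)" if "cmod w \<le> B" for w
    using that cB norm_triangle_ineq[of z "w - c"] norm_triangle_ineq4[of w c] by linarith
  have cosh_b: "\<bar>cosh (cmod (z + (w - c)))\<bar> \<le> b" if "cmod w \<le> B" for w
    using zb[OF that] order_trans[OF norm_ge_zero zb[OF that]] by (simp add: b_def cosh_real_nonneg_le_iff)
  have [measurable]: "f \<in> borel_measurable borel" unfolding f_def cosh_def by measurable
  have fb: "norm (f y) \<le> b" for y unfolding f_def real_norm_def by (rule cosh_b[OF B(1)])
  have "(\<integral>\<omega>. f (x + (sqrt (Suc k) * r) *\<^sub>R X \<omega>) \<partial>M) = (\<integral>u. (\<integral>v. f (x + r *\<^sub>R X u + t *\<^sub>R X v) \<partial>M) \<partial>M)"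
    using smoothing_smoothing_integral[of f b r t x] fb r t unfolding sq by (simp add: smoothing_def)
  also have "\<dots> \<le> (\<integral>u. cosh (cmod (z + (G (x + r *\<^sub>R X u) - c))) * (1 + \<kappa>) ^ k \<partial>M)"
  proof (rule integral_mono)
    show "integrable M (\<lambda>u. \<integral>v. f (x + r *\<^sub>R X u + t *\<^sub>R X v) \<partial>M)"
    proof (rule integrable_bounded[where B = b])
      show "norm (\<integral>v. f (x + r *\<^sub>R X u + t *\<^sub>R X v) \<partial>M) \<le> b" for u
      proof -
        have i: "integrable M (\<lambda>v. f (x + r *\<^sub>R X u + t *\<^sub>R X v))"
          by (rule integrable_bounded[OF _ fb]) measurable
        have "norm (\<integral>v. f (x + r *\<^sub>R X u + t *\<^sub>R X v) \<partial>M) \<le> (\<integral>v. norm (f (x + r *\<^sub>R X u + t *\<^sub>R X v)) \<partial>M)"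
          by (rule integral_norm_bound)
        also have "\<dots> \<le> (\<integral>v. b \<partial>M)"
          by (rule integral_mono[OF Bochner_Integration.integrable_norm[OF i] integrable_const fb])
        finally show ?thesis by (simp add: prob_space)
      qed
    qed measurable
    show "integrable M (\<lambda>u. cosh (cmod (z + (G (x + r *\<^sub>R X u) - c))) * (1 + \<kappa>) ^ k)"
      using cosh_b[OF B(2)] by (intro integrable_mult_left integrable_bounded[where B = b]) (auto simp: cosh_def)
    \<comment> \<open>Given the first step, the induction hypothesis is applied at the displaced
      base point, with \<open>z\<close> shifted by the first martingale increment. The one-step
      bound for \<open>G\<close> then removes that increment.\<close>
    show "(\<integral>v. f (x + r *\<^sub>R X u + t *\<^sub>R X v) \<partial>M) \<le> cosh (cmod (z + (G (x + r *\<^sub>R X u) - c))) * (1 + \<kappa>) ^ k" for u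
      using Suc.IH[of "z + (G (x + r *\<^sub>R X u) - c)" "x + r *\<^sub>R X u"]
      by (simp add: f_def G_def t_def algebra_simps)
  qed
  also have "\<dots> = (\<integral>u. cosh (cmod (z + (G (x + r *\<^sub>R X u) - smoothing r G x))) \<partial>M) * (1 + \<kappa>) ^ k"
    unfolding cG by simp
  also have "\<dots> \<le> (cosh (cmod z) * (1 + \<kappa>)) * (1 + \<kappa>) ^ k"
    using cosh_increment_le[OF nbG r, of z x] \<kappa> unfolding \<kappa>_def
    by (intro mult_right_mono) (auto simp: add.assoc)
  finally show ?case unfolding f_def c_def by (simp add: mult.assoc)
qed

text \<open>With n steps of size 1/sqrt n the quadratic terms add up to V/2 and the cubic ones to
  K/sqrt n. In the limit the Lipschitz constant, the bound \<open>B\<close> and the constant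
  \<open>C\<close> disappear.\<close>

lemma expectation_cosh_le:
  assumes nb: "noise_bound B l V C F" and V: "0 \<le> V" and C: "0 \<le> C"
  shows "(\<integral>\<omega>. cosh (cmod (F (x + X \<omega>) - smoothing 1 F x)) \<partial>M) \<le> exp (V / 2)"
proof -
  define K where "K = C / 2 + exp (B + B) * l ^ 3 * third_moment"
  have m3: "0 \<le> third_moment" unfolding third_moment_def by (simp add: integral_nonneg_AE)
  have K: "0 \<le> K" using nb C m3 by (simp add: K_def noise_bound_def)
  have le: "(\<integral>\<omega>. cosh (cmod (F (x + X \<omega>) - smoothing 1 F x)) \<partial>M) \<le> exp (V / 2 + K * (1 / sqrt (real n)))"
    if n: "n \<ge> 1" for n
  proof -
    define r where "r = 1 / sqrt (real n)"
    have r: "0 \<le> r" "r \<le> 1" "sqrt n * r = 1" "r\<^sup>2 = 1 / n" using n by (auto simp: r_def power_divide)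
    define \<kappa> where "\<kappa> = V / 2 * r\<^sup>2 + K * r ^ 3"
    have \<kappa>: "0 \<le> \<kappa>" using V K r by (simp add: \<kappa>_def)
    have "(\<integral>\<omega>. cosh (cmod (F (x + X \<omega>) - smoothing 1 F x)) \<partial>M) \<le> (1 + \<kappa>) ^ n"
      using cosh_iterated_le[OF nb r(1,2), of 0 x n] \<kappa> by (simp add: r(3) \<kappa>_def K_def)
    also have "\<dots> \<le> exp \<kappa> ^ n" using \<kappa> by (intro power_mono exp_ge_add_one_self) auto
    also have "\<dots> = exp (n * \<kappa>)" by (simp add: exp_of_nat_mult)
    also have "n * \<kappa> = V / 2 + K * r"
      using n by (simp add: \<kappa>_def power3_eq_cube r(4) field_simps flip: power2_eq_square)
    finally show ?thesis by (simp add: r_def)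
  qed
  have "(\<lambda>n. 1 / sqrt (real n)) \<longlonglongrightarrow> 0"
    by (intro tendsto_divide_0[OF tendsto_const] filterlim_at_top_imp_at_infinity
        filterlim_compose[OF sqrt_at_top filterlim_real_sequentially])
  then have "(\<lambda>n. exp (V / 2 + K * (1 / sqrt (real n)))) \<longlonglongrightarrow> exp (V / 2 + K * 0)"
    by (intro tendsto_intros)
  then show ?thesis
    using le by (intro tendsto_lowerbound[where F = sequentially and f = "\<lambda>n. exp (V / 2 + K * (1 / sqrt (real n)))"])
      (auto simp: eventually_sequentially)
qed

lemma noise_bound_scale:
  assumes "noise_bound B l V C F" "0 \<le> c"
  shows "noise_bound (c * B) (c * l) (c\<^sup>2 * V) (c\<^sup>2 * C) (\<lambda>x. of_real c * F x)"
proof -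
  have sm: "smoothing r (\<lambda>x. of_real c * F x) x = of_real c * smoothing r F x" for r x
    by (simp add: smoothing_def)
  have "(\<integral>\<omega>. (cmod (of_real c * F (x + r *\<^sub>R X \<omega>) - of_real c * smoothing r F x))\<^sup>2 \<partial>M)
    \<le> c\<^sup>2 * V * r\<^sup>2 + c\<^sup>2 * C * r ^ 3" if r: "0 \<le> r" "r \<le> 1" for r x
  proof -
    have "(\<integral>\<omega>. (cmod (of_real c * F (x + r *\<^sub>R X \<omega>) - of_real c * smoothing r F x))\<^sup>2 \<partial>M)
      = c\<^sup>2 * (\<integral>\<omega>. (cmod (F (x + r *\<^sub>R X \<omega>) - smoothing r F x))\<^sup>2 \<partial>M)"
      by (simp add: norm_mult power_mult_distrib flip: right_diff_distrib)
    also have "\<dots> \<le> c\<^sup>2 * (V * r\<^sup>2 + C * r ^ 3)"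
      using assms r by (intro mult_left_mono) (auto simp: noise_bound_def)
    finally show ?thesis by (simp add: algebra_simps)
  qed
  then show ?thesis
    using assms unfolding noise_bound_def sm
    by (auto simp: norm_mult mult.assoc mult_left_mono simp flip: right_diff_distrib)
qed

lemma expectation_cosh_scaled_le:
  assumes nb: "noise_bound B l V C F" and V: "0 \<le> V" and C: "0 \<le> C" and c: "0 \<le> c"
  shows "(\<integral>\<omega>. cosh (c * cmod (F (x + X \<omega>) - smoothing 1 F x)) \<partial>M) \<le> exp (c\<^sup>2 * V / 2)"
proof -
  have "smoothing r (\<lambda>x. of_real c * F x) x = of_real c * smoothing r F x" for r
    by (simp add: smoothing_def)
  then show ?thesis
    using expectation_cosh_le[OF noise_bound_scale[OF nb c], of x] V C c
    by (simp add: norm_mult flip: right_diff_distrib)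
qed

text \<open>Markov's inequality for \<open>cosh (c * Z \<omega>)\<close>; bounding
  \<open>cosh\<close> from below by half an exponential gives the prefactor 2.\<close>

theorem gaussian_concentration:
  assumes nb: "noise_bound B l V C F" and V: "0 < V" and C: "0 \<le> C" and t: "0 \<le> t"
  shows "measure M {\<omega> \<in> space M. t \<le> cmod (F (x + X \<omega>) - smoothing 1 F x)} \<le> 2 * exp (- t\<^sup>2 / (2 * V))"
proof -
  note [measurable] = noise_bound_measurable[OF nb]
  \<comment> \<open>Minimizes the exponent c^2 V / 2 - c t.\<close>
  define c where "c = t / V"
  have c: "0 \<le> c" using t V by (simp add: c_def)
  define Z where "Z \<omega> = cmod (F (x + X \<omega>) - smoothing 1 F x)" for \<omega>
  have [measurable]: "Z \<in> borel_measurable M" unfolding Z_def by measurable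
  have ZB: "Z \<omega> \<le> B + B" for \<omega>
    unfolding Z_def using nb noise_bound_smoothing[OF nb, of 1]
    by (intro order_trans[OF norm_triangle_ineq4 add_mono]) (auto simp: noise_bound_def)
  have Z0: "0 \<le> Z \<omega>" for \<omega> by (simp add: Z_def)
  have int: "integrable M (\<lambda>\<omega>. cosh (c * Z \<omega>))"
  proof (rule integrable_bounded[where B = "cosh (c * (B + B))"])
    show "norm (cosh (c * Z \<omega>)) \<le> cosh (c * (B + B))" for \<omega>
      using c Z0[of \<omega>] ZB[of \<omega>] by (simp add: cosh_real_nonneg_le_iff mult_left_mono del: mult_2_right)
  qed (simp add: cosh_def)
  have "measure M {\<omega> \<in> space M. t \<le> Z \<omega>} \<le> measure M {\<omega> \<in> space M. cosh (c * t) \<le> cosh (c * Z \<omega>)}"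
  proof (rule finite_measure_mono)
    show "{\<omega> \<in> space M. t \<le> Z \<omega>} \<subseteq> {\<omega> \<in> space M. cosh (c * t) \<le> cosh (c * Z \<omega>)}"
    proof (intro subsetI CollectI conjI)
      fix \<omega> assume \<omega>: "\<omega> \<in> {\<omega> \<in> space M. t \<le> Z \<omega>}"
      then show "\<omega> \<in> space M" by simp
      have "c * t \<le> c * Z \<omega>" "0 \<le> c * t" using \<omega> c t by (auto intro: mult_left_mono)
      then show "cosh (c * t) \<le> cosh (c * Z \<omega>)"
        using cosh_real_nonneg_le_iff[of "c * t" "c * Z \<omega>"] by linarith
    qed
    have [measurable]: "(\<lambda>\<omega>. cosh (c * Z \<omega>)) \<in> borel_measurable M" by (simp add: cosh_def)
    show "{\<omega> \<in> space M. cosh (c * t) \<le> cosh (c * Z \<omega>)} \<in> events" by measurable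
  qed
  also have "\<dots> \<le> (\<integral>\<omega>. cosh (c * Z \<omega>) \<partial>M) / cosh (c * t)"
    by (rule integral_Markov_inequality_measure[OF int]) auto
  also have "\<dots> \<le> exp (c\<^sup>2 * V / 2) / cosh (c * t)"
    using expectation_cosh_scaled_le[OF nb _ C c, of x] V unfolding Z_def by (intro divide_right_mono) auto
  also have "\<dots> \<le> exp (c\<^sup>2 * V / 2) / (exp (c * t) / 2)"
    by (intro divide_left_mono) (auto simp: cosh_field_def intro!: mult_pos_pos add_pos_pos)
  also have "\<dots> = 2 * exp (c\<^sup>2 * V / 2 - c * t)" by (simp add: exp_diff)
  also have "c\<^sup>2 * V / 2 - c * t = - t\<^sup>2 / (2 * V)"
    using V by (simp add: c_def power2_eq_square field_simps)
  finally show ?thesis unfolding Z_def .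
qed

text \<open>The second-order part of the exponential estimate at 0: insert cosh y >= 1 + y^2 / 2,
  divide by e = c^2 and let e tend to 0.\<close>

theorem gaussian_poincare:
  assumes nb: "noise_bound B l V C F" and V: "0 \<le> V" and C: "0 \<le> C"
  shows "(\<integral>\<omega>. (cmod (F (x + X \<omega>) - smoothing 1 F x))\<^sup>2 \<partial>M) \<le> V"
proof -
  note [measurable] = noise_bound_measurable[OF nb]
  define Z where "Z \<omega> = cmod (F (x + X \<omega>) - smoothing 1 F x)" for \<omega>
  have [measurable]: "Z \<in> borel_measurable M" unfolding Z_def by measurable
  have ZB: "Z \<omega> \<le> B + B" for \<omega>
    unfolding Z_def using nb noise_bound_smoothing[OF nb, of 1]
    by (intro order_trans[OF norm_triangle_ineq4 add_mono]) (auto simp: noise_bound_def)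
  have Z0: "0 \<le> Z \<omega>" for \<omega> by (simp add: Z_def)
  have sq: "integrable M (\<lambda>\<omega>. (Z \<omega>)\<^sup>2)"
  proof (rule integrable_bounded[where B = "(B + B)\<^sup>2"])
    show "norm ((Z \<omega>)\<^sup>2) \<le> (B + B)\<^sup>2" for \<omega>
      using power_mono[OF ZB Z0, of \<omega> 2] by simp
  qed simp
  have le: "(\<integral>\<omega>. (Z \<omega>)\<^sup>2 \<partial>M) \<le> V + e * V\<^sup>2 / 2" if e: "0 < e" "e * V / 2 \<le> 1" for e
  proof -
    define c where "c = sqrt e"
    have c: "0 \<le> c" "c\<^sup>2 = e" using e by (auto simp: c_def)
    have int: "integrable M (\<lambda>\<omega>. cosh (c * Z \<omega>))"
    proof (rule integrable_bounded[where B = "cosh (c * (B + B))"])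
      show "norm (cosh (c * Z \<omega>)) \<le> cosh (c * (B + B))" for \<omega>
        using c Z0[of \<omega>] ZB[of \<omega>] by (simp add: cosh_real_nonneg_le_iff mult_left_mono del: mult_2_right)
    qed (simp add: cosh_def)
    have cosh_ge: "1 + y\<^sup>2 / 2 \<le> cosh y" for y :: real
    proof -
      have "(\<Sum>n<3. if even n then y ^ n /\<^sub>R fact n else 0) \<le> cosh y"
        unfolding sums_unique[OF cosh_converges, of y]
        by (rule sum_le_suminf[OF sums_summable[OF cosh_converges]]) (auto simp: zero_le_even_power)
      then show ?thesis by (simp add: eval_nat_numeral)
    qed
    have "(\<integral>\<omega>. 1 + e / 2 * (Z \<omega>)\<^sup>2 \<partial>M) \<le> (\<integral>\<omega>. cosh (c * Z \<omega>) \<partial>M)"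
    proof (rule integral_mono)
      show "1 + e / 2 * (Z \<omega>)\<^sup>2 \<le> cosh (c * Z \<omega>)" for \<omega>
        using cosh_ge[of "c * Z \<omega>"] by (simp add: power_mult_distrib c(2))
    qed (use sq int in auto)
    also have "\<dots> \<le> exp (e * V / 2)"
      using expectation_cosh_scaled_le[OF nb V C c(1), of x] by (simp add: Z_def c(2))
    also have "\<dots> \<le> 1 + e * V / 2 + (e * V / 2)\<^sup>2"
      using e V by (intro exp_bound) auto
    finally have "e / 2 * (\<integral>\<omega>. (Z \<omega>)\<^sup>2 \<partial>M) \<le> e / 2 * (V + e * V\<^sup>2 / 2)"
      using sq by (simp add: prob_space power2_eq_square algebra_simps)
    then show ?thesis using e by simp
  qed
  have "((\<lambda>e. V + e * V\<^sup>2 / 2) \<longlongrightarrow> V + 0 * V\<^sup>2 / 2) (at_right 0)"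
    by (intro tendsto_intros) auto
  moreover have "\<forall>\<^sub>F e in at_right 0. (\<integral>\<omega>. (Z \<omega>)\<^sup>2 \<partial>M) \<le> V + e * V\<^sup>2 / 2"
  proof -
    have "\<forall>\<^sub>F e in at_right 0. 0 < e \<and> e < 2 / (V + 1)"
      using V by (intro eventually_conj eventually_at_right_less eventually_at_rightI[of 0 "2 / (V + 1)"]) auto
    then show ?thesis
    proof (rule eventually_mono)
      fix e assume e: "0 < e \<and> e < 2 / (V + 1)"
      then have "e * (V + 1) < 2" using V by (simp add: field_simps)
      then have "e * V / 2 \<le> 1" using e by (simp add: algebra_simps)
      then show "(\<integral>\<omega>. (Z \<omega>)\<^sup>2 \<partial>M) \<le> V + e * V\<^sup>2 / 2" using e le by blast
    qed
  qed
  ultimately have "(\<integral>\<omega>. (Z \<omega>)\<^sup>2 \<partial>M) \<le> V + 0 * V\<^sup>2 / 2"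
    by (rule tendsto_lowerbound) simp
  then show ?thesis by (simp add: Z_def)
qed

text \<open>The mean minimizes the mean square deviation, so \<open>smoothing r F x\<close> may be
  replaced by \<open>F x\<close>. The linear term of the expansion gives
  \<open>V * r\<^sup>2\<close>, its product with the remainder gives r^3, and the squared remainder
  r^4 is at most r^3 for r at most 1.\<close>

lemma noise_bound_of_gradient:
  fixes F :: "'v \<Rightarrow> complex" and F' :: "'v \<Rightarrow> 'v \<Rightarrow> complex"
  assumes l: "0 \<le> l" and c: "0 \<le> c"
    and B: "\<And>x. cmod (F x) \<le> B" and lip: "\<And>x y. cmod (F x - F y) \<le> l * norm (x - y)"
    and lin: "\<And>x. linear (F' x)" and F'_le: "\<And>x h. cmod (F' x h) \<le> l * norm h"
    and taylor: "\<And>x h. cmod (F (x + h) - F x - F' x h) \<le> c * (norm h)\<^sup>2"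
    and grad: "\<And>x. (\<integral>\<omega>. (cmod (F' x (X \<omega>)))\<^sup>2 \<partial>M) \<le> V"
  shows "noise_bound B l V (2 * l * c * (\<integral>\<omega>. norm (X \<omega>) ^ 3 \<partial>M) + c\<^sup>2 * (\<integral>\<omega>. norm (X \<omega>) ^ 4 \<partial>M)) F"
proof -
  have [measurable]: "F \<in> borel_measurable borel"
  proof (rule borel_measurable_continuous_onI, rule lipschitz_on_continuous_on[of l], rule lipschitz_onI)
    show "dist (F x) (F y) \<le> l * dist x y" for x y using lip by (simp add: dist_norm)
  qed (rule l)
  have [measurable]: "F' x \<in> borel_measurable borel" for x
    by (intro borel_measurable_continuous_onI linear_continuous_on linear_linear[THEN iffD2] lin)
  have "(\<integral>\<omega>. (cmod (F (x + r *\<^sub>R X \<omega>) - smoothing r F x))\<^sup>2 \<partial>M)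
      \<le> V * r\<^sup>2 + (2 * l * c * (\<integral>\<omega>. norm (X \<omega>) ^ 3 \<partial>M) + c\<^sup>2 * (\<integral>\<omega>. norm (X \<omega>) ^ 4 \<partial>M)) * r ^ 3"
    if r: "0 \<le> r" "r \<le> 1" for x r
  proof -
    have F'int: "integrable M (\<lambda>\<omega>. (cmod (F' x (X \<omega>)))\<^sup>2)"
    proof (rule Bochner_Integration.integrable_bound)
      show "integrable M (\<lambda>\<omega>. l\<^sup>2 * norm (X \<omega>) ^ 2)" using integrable_norm_power[of 2] by simp
      show "AE \<omega> in M. norm ((cmod (F' x (X \<omega>)))\<^sup>2) \<le> norm (l\<^sup>2 * norm (X \<omega>) ^ 2)"
        using power_mono[OF F'_le norm_ge_zero, of x _ 2] by (simp add: power_mult_distrib)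
    qed simp
    have "(\<integral>\<omega>. (cmod (F (x + r *\<^sub>R X \<omega>) - smoothing r F x))\<^sup>2 \<partial>M)
        \<le> (\<integral>\<omega>. (cmod (F (x + r *\<^sub>R X \<omega>) - F x))\<^sup>2 \<partial>M)"
      unfolding smoothing_def by (rule variance_le_second_moment[where B = B]) (auto simp: B)
    also have "\<dots> \<le> (\<integral>\<omega>. r\<^sup>2 * (cmod (F' x (X \<omega>)))\<^sup>2 + 2 * l * c * r ^ 3 * norm (X \<omega>) ^ 3
          + c\<^sup>2 * r ^ 3 * norm (X \<omega>) ^ 4 \<partial>M)"
    proof (rule integral_mono)
      show "integrable M (\<lambda>\<omega>. (cmod (F (x + r *\<^sub>R X \<omega>) - F x))\<^sup>2)"
      proof (rule integrable_bounded[where B = "(B + B)\<^sup>2"])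
        show "norm ((cmod (F (x + r *\<^sub>R X \<omega>) - F x))\<^sup>2) \<le> (B + B)\<^sup>2" for \<omega>
          using power_mono[OF order_trans[OF norm_triangle_ineq4 add_mono[OF B B]] norm_ge_zero, of "x + r *\<^sub>R X \<omega>" x 2]
          by simp
      qed simp
      show "(cmod (F (x + r *\<^sub>R X \<omega>) - F x))\<^sup>2 \<le> r\<^sup>2 * (cmod (F' x (X \<omega>)))\<^sup>2 + 2 * l * c * r ^ 3 * norm (X \<omega>) ^ 3
          + c\<^sup>2 * r ^ 3 * norm (X \<omega>) ^ 4" for \<omega>
      proof -
        define u where "u = cmod (F' x (X \<omega>))"
        define n where "n = norm (X \<omega>)"
        have u: "0 \<le> u" "u \<le> l * n" using F'_le by (auto simp: u_def n_def)
        have n: "0 \<le> n" by (simp add: n_def)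
        have "F' x (r *\<^sub>R X \<omega>) = r *\<^sub>R F' x (X \<omega>)" by (rule linear_scale[OF lin])
        then have "cmod (F (x + r *\<^sub>R X \<omega>) - F x - r *\<^sub>R F' x (X \<omega>)) \<le> c * (r * n)\<^sup>2"
          using taylor[of x "r *\<^sub>R X \<omega>"] r by (simp add: n_def)
        then have "cmod (F (x + r *\<^sub>R X \<omega>) - F x) \<le> r * u + c * (r * n)\<^sup>2"
          using norm_triangle_ineq[of "F (x + r *\<^sub>R X \<omega>) - F x - r *\<^sub>R F' x (X \<omega>)" "r *\<^sub>R F' x (X \<omega>)"] r
          by (simp add: u_def)
        then have "(cmod (F (x + r *\<^sub>R X \<omega>) - F x))\<^sup>2 \<le> (r * u + c * (r * n)\<^sup>2)\<^sup>2"
          by (rule power_mono) simp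
        also have "\<dots> = r\<^sup>2 * u\<^sup>2 + 2 * c * r ^ 3 * n\<^sup>2 * u + c\<^sup>2 * n ^ 4 * r ^ 4"
          by (simp add: power2_eq_square power3_eq_cube power4_eq_xxxx algebra_simps)
        also have "2 * c * r ^ 3 * n\<^sup>2 * u \<le> 2 * c * r ^ 3 * n\<^sup>2 * (l * n)"
          using c r n u by (intro mult_left_mono) auto
        also have "c\<^sup>2 * n ^ 4 * r ^ 4 \<le> c\<^sup>2 * n ^ 4 * r ^ 3"
          using r n by (intro mult_left_mono power_decreasing) auto
        finally show ?thesis
          by (simp add: u_def n_def power2_eq_square power3_eq_cube algebra_simps)
      qed
    qed (use F'int integrable_norm_power[of 3] integrable_norm4 in auto)
    also have "\<dots> = r\<^sup>2 * (\<integral>\<omega>. (cmod (F' x (X \<omega>)))\<^sup>2 \<partial>M)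
        + 2 * l * c * r ^ 3 * (\<integral>\<omega>. norm (X \<omega>) ^ 3 \<partial>M) + c\<^sup>2 * r ^ 3 * (\<integral>\<omega>. norm (X \<omega>) ^ 4 \<partial>M)"
      using F'int integrable_norm_power[of 3] integrable_norm4 by simp
    also have "\<dots> \<le> r\<^sup>2 * V
        + 2 * l * c * r ^ 3 * (\<integral>\<omega>. norm (X \<omega>) ^ 3 \<partial>M) + c\<^sup>2 * r ^ 3 * (\<integral>\<omega>. norm (X \<omega>) ^ 4 \<partial>M)"
      using grad by (intro add_right_mono mult_left_mono) auto
    finally show ?thesis by (simp add: algebra_simps)
  qed
  then show ?thesis using l B lip by (simp add: noise_bound_def)
qed

end

section \<open>Gaussian integration by parts\<close>

context stable_law
begin

lemma integrable_pair_dominated: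
  fixes f :: "'a \<times> 'a \<Rightarrow> complex"
  assumes [measurable]: "f \<in> borel_measurable (M \<Otimes>\<^sub>M M)"
    and le: "\<And>u v. cmod (f (u, v)) \<le> B * (norm (X u) + norm (X v))"
  shows "integrable (M \<Otimes>\<^sub>M M) f"
proof (rule pair.Fubini_integrable)
  have int: "integrable M (\<lambda>v. f (u, v))" if "u \<in> space M" for u
  proof (rule Bochner_Integration.integrable_bound)
    show "integrable M (\<lambda>v. B * (norm (X u) + norm (X v)))" using integrable_norm by simp
    show "AE v in M. norm (f (u, v)) \<le> norm (B * (norm (X u) + norm (X v)))"
      using order_trans[OF le abs_ge_self] by simp
    show "(\<lambda>v. f (u, v)) \<in> borel_measurable M" using that by measurable
  qed
  then show "AE u in M. integrable M (\<lambda>v. f (u, v))" by simp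
  show "integrable M (\<lambda>u. \<integral>v. norm (f (u, v)) \<partial>M)"
  proof (rule Bochner_Integration.integrable_bound)
    show "integrable M (\<lambda>u. B * (norm (X u) + (\<integral>v. norm (X v) \<partial>M)))" using integrable_norm by simp
    show "AE u in M. norm (\<integral>v. norm (f (u, v)) \<partial>M) \<le> norm (B * (norm (X u) + (\<integral>v. norm (X v) \<partial>M)))"
    proof (rule AE_I2)
      fix u assume u: "u \<in> space M"
      have "(\<integral>v. norm (f (u, v)) \<partial>M) \<le> (\<integral>v. B * (norm (X u) + norm (X v)) \<partial>M)"
        using int[OF u] integrable_norm by (intro integral_mono le) auto
      also have "\<dots> = B * (norm (X u) + (\<integral>v. norm (X v) \<partial>M))"
        using integrable_norm by (simp add: prob_space)
      finally show "norm (\<integral>v. norm (f (u, v)) \<partial>M) \<le> norm (B * (norm (X u) + (\<integral>v. norm (X v) \<partial>M)))"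
        by (simp add: integral_nonneg_AE)
    qed
  qed simp
qed simp

lemma linear_bound:
  fixes \<phi> :: "'v \<Rightarrow> complex"
  assumes "linear \<phi>"
  obtains K where "0 < K" "\<And>x. cmod (\<phi> x) \<le> K * norm x"
  using linear_bounded_pos[OF assms] by (auto simp: mult.commute)

lemma linear_measurable: "linear (\<phi> :: 'v \<Rightarrow> complex) \<Longrightarrow> \<phi> \<in> borel_measurable borel"
  by (intro borel_measurable_continuous_onI linear_continuous_on linear_linear[THEN iffD2])

text \<open>Replace \<open>X\<close> by (X u + X v) / sqrt 2 and split the linear
  \<open>\<phi>\<close>. By symmetry both halves agree, which leaves the factor 2 / sqrt 2.\<close>

lemma exchange_half:
  fixes \<phi> f :: "'v \<Rightarrow> complex"
  assumes \<phi>: "linear \<phi>" and f: "f \<in> borel_measurable borel" "\<And>x. cmod (f x) \<le> B"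
  shows "(\<integral>u. \<phi> (X u) * f (X u) \<partial>M) =
    sqrt 2 * (\<integral>u. (\<integral>v. \<phi> (X v) * f ((1 / sqrt 2) *\<^sub>R X u + (1 / sqrt 2) *\<^sub>R X v) \<partial>M) \<partial>M)"
proof -
  note f(1)[measurable] linear_measurable[OF \<phi>, measurable]
  define a :: real where "a = 1 / sqrt 2"
  have a: "a\<^sup>2 + a\<^sup>2 = 1" "2 * a = sqrt 2" "0 < a" by (simp_all add: a_def power_divide real_div_sqrt)
  obtain K where K: "0 < K" "\<And>x. cmod (\<phi> x) \<le> K * norm x" using linear_bound[OF \<phi>] by blast
  have B: "0 \<le> B" using f(2)[of 0] norm_ge_zero order_trans by blast
  define S where "S = (\<lambda>(u, v). a *\<^sub>R X u + a *\<^sub>R X v)"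
  have [measurable]: "S \<in> borel_measurable (M \<Otimes>\<^sub>M M)" unfolding S_def by measurable
  have le: "cmod (\<phi> (X w) * f y) \<le> K * B * (norm (X u) + norm (X v))" if "w = u \<or> w = v" for u v w y
  proof -
    have "cmod (\<phi> (X w) * f y) \<le> (K * norm (X w)) * B"
      unfolding norm_mult using K f(2) by (intro mult_mono) auto
    also have "\<dots> \<le> (K * (norm (X u) + norm (X v))) * B"
      using K B that by (intro mult_right_mono mult_left_mono) auto
    finally show ?thesis by (simp add: mult_ac)
  qed
  have i1: "integrable (M \<Otimes>\<^sub>M M) (\<lambda>(u, v). \<phi> (X u) * f (S (u, v)))"
    and i2: "integrable (M \<Otimes>\<^sub>M M) (\<lambda>(u, v). \<phi> (X v) * f (S (u, v)))"
    by (rule integrable_pair_dominated[where B = "K * B"]; use le in force)+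
  have "(\<integral>u. \<phi> (X u) * f (X u) \<partial>M) = (\<integral>y. \<phi> y * f y \<partial>distr M borel X)"
    by (subst integral_distr) auto
  also have "\<dots> = (\<integral>p. \<phi> (S p) * f (S p) \<partial>(M \<Otimes>\<^sub>M M))"
    unfolding stable[OF a(3,3,1), symmetric] by (subst integral_distr) (auto simp: S_def)
  also have "\<dots> = (\<integral>p. a *\<^sub>R (case p of (u, v) \<Rightarrow> \<phi> (X u) * f (S (u, v)))
       + a *\<^sub>R (case p of (u, v) \<Rightarrow> \<phi> (X v) * f (S (u, v))) \<partial>(M \<Otimes>\<^sub>M M))"
    by (simp add: S_def case_prod_beta linear_add[OF \<phi>] linear_scale[OF \<phi>] distrib_right)
  also have "\<dots> = a *\<^sub>R (\<integral>p. (case p of (u, v) \<Rightarrow> \<phi> (X u) * f (S (u, v))) \<partial>(M \<Otimes>\<^sub>M M))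
       + a *\<^sub>R (\<integral>p. (case p of (u, v) \<Rightarrow> \<phi> (X v) * f (S (u, v))) \<partial>(M \<Otimes>\<^sub>M M))"
    using i1 i2 by simp
  also have "(\<integral>p. (case p of (u, v) \<Rightarrow> \<phi> (X u) * f (S (u, v))) \<partial>(M \<Otimes>\<^sub>M M))
     = (\<integral>v. (\<integral>u. \<phi> (X u) * f (S (u, v)) \<partial>M) \<partial>M)"
    using pair.integral_snd[OF i1] by simp
  also have "\<dots> = (\<integral>u. (\<integral>v. \<phi> (X v) * f (S (u, v)) \<partial>M) \<partial>M)"
    by (simp add: S_def add.commute)
  also have "(\<integral>p. (case p of (u, v) \<Rightarrow> \<phi> (X v) * f (S (u, v))) \<partial>(M \<Otimes>\<^sub>M M))
     = (\<integral>u. (\<integral>v. \<phi> (X v) * f (S (u, v)) \<partial>M) \<partial>M)"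
    using pair.integral_fst[OF i2] by simp
  finally have "(\<integral>u. \<phi> (X u) * f (X u) \<partial>M) = (2 * a) *\<^sub>R (\<integral>u. (\<integral>v. \<phi> (X v) * f (S (u, v)) \<partial>M) \<partial>M)"
    by (simp add: scaleR_conv_of_real algebra_simps)
  then show ?thesis unfolding a(2) by (simp add: S_def a_def scaleR_conv_of_real)
qed

text \<open>Each application of \<open>exchange_half\<close> to the inner integral releases half of
  the variance still tied to \<open>\<phi>\<close>. After k rounds the released part, of variance 1
  - 2^(-k), is an outer smoothing, and the prefactor is 2^(k/2).\<close>

lemma exchange_dyadic:
  fixes \<phi> f :: "'v \<Rightarrow> complex"
  assumes \<phi>: "linear \<phi>" and f: "f \<in> borel_measurable borel" "\<And>x. cmod (f x) \<le> B"
  shows "(\<integral>u. \<phi> (X u) * f (x + X u) \<partial>M) =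
    smoothing (sqrt (1 - 1 / 2 ^ k)) (\<lambda>y. sqrt (2 ^ k) * (\<integral>v. \<phi> (X v) * f (y + (1 / sqrt (2 ^ k)) *\<^sub>R X v) \<partial>M)) x"
proof (induction k)
  case 0
  show ?case by (simp add: smoothing_def prob_space)
next
  case (Suc k)
  note f(1)[measurable] linear_measurable[OF \<phi>, measurable]
  obtain K where K: "0 < K" "\<And>x. cmod (\<phi> x) \<le> K * norm x" using linear_bound[OF \<phi>] by blast
  have B: "0 \<le> B" using f(2)[of 0] norm_ge_zero order_trans by blast
  define \<tau> :: real where "\<tau> = 1 / sqrt (2 ^ Suc k)"
  define h where "h y = (\<integral>v. \<phi> (X v) * f (y + \<tau> *\<^sub>R X v) \<partial>M)" for y
  have [measurable]: "h \<in> borel_measurable borel" unfolding h_def by measurable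
  have hb: "cmod (h y) \<le> K * B * (\<integral>v. norm (X v) \<partial>M)" for y
  proof -
    have "cmod (h y) \<le> (\<integral>v. cmod (\<phi> (X v) * f (y + \<tau> *\<^sub>R X v)) \<partial>M)"
      unfolding h_def by (rule integral_norm_bound)
    also have "\<dots> \<le> (\<integral>v. K * B * norm (X v) \<partial>M)"
    proof (rule integral_mono_AE')
      show "integrable M (\<lambda>v. K * B * norm (X v))" using integrable_norm by simp
      show "AE v in M. cmod (\<phi> (X v) * f (y + \<tau> *\<^sub>R X v)) \<le> K * B * norm (X v)"
      proof (rule AE_I2)
        fix v
        have "cmod (\<phi> (X v) * f (y + \<tau> *\<^sub>R X v)) \<le> (K * norm (X v)) * B"
          unfolding norm_mult using K f(2) by (intro mult_mono) auto
        then show "cmod (\<phi> (X v) * f (y + \<tau> *\<^sub>R X v)) \<le> K * B * norm (X v)" by (simp add: mult_ac)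
      qed
    qed (use K B in auto)
    finally show ?thesis by simp
  qed
  define \<sigma> :: real where "\<sigma> = sqrt (1 - 1 / 2 ^ k)"
  have "(\<integral>u. \<phi> (X u) * f (x + X u) \<partial>M) = (\<integral>u. sqrt (2 ^ k) * (\<integral>v. \<phi> (X v) * f (x + \<sigma> *\<^sub>R X u + (1 / sqrt (2 ^ k)) *\<^sub>R X v) \<partial>M) \<partial>M)"
    using Suc.IH by (simp add: smoothing_def \<sigma>_def)
  also have "\<dots> = (\<integral>u. sqrt (2 ^ Suc k) * (\<integral>v. h (x + \<sigma> *\<^sub>R X u + \<tau> *\<^sub>R X v) \<partial>M) \<partial>M)"
  proof (rule Bochner_Integration.integral_cong[OF refl])
    \<comment> \<open>The base point \<open>y\<close> is frozen and the exchange is applied to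
      \<open>f\<close> rescaled around it; the free half of the noise then joins the outer
      smoothing.\<close>
    fix u
    define y where "y = x + \<sigma> *\<^sub>R X u"
    have "(\<integral>v. \<phi> (X v) * f (y + (1 / sqrt (2 ^ k)) *\<^sub>R X v) \<partial>M)
      = sqrt 2 * (\<integral>u. (\<integral>v. \<phi> (X v) * f (y + (1 / sqrt (2 ^ k)) *\<^sub>R ((1 / sqrt 2) *\<^sub>R X u + (1 / sqrt 2) *\<^sub>R X v)) \<partial>M) \<partial>M)"
      by (rule exchange_half[OF \<phi>, of "\<lambda>w. f (y + (1 / sqrt (2 ^ k)) *\<^sub>R w)" B]) (auto simp: f(2))
    also have "\<dots> = sqrt 2 * (\<integral>v. h (y + \<tau> *\<^sub>R X v) \<partial>M)"
      by (simp add: h_def \<tau>_def real_sqrt_mult scaleR_add_right add.assoc mult.commute)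
    finally have "sqrt (2 ^ k) * (\<integral>v. \<phi> (X v) * f (y + (1 / sqrt (2 ^ k)) *\<^sub>R X v) \<partial>M)
       = sqrt (2 ^ k) * (sqrt 2 * (\<integral>v. h (y + \<tau> *\<^sub>R X v) \<partial>M))" by simp
    also have "\<dots> = sqrt (2 ^ Suc k) * (\<integral>v. h (y + \<tau> *\<^sub>R X v) \<partial>M)"
      by (simp add: real_sqrt_mult)
    finally show "sqrt (2 ^ k) * (\<integral>v. \<phi> (X v) * f (x + \<sigma> *\<^sub>R X u + (1 / sqrt (2 ^ k)) *\<^sub>R X v) \<partial>M)
       = sqrt (2 ^ Suc k) * (\<integral>v. h (x + \<sigma> *\<^sub>R X u + \<tau> *\<^sub>R X v) \<partial>M)" unfolding y_def .
  qed
  also have "\<dots> = sqrt (2 ^ Suc k) * smoothing (sqrt (\<sigma>\<^sup>2 + \<tau>\<^sup>2)) h x"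
    using smoothing_smoothing_integral[of h "K * B * (\<integral>v. norm (X v) \<partial>M)" \<sigma> \<tau> x] hb
    by (simp add: \<sigma>_def \<tau>_def)
  also have "\<sigma>\<^sup>2 + \<tau>\<^sup>2 = 1 - 1 / 2 ^ Suc k"
    by (simp add: \<sigma>_def \<tau>_def power_divide field_simps)
  also have "sqrt (2 ^ Suc k) * smoothing (sqrt (1 - 1 / 2 ^ Suc k)) h x
     = smoothing (sqrt (1 - 1 / 2 ^ Suc k)) (\<lambda>y. sqrt (2 ^ Suc k) * h y) x"
    by (simp add: smoothing_def)
  finally show ?case unfolding h_def \<tau>_def .
qed

lemma integrable_X: "integrable M X"
  by (rule Bochner_Integration.integrable_bound[OF integrable_norm]) auto

text \<open>The exchange with a constant function says that the mean of
  \<open>\<phi> (X \<omega>)\<close> equals sqrt 2 times itself.\<close>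

lemma expectation_X: "(\<integral>\<omega>. X \<omega> \<partial>M) = 0"
proof -
  have "(\<integral>\<omega>. \<phi> (X \<omega>) \<partial>M) = 0" if \<phi>: "linear \<phi>" for \<phi> :: "'v \<Rightarrow> complex"
  proof -
    have "(\<integral>\<omega>. \<phi> (X \<omega>) \<partial>M) = sqrt 2 * (\<integral>\<omega>. \<phi> (X \<omega>) \<partial>M)"
      using exchange_half[OF \<phi>, of "\<lambda>_. 1" 1] by (simp add: prob_space)
    then have "(sqrt 2 - 1) * (\<integral>\<omega>. \<phi> (X \<omega>) \<partial>M) = 0" by (simp add: left_diff_distrib)
    moreover have "complex_of_real (sqrt 2) - 1 \<noteq> 0" by simp
    ultimately show ?thesis by simp
  qed
  note zero = this
  have "(\<integral>\<omega>. X \<omega> \<partial>M) \<bullet> b = 0" for b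
  proof -
    have "linear (\<lambda>x. complex_of_real (x \<bullet> b))"
      by (rule linearI) (simp_all add: inner_add_left scaleR_conv_of_real)
    from zero[OF this] have "complex_of_real (\<integral>\<omega>. X \<omega> \<bullet> b \<partial>M) = 0"
      by (simp only: integral_complex_of_real)
    then show ?thesis using integral_inner_left[of b M X] integrable_X by simp
  qed
  then show ?thesis by (metis inner_eq_zero_iff)
qed

text \<open>
  After the dyadic exchange the factor \<open>\<phi> (X v)\<close> only sees noise of size \<open>2 powr (- k / 2)\<close> inside
  \<open>f\<close>, so a first-order expansion of \<open>f\<close> suffices as \<open>k\<close> grows.
\<close>

theorem gaussian_integration_by_parts:
  fixes \<phi> f g :: "'v \<Rightarrow> complex" and f' :: "'v \<Rightarrow> 'v \<Rightarrow> complex"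
  assumes \<phi>: "linear \<phi>" and f: "f \<in> borel_measurable borel" "\<And>x. cmod (f x) \<le> B"
    and lin: "\<And>x. linear (f' x)" and c: "0 \<le> c"
    and taylor: "\<And>x h. cmod (f (x + h) - f x - f' x h) \<le> c * (norm h)\<^sup>2"
    and g: "\<And>x. (\<integral>\<omega>. \<phi> (X \<omega>) * f' x (X \<omega>) \<partial>M) = g x"
    and g_bound: "\<And>x. cmod (g x) \<le> B'" and g_lip: "\<And>x y. cmod (g x - g y) \<le> l * norm (x - y)" and l: "0 \<le> l"
  shows "(\<integral>\<omega>. \<phi> (X \<omega>) * f (x + X \<omega>) \<partial>M) = (\<integral>\<omega>. g (x + X \<omega>) \<partial>M)"
proof -
  note f(1)[measurable] linear_measurable[OF \<phi>, measurable] linear_measurable[OF lin, measurable]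
  obtain K where K: "0 < K" "\<And>x. cmod (\<phi> x) \<le> K * norm x" using linear_bound[OF \<phi>] by blast
  have [measurable]: "g \<in> borel_measurable borel"
  proof (rule borel_measurable_continuous_onI, rule lipschitz_on_continuous_on[of l], rule lipschitz_onI)
    show "dist (g x) (g y) \<le> l * dist x y" for x y using g_lip by (simp add: dist_norm)
  qed (rule l)
  define m1 where "m1 = (\<integral>\<omega>. norm (X \<omega>) \<partial>M)"
  define m3 where "m3 = (\<integral>\<omega>. norm (X \<omega>) ^ 3 \<partial>M)"
  have \<phi>X: "integrable M (\<lambda>\<omega>. \<phi> (X \<omega>))"
    by (rule Bochner_Integration.integrable_bound[of _ "\<lambda>\<omega>. K * norm (X \<omega>)"])
      (use integrable_norm K in \<open>auto simp: abs_mult\<close>)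
  have \<phi>0: "(\<integral>\<omega>. \<phi> (X \<omega>) \<partial>M) = 0"
    using integral_bounded_linear[OF linear_linear[THEN iffD2, OF \<phi>] integrable_X] expectation_X linear_0[OF \<phi>] by simp
  \<comment> \<open>Expansion of \<open>f\<close> at \<open>y\<close>: the constant term drops out
    since \<open>\<phi> (X \<omega>)\<close> is centred, the linear term scaled by \<open>s\<close>
    is exactly \<open>g y\<close>, and the quadratic remainder leaves an error of order 1/s.\<close>
  have first_order: "cmod (s * (\<integral>\<omega>. \<phi> (X \<omega>) * f (y + (1 / s) *\<^sub>R X \<omega>) \<partial>M) - g y) \<le> K * c * m3 / s"
    if s: "0 < s" for s :: real and y
  proof -
    obtain L where L: "0 < L" "\<And>h. cmod (f' y h) \<le> L * norm h" using linear_bound[OF lin] by blast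
    define R where "R \<omega> = f (y + (1 / s) *\<^sub>R X \<omega>) - f y - f' y ((1 / s) *\<^sub>R X \<omega>)" for \<omega>
    have i1: "integrable M (\<lambda>\<omega>. \<phi> (X \<omega>) * f (y + (1 / s) *\<^sub>R X \<omega>))"
    proof (rule Bochner_Integration.integrable_bound[of _ "\<lambda>\<omega>. K * norm (X \<omega>) * B"])
      show "AE \<omega> in M. norm (\<phi> (X \<omega>) * f (y + (1 / s) *\<^sub>R X \<omega>)) \<le> norm (K * norm (X \<omega>) * B)"
        unfolding norm_mult by (intro AE_I2 mult_mono) (use K f(2) in \<open>auto intro: order_trans[OF f(2) abs_ge_self]\<close>)
    qed (use integrable_norm in auto)
    have i2: "integrable M (\<lambda>\<omega>. \<phi> (X \<omega>) * f' y (X \<omega>))"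
    proof (rule Bochner_Integration.integrable_bound[of _ "\<lambda>\<omega>. (K * L) * norm (X \<omega>) ^ 2"])
      show "AE \<omega> in M. norm (\<phi> (X \<omega>) * f' y (X \<omega>)) \<le> norm ((K * L) * norm (X \<omega>) ^ 2)"
      proof (rule AE_I2)
        fix \<omega>
        have "norm (\<phi> (X \<omega>) * f' y (X \<omega>)) \<le> (K * norm (X \<omega>)) * (L * norm (X \<omega>))"
          unfolding norm_mult using K L by (intro mult_mono) auto
        also have "\<dots> = norm ((K * L) * norm (X \<omega>) ^ 2)"
          using K L by (simp add: abs_mult power2_eq_square)
        finally show "norm (\<phi> (X \<omega>) * f' y (X \<omega>)) \<le> norm ((K * L) * norm (X \<omega>) ^ 2)" .
      qed
    qed (use integrable_norm_power[of 2] in auto)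
    have R_eq: "\<phi> (X \<omega>) * R \<omega> = \<phi> (X \<omega>) * f (y + (1 / s) *\<^sub>R X \<omega>) - \<phi> (X \<omega>) * f y - (1 / s) *\<^sub>R (\<phi> (X \<omega>) * f' y (X \<omega>))" for \<omega>
      by (simp add: R_def linear_scale[OF lin] right_diff_distrib)
    have iR: "integrable M (\<lambda>\<omega>. \<phi> (X \<omega>) * R \<omega>)" unfolding R_eq using i1 i2 \<phi>X by simp
    have "(\<integral>\<omega>. \<phi> (X \<omega>) * R \<omega> \<partial>M) = (\<integral>\<omega>. \<phi> (X \<omega>) * f (y + (1 / s) *\<^sub>R X \<omega>) \<partial>M) - (1 / s) *\<^sub>R g y"
      unfolding R_eq using i1 i2 \<phi>X \<phi>0 g[of y] by simp
    then have "s * (\<integral>\<omega>. \<phi> (X \<omega>) * f (y + (1 / s) *\<^sub>R X \<omega>) \<partial>M) - g y = s * (\<integral>\<omega>. \<phi> (X \<omega>) * R \<omega> \<partial>M)"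
      using s by (simp add: right_diff_distrib scaleR_conv_of_real)
    then have "cmod (s * (\<integral>\<omega>. \<phi> (X \<omega>) * f (y + (1 / s) *\<^sub>R X \<omega>) \<partial>M) - g y) = s * cmod (\<integral>\<omega>. \<phi> (X \<omega>) * R \<omega> \<partial>M)"
      using s by (simp add: norm_mult)
    also have "cmod (\<integral>\<omega>. \<phi> (X \<omega>) * R \<omega> \<partial>M) \<le> (\<integral>\<omega>. cmod (\<phi> (X \<omega>) * R \<omega>) \<partial>M)"
      by (rule integral_norm_bound)
    also have "\<dots> \<le> (\<integral>\<omega>. K * c / s\<^sup>2 * norm (X \<omega>) ^ 3 \<partial>M)"
    proof (rule integral_mono)
      fix \<omega>
      have "cmod (R \<omega>) \<le> c * (norm ((1 / s) *\<^sub>R X \<omega>))\<^sup>2" unfolding R_def by (rule taylor)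
      then have "cmod (\<phi> (X \<omega>) * R \<omega>) \<le> (K * norm (X \<omega>)) * (c * (norm ((1 / s) *\<^sub>R X \<omega>))\<^sup>2)"
        unfolding norm_mult using K by (intro mult_mono) auto
      also have "\<dots> = K * c / s\<^sup>2 * norm (X \<omega>) ^ 3"
        using s by (simp add: power_divide power2_eq_square power3_eq_cube)
      finally show "cmod (\<phi> (X \<omega>) * R \<omega>) \<le> K * c / s\<^sup>2 * norm (X \<omega>) ^ 3" .
    qed (use iR integrable_norm_power[of 3] in auto)
    also have "s * (\<integral>\<omega>. K * c / s\<^sup>2 * norm (X \<omega>) ^ 3 \<partial>M) = K * c * m3 / s"
      using s by (simp add: m3_def power2_eq_square)
    finally show ?thesis using s by simp
  qed
  define E where "E = (\<integral>\<omega>. \<phi> (X \<omega>) * f (x + X \<omega>) \<partial>M)"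
  \<comment> \<open>Two errors: the first-order expansion at scale s = 2^(k/2), and the change of
    the outer noise size from \<open>\<sigma>\<close> to 1, controlled by the Lipschitz constant of
    \<open>g\<close>.\<close>
  have bound: "cmod (E - smoothing 1 g x) \<le> K * c * m3 * (1 / sqrt (2 ^ k)) + l * m1 * (1 - sqrt (1 - 1 / 2 ^ k))" for k :: nat
  proof -
    define s :: real where "s = sqrt (2 ^ k)"
    define \<sigma> :: real where "\<sigma> = sqrt (1 - 1 / 2 ^ k)"
    have s: "0 < s" by (simp add: s_def)
    have \<sigma>: "0 \<le> \<sigma>" "\<sigma> \<le> 1" by (auto simp: \<sigma>_def)
    define h where "h y = s * (\<integral>v. \<phi> (X v) * f (y + (1 / s) *\<^sub>R X v) \<partial>M)" for y
    have [measurable]: "h \<in> borel_measurable borel" unfolding h_def by measurable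
    have hg: "cmod (h y - g y) \<le> K * c * m3 / s" for y unfolding h_def by (rule first_order[OF s])
    have hb: "cmod (h y) \<le> K * c * m3 / s + B'" for y
      using norm_triangle_ineq[of "h y - g y" "g y"] hg[of y] g_bound[of y] by simp
    have hi: "integrable M (\<lambda>\<omega>. h (x + \<sigma> *\<^sub>R X \<omega>))" by (rule integrable_bounded[OF _ hb]) simp
    have gi: "integrable M (\<lambda>\<omega>. g (x + r *\<^sub>R X \<omega>))" for r by (rule integrable_bounded[OF _ g_bound]) simp
    have "E = smoothing \<sigma> h x"
      unfolding E_def h_def \<sigma>_def s_def by (rule exchange_dyadic[OF \<phi> f])
    then have Eeq: "E - smoothing 1 g x = (\<integral>\<omega>. (h (x + \<sigma> *\<^sub>R X \<omega>) - g (x + \<sigma> *\<^sub>R X \<omega>)) + (g (x + \<sigma> *\<^sub>R X \<omega>) - g (x + 1 *\<^sub>R X \<omega>)) \<partial>M)"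
      unfolding smoothing_def using hi gi[of \<sigma>] gi[of 1] by simp
    have "cmod (E - smoothing 1 g x) \<le> (\<integral>\<omega>. cmod ((h (x + \<sigma> *\<^sub>R X \<omega>) - g (x + \<sigma> *\<^sub>R X \<omega>)) + (g (x + \<sigma> *\<^sub>R X \<omega>) - g (x + 1 *\<^sub>R X \<omega>))) \<partial>M)"
      unfolding Eeq by (rule integral_norm_bound)
    also have "\<dots> \<le> (\<integral>\<omega>. K * c * m3 / s + l * (1 - \<sigma>) * norm (X \<omega>) \<partial>M)"
    proof (rule integral_mono)
      fix \<omega>
      have eq: "(x + \<sigma> *\<^sub>R X \<omega>) - (x + 1 *\<^sub>R X \<omega>) = (\<sigma> - 1) *\<^sub>R X \<omega>"
        by (simp only: scaleR_left_diff_distrib add_diff_cancel_left)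
      have nm: "l * norm ((\<sigma> - 1) *\<^sub>R X \<omega>) = l * (1 - \<sigma>) * norm (X \<omega>)"
        using \<sigma> by simp
      have "cmod (g (x + \<sigma> *\<^sub>R X \<omega>) - g (x + 1 *\<^sub>R X \<omega>)) \<le> l * (1 - \<sigma>) * norm (X \<omega>)"
        using g_lip[of "x + \<sigma> *\<^sub>R X \<omega>" "x + 1 *\<^sub>R X \<omega>"] unfolding eq nm .
      then show "cmod ((h (x + \<sigma> *\<^sub>R X \<omega>) - g (x + \<sigma> *\<^sub>R X \<omega>)) + (g (x + \<sigma> *\<^sub>R X \<omega>) - g (x + 1 *\<^sub>R X \<omega>)))
          \<le> K * c * m3 / s + l * (1 - \<sigma>) * norm (X \<omega>)"
        using norm_triangle_ineq[of "h (x + \<sigma> *\<^sub>R X \<omega>) - g (x + \<sigma> *\<^sub>R X \<omega>)" "g (x + \<sigma> *\<^sub>R X \<omega>) - g (x + 1 *\<^sub>R X \<omega>)"]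
          hg[of "x + \<sigma> *\<^sub>R X \<omega>"] by linarith
    qed (use hi gi[of \<sigma>] gi[of 1] integrable_norm in auto)
    also have "\<dots> = K * c * m3 / s + l * (1 - \<sigma>) * m1"
      using integrable_norm by (simp add: prob_space m1_def)
    finally show ?thesis by (simp add: s_def \<sigma>_def mult_ac)
  qed
  have half: "(\<lambda>k. 1 / 2 ^ k :: real) \<longlonglongrightarrow> 0"
    using LIMSEQ_divide_realpow_zero[of 2 1] by simp
  have "(\<lambda>k. K * c * m3 * sqrt (1 / 2 ^ k) + l * m1 * (1 - sqrt (1 - 1 / 2 ^ k)))
      \<longlonglongrightarrow> K * c * m3 * sqrt 0 + l * m1 * (1 - sqrt (1 - 0))"
    by (intro tendsto_intros half)
  then have "(\<lambda>k. K * c * m3 * (1 / sqrt (2 ^ k)) + l * m1 * (1 - sqrt (1 - 1 / 2 ^ k))) \<longlonglongrightarrow> 0"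
    by (simp add: real_sqrt_divide)
  then have "cmod (E - smoothing 1 g x) \<le> 0"
    using bound by (intro LIMSEQ_le_const) auto
  then show ?thesis by (simp add: E_def smoothing_def)
qed

end

section \<open>Resolvents of Gaussian matrices\<close>

lemma norm_matrix_vector_mult_le:
  fixes A :: "complex ^ 'n ^ 'm"
  shows "norm (A *v v) \<le> norm A * norm v"
proof -
  have "(norm (A *v v))\<^sup>2 = (\<Sum>i\<in>UNIV. (cmod (\<Sum>j\<in>UNIV. A $ i $ j * v $ j))\<^sup>2)"
    unfolding norm_vec_power2 by (simp add: matrix_vector_mult_def)
  also have "\<dots> \<le> (\<Sum>i\<in>UNIV. (norm (A $ i) * norm v)\<^sup>2)"
    by (intro sum_mono power_mono cmod_sum_mult_le_norm) simp
  also have "\<dots> = (norm A * norm v)\<^sup>2"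
    by (simp add: power_mult_distrib norm_vec_power2[of A] sum_distrib_right)
  finally show ?thesis by (rule power2_le_imp_le) simp
qed

lemma norm_matrix_mult_le: "norm (A ** B) \<le> norm A * norm (B :: complex ^ 'n ^ 'n)" for A :: "complex ^ 'n ^ 'n"
  by (rule norm_matrix_matrix_mult_le) (rule norm_matrix_vector_mult_le)

definition hermitian_part :: "complex ^ 'n ^ 'n \<Rightarrow> complex ^ 'n ^ 'n" where
  "hermitian_part H = (1 / 2) *\<^sub>R (H + adjm H)"

lemma hermitian_part_entry: "hermitian_part H $ i $ j = (H $ i $ j + cnj (H $ j $ i)) / 2"
  by (simp add: hermitian_part_def adjm_def) (simp add: scaleR_conv_of_real)

lemma hermitian_part_add: "hermitian_part (A + B) = hermitian_part A + hermitian_part B"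
  by (simp add: vec_eq_iff hermitian_part_entry add_divide_distrib)

lemma hermitian_part_scaleR: "hermitian_part (r *\<^sub>R A) = r *\<^sub>R hermitian_part A"
  by (simp add: vec_eq_iff hermitian_part_entry) (simp add: scaleR_conv_of_real algebra_simps)

lemma hermitian_part_diff: "hermitian_part (A - B) = hermitian_part A - hermitian_part B"
  by (simp add: vec_eq_iff hermitian_part_entry algebra_simps flip: diff_divide_distrib)

lemma hermitian_hermitian_part: "hermitian (hermitian_part H)"
  by (simp add: hermitian_iff_entries hermitian_part_entry add.commute)

lemma hermitian_part_hermitian: "hermitian H \<Longrightarrow> hermitian_part H = H"
  by (simp add: vec_eq_iff hermitian_part_entry hermitian_entry)

lemma norm_hermitian_part_le: "norm (hermitian_part H) \<le> norm H"
proof -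
  have "(norm (adjm H))\<^sup>2 = (norm H)\<^sup>2"
    unfolding norm_matrix_power2 adjm_def by (simp, rule sum.swap)
  then have "norm (adjm H) = norm H" by simp
  then show ?thesis
    using norm_triangle_ineq[of H "adjm H"] by (simp add: hermitian_part_def)
qed

lemma hermitian_add: "hermitian A \<Longrightarrow> hermitian B \<Longrightarrow> hermitian (A + B)"
  by (simp add: hermitian_iff_entries)

lemma norm_diagm_power2: "(norm (diagm b))\<^sup>2 = (\<Sum>i\<in>UNIV. (cmod (b i))\<^sup>2)"
  unfolding norm_matrix_power2 diagm_def
  by (simp add: if_distrib[where f = cmod] if_distrib[where f = "\<lambda>x. x\<^sup>2"] cong: if_cong)

text \<open>The trace of \<open>diagm b ** A\<close>. An indicator \<open>b\<close> gives a diagonal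
  entry, a row of \<open>\<sigma>\<close> gives a diagonal entry of the self-energy.\<close>

definition weighted_trace :: "('n \<Rightarrow> complex) \<Rightarrow> complex ^ 'n ^ 'n \<Rightarrow> complex" where
  "weighted_trace b A = (\<Sum>i\<in>UNIV. b i * A $ i $ i)"

lemma cmod_weighted_trace_le: "cmod (weighted_trace b A) \<le> (\<Sum>i\<in>UNIV. cmod (b i)) * norm A"
  unfolding weighted_trace_def sum_distrib_right
  by (intro order_trans[OF norm_sum] sum_mono) (simp add: norm_mult mult_left_mono cmod_entry_le_norm)

lemma weighted_trace_diff: "weighted_trace b (A - B) = weighted_trace b A - weighted_trace b B"
  by (simp add: weighted_trace_def sum_subtractf algebra_simps)

text \<open>Cyclicity of the trace. It exhibits \<open>R ** diagm b ** R\<close> as the gradient of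
  the weighted trace of the resolvent.\<close>

lemma weighted_trace_sandwich:
  fixes R K :: "complex ^ 'n ^ 'n"
  shows   "weighted_trace b (R ** K ** R) = (\<Sum>k\<in>UNIV. \<Sum>m\<in>UNIV. (R ** diagm b ** R) $ m $ k * K $ k $ m)"
proof -
  have "weighted_trace b (R ** K ** R) = (\<Sum>i\<in>UNIV. \<Sum>m\<in>UNIV. \<Sum>k\<in>UNIV. b i * (R $ i $ k * K $ k $ m * R $ m $ i))"
    by (simp add: weighted_trace_def matrix_matrix_mult_def sum_distrib_left sum_distrib_right)
  also have "\<dots> = (\<Sum>i\<in>UNIV. \<Sum>k\<in>UNIV. \<Sum>m\<in>UNIV. b i * (R $ i $ k * K $ k $ m * R $ m $ i))"
    by (intro sum.cong refl sum.swap)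
  also have "\<dots> = (\<Sum>k\<in>UNIV. \<Sum>i\<in>UNIV. \<Sum>m\<in>UNIV. b i * (R $ i $ k * K $ k $ m * R $ m $ i))"
    by (rule sum.swap)
  also have "\<dots> = (\<Sum>k\<in>UNIV. \<Sum>m\<in>UNIV. \<Sum>i\<in>UNIV. b i * (R $ i $ k * K $ k $ m * R $ m $ i))"
    by (intro sum.cong refl sum.swap)
  also have "\<dots> = (\<Sum>k\<in>UNIV. \<Sum>m\<in>UNIV. (\<Sum>i\<in>UNIV. R $ m $ i * R $ i $ k * b i) * K $ k $ m)"
    unfolding sum_distrib_right by (intro sum.cong refl) (simp only: mult_ac)
  also have "\<dots> = (\<Sum>k\<in>UNIV. \<Sum>m\<in>UNIV. (R ** diagm b ** R) $ m $ k * K $ k $ m)"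
    by (simp add: diagm_sandwich_entry)
  finally show ?thesis .
qed

text \<open>
  All properties of the entries that matter are the covariance and the stability of the law of \<open>X\<close>; here \<open>v\<close>
  bounds the entries of the variance profile and \<open>c\<close> the imaginary part of the spectral parameter \<open>l\<close>.
  The resolvent below is composed with the projection on Hermitian matrices to be defined, bounded and
  smooth everywhere.
\<close>

locale gaussian_resolvent = stable_law M X + dyson \<sigma> Y
  for M :: "'a measure" and X :: "'a \<Rightarrow> complex ^ 'n ^ 'n" and \<sigma> :: "'n::finite \<Rightarrow> 'n \<Rightarrow> real" and Y +
  fixes l :: "'n \<Rightarrow> complex" and c v :: real
  assumes hermitian_X: "\<omega> \<in> space M \<Longrightarrow> hermitian (X \<omega>)"
    and covariance: "(\<integral>\<omega>. X \<omega> $ i $ j * X \<omega> $ k $ m \<partial>M) = (if i = m \<and> j = k then of_real (\<sigma> i j) else 0)"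
    and sigma_le: "\<sigma> i j \<le> v" and v_pos: "0 < v"
    and c_pos: "0 < c" and Im_ge: "c \<le> Im (l i)"
begin

section \<open>The resolvent as a smooth function of the noise\<close>

definition res :: "complex ^ 'n ^ 'n \<Rightarrow> complex ^ 'n ^ 'n" where
  "res H = matrix_inv (diagm l - (Y + hermitian_part H))"

definition res_deriv :: "complex ^ 'n ^ 'n \<Rightarrow> complex ^ 'n ^ 'n \<Rightarrow> complex ^ 'n ^ 'n" where
  "res_deriv H K = res H ** hermitian_part K ** res H"

lemma dissipative_shift: "dissipative c (diagm l - (Y + hermitian_part H))"
  by (intro dissipative_diagm_minus_hermitian hermitian_add hermitian_Y hermitian_hermitian_part Im_ge)

lemmas invertible_shift = dissipative_invertible[OF dissipative_shift c_pos]

lemma norm_res_mult_le: "norm (res H ** A) \<le> norm A / c" for A :: "complex ^ 'n ^ 'n"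
  unfolding res_def by (rule norm_dissipative_inv_mult[OF dissipative_shift c_pos])

lemma norm_mult_res_le: "norm (A ** res H) \<le> norm A / c" for A :: "complex ^ 'n ^ 'n"
  unfolding res_def by (rule norm_mult_dissipative_inv[OF dissipative_shift c_pos])

lemma cmod_res_entry_le: "cmod (res H $ i $ j) \<le> 1 / c"
  unfolding res_def by (rule cmod_entry_dissipative_inv[OF dissipative_shift c_pos])

lemma norm_res_le: "norm (res H) \<le> norm (mat 1 :: complex ^ 'n ^ 'n) / c"
  using norm_res_mult_le[of H "mat 1"] by simp

lemma res_diff: "res H - res H' = res H ** hermitian_part (H - H') ** res H'"
proof -
  have "diagm l - (Y + hermitian_part H') - (diagm l - (Y + hermitian_part H)) = hermitian_part (H - H')"
    by (simp add: hermitian_part_diff)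
  then show ?thesis unfolding res_def by (subst resolvent_identity[OF invertible_shift invertible_shift]) simp
qed

lemma norm_res_diff_le: "norm (res H - res H') \<le> norm (H - H') / c\<^sup>2"
proof -
  have "norm (res H - res H') \<le> norm (hermitian_part (H - H')) / c / c"
    unfolding res_diff using order_trans[OF norm_mult_res_le divide_right_mono[OF norm_res_mult_le]] c_pos by simp
  also have "\<dots> \<le> norm (H - H') / c / c"
    using norm_hermitian_part_le[of "H - H'"] c_pos by (intro divide_right_mono) auto
  finally show ?thesis by (simp add: power2_eq_square)
qed

lemma linear_res_deriv: "linear (res_deriv H)"
proof (rule linearI)
  show "res_deriv H (x + y) = res_deriv H x + res_deriv H y" for x y
    unfolding res_deriv_def hermitian_part_add
    by (simp add: vec_eq_iff matrix_matrix_mult_def algebra_simps sum.distrib sum_distrib_left)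
  show "res_deriv H (r *\<^sub>R x) = r *\<^sub>R res_deriv H x" for r x
    unfolding res_deriv_def hermitian_part_scaleR
    by (simp add: vec_eq_iff matrix_matrix_mult_def flip: scaleR_sum_right)
qed

lemma norm_res_deriv_le: "norm (res_deriv H K) \<le> norm K / c\<^sup>2"
proof -
  have "norm (res_deriv H K) \<le> norm (hermitian_part K) / c / c"
    unfolding res_deriv_def using order_trans[OF norm_mult_res_le divide_right_mono[OF norm_res_mult_le]] c_pos by simp
  also have "\<dots> \<le> norm K / c / c"
    using norm_hermitian_part_le[of K] c_pos by (intro divide_right_mono) auto
  finally show ?thesis by (simp add: power2_eq_square)
qed

text \<open>One use of the resolvent identity leaves \<open>res (H + K) - res H\<close> as left
  factor of the remainder; a second use bounds that factor by
  \<open>norm K / c\<^sup>2\<close>.\<close>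

lemma res_taylor: "norm (res (H + K) - res H - res_deriv H K) \<le> (norm K)\<^sup>2 / c ^ 3"
proof -
  have "res (H + K) - res H - res_deriv H K = (res (H + K) - res H) ** hermitian_part K ** res H"
    unfolding res_deriv_def matrix_mult_diff_right using res_diff[of "H + K" H] by simp
  then have "norm (res (H + K) - res H - res_deriv H K) \<le> norm ((res (H + K) - res H) ** hermitian_part K) / c"
    using norm_mult_res_le by simp
  also have "\<dots> \<le> (norm (res (H + K) - res H) * norm (hermitian_part K)) / c"
    using c_pos by (intro divide_right_mono norm_matrix_mult_le) auto
  also have "\<dots> \<le> (norm K / c\<^sup>2 * norm K) / c"
    using c_pos norm_res_diff_le[of "H + K" H] norm_hermitian_part_le[of K]
    by (intro divide_right_mono mult_mono) auto
  also have "\<dots> = (norm K)\<^sup>2 / c ^ 3"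
    by (simp add: power2_eq_square power3_eq_cube)
  finally show ?thesis .
qed

lemma X_entry_measurable [measurable]: "(\<lambda>\<omega>. X \<omega> $ i $ j) \<in> borel_measurable M"
proof -
  have "(\<lambda>A :: complex ^ 'n ^ 'n. A $ i $ j) \<in> borel_measurable borel"
    by (intro borel_measurable_continuous_onI continuous_intros)
  then show ?thesis by (rule measurable_compose[OF X_measurable])
qed

lemma integrable_X_mult: "integrable M (\<lambda>\<omega>. X \<omega> $ i $ j * X \<omega> $ k $ m)"
proof (rule Bochner_Integration.integrable_bound)
  show "integrable M (\<lambda>\<omega>. norm (X \<omega>) ^ 2)" by (rule integrable_norm_power) simp
  show "AE \<omega> in M. norm (X \<omega> $ i $ j * X \<omega> $ k $ m) \<le> norm (norm (X \<omega>) ^ 2)"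
    by (intro AE_I2) (simp add: norm_mult power2_eq_square mult_mono cmod_entry_le_norm)
qed simp

lemma X_swap: "\<omega> \<in> space M \<Longrightarrow> cnj (X \<omega> $ i $ j) = X \<omega> $ j $ i"
  by (rule hermitian_entry[OF hermitian_X])

text \<open>Hermitian symmetry turns the conjugated factor into entries of \<open>X\<close> with
  swapped indices, so the covariance without conjugates suffices; it kills all pairs but equal
  ones.\<close>

lemma second_moment:
  fixes a :: "complex ^ 'n ^ 'n"
  shows "(\<integral>\<omega>. (cmod (\<Sum>k\<in>UNIV. \<Sum>m\<in>UNIV. a $ m $ k * X \<omega> $ k $ m))\<^sup>2 \<partial>M)
    = (\<Sum>k\<in>UNIV. \<Sum>m\<in>UNIV. \<sigma> k m * (cmod (a $ m $ k))\<^sup>2)"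
proof -
  have "complex_of_real (\<integral>\<omega>. (cmod (\<Sum>k\<in>UNIV. \<Sum>m\<in>UNIV. a $ m $ k * X \<omega> $ k $ m))\<^sup>2 \<partial>M)
     = (\<integral>\<omega>. complex_of_real ((cmod (\<Sum>k\<in>UNIV. \<Sum>m\<in>UNIV. a $ m $ k * X \<omega> $ k $ m))\<^sup>2) \<partial>M)"
    by (rule integral_complex_of_real[symmetric])
  also have "\<dots> = (\<integral>\<omega>. (\<Sum>k\<in>UNIV. \<Sum>m\<in>UNIV. \<Sum>p\<in>UNIV. \<Sum>q\<in>UNIV.
      a $ m $ k * cnj (a $ q $ p) * (X \<omega> $ k $ m * X \<omega> $ q $ p)) \<partial>M)"
  proof (rule Bochner_Integration.integral_cong[OF refl])
    fix \<omega> assume \<omega>: "\<omega> \<in> space M"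
    have "cnj (\<Sum>p\<in>UNIV. \<Sum>q\<in>UNIV. a $ q $ p * X \<omega> $ p $ q) = (\<Sum>p\<in>UNIV. \<Sum>q\<in>UNIV. cnj (a $ q $ p) * X \<omega> $ q $ p)"
      by (simp add: X_swap[OF \<omega>])
    then show "complex_of_real ((cmod (\<Sum>k\<in>UNIV. \<Sum>m\<in>UNIV. a $ m $ k * X \<omega> $ k $ m))\<^sup>2)
      = (\<Sum>k\<in>UNIV. \<Sum>m\<in>UNIV. \<Sum>p\<in>UNIV. \<Sum>q\<in>UNIV. a $ m $ k * cnj (a $ q $ p) * (X \<omega> $ k $ m * X \<omega> $ q $ p))"
      unfolding complex_norm_square by (simp only: sum_distrib_right) (simp only: sum_distrib_left mult_ac)
  qed
  also have "\<dots> = (\<Sum>k\<in>UNIV. \<Sum>m\<in>UNIV. \<Sum>p\<in>UNIV. \<Sum>q\<in>UNIV.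
      a $ m $ k * cnj (a $ q $ p) * (\<integral>\<omega>. X \<omega> $ k $ m * X \<omega> $ q $ p \<partial>M))"
    by (simp add: integrable_X_mult)
  also have "\<dots> = (\<Sum>k\<in>UNIV. \<Sum>m\<in>UNIV. \<Sum>p\<in>UNIV. \<Sum>q\<in>UNIV.
      (if q = m then (if p = k then a $ m $ k * cnj (a $ q $ p) * of_real (\<sigma> k m) else 0) else 0))"
    unfolding covariance by (intro sum.cong refl) auto
  also have "\<dots> = (\<Sum>k\<in>UNIV. \<Sum>m\<in>UNIV. a $ m $ k * cnj (a $ m $ k) * of_real (\<sigma> k m))"
    by simp
  also have "\<dots> = complex_of_real (\<Sum>k\<in>UNIV. \<Sum>m\<in>UNIV. \<sigma> k m * (cmod (a $ m $ k))\<^sup>2)"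
    unfolding of_real_sum of_real_mult complex_norm_square by (simp only: mult_ac)
  finally show ?thesis by (simp only: of_real_eq_iff)
qed

lemma second_moment_le:
  fixes a :: "complex ^ 'n ^ 'n"
  shows "(\<integral>\<omega>. (cmod (\<Sum>k\<in>UNIV. \<Sum>m\<in>UNIV. a $ m $ k * X \<omega> $ k $ m))\<^sup>2 \<partial>M) \<le> v * (norm a)\<^sup>2"
proof -
  have "(\<Sum>k\<in>UNIV. \<Sum>m\<in>UNIV. \<sigma> k m * (cmod (a $ m $ k))\<^sup>2) \<le> (\<Sum>k\<in>UNIV. \<Sum>m\<in>UNIV. v * (cmod (a $ m $ k))\<^sup>2)"
    by (intro sum_mono mult_right_mono sigma_le) simp
  also have "\<dots> = v * (norm a)\<^sup>2"
    unfolding norm_matrix_power2 sum_distrib_left by (rule sum.swap)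
  finally show ?thesis unfolding second_moment .
qed

text \<open>The variance of the linearization is at most \<open>v\<close> times the squared
  Frobenius norm of \<open>res x ** diagm b ** res x\<close>. Each resolvent costs a factor 1/c in
  norm, and the Frobenius norm of \<open>diagm b\<close> is the Euclidean norm of \<open>b\<close>.
  The other constants are irrelevant for the limit and are hidden.\<close>

lemma noise_bound_weighted_trace:
  obtains B L C where "0 \<le> C"
    "noise_bound B L (v * (\<Sum>i\<in>UNIV. (cmod (b i))\<^sup>2) / c ^ 4) C (\<lambda>H. weighted_trace b (res H))"
proof -
  define p where "p = (\<Sum>i\<in>UNIV. cmod (b i))"
  have p: "0 \<le> p" by (simp add: p_def sum_nonneg)
  have pt: "cmod (weighted_trace b A) \<le> p * t" if "norm A \<le> t" for A t
    using order_trans[OF cmod_weighted_trace_le mult_left_mono[OF that]] p by (simp add: p_def)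
  have "noise_bound (p * (norm (mat 1 :: complex ^ 'n ^ 'n) / c)) (p / c\<^sup>2) (v * (\<Sum>i\<in>UNIV. (cmod (b i))\<^sup>2) / c ^ 4)
     (2 * (p / c\<^sup>2) * (p / c ^ 3) * (\<integral>\<omega>. norm (X \<omega>) ^ 3 \<partial>M) + (p / c ^ 3)\<^sup>2 * (\<integral>\<omega>. norm (X \<omega>) ^ 4 \<partial>M))
     (\<lambda>H. weighted_trace b (res H))"
  proof (rule noise_bound_of_gradient[where F' = "\<lambda>H K. weighted_trace b (res_deriv H K)"])
    show "cmod (weighted_trace b (res x)) \<le> p * (norm (mat 1 :: complex ^ 'n ^ 'n) / c)" for x
      by (intro pt norm_res_le)
    show "cmod (weighted_trace b (res x) - weighted_trace b (res y)) \<le> p / c\<^sup>2 * norm (x - y)" for x y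
      using pt[OF norm_res_diff_le, of x y] by (simp add: weighted_trace_diff)
    show "linear (\<lambda>K. weighted_trace b (res_deriv x K))" for x
    proof (rule linearI)
      show "weighted_trace b (res_deriv x (K + K')) = weighted_trace b (res_deriv x K) + weighted_trace b (res_deriv x K')" for K K'
        by (simp add: linear_add[OF linear_res_deriv] weighted_trace_def algebra_simps sum.distrib)
      show "weighted_trace b (res_deriv x (r *\<^sub>R K)) = r *\<^sub>R weighted_trace b (res_deriv x K)" for r K
        by (simp add: linear_scale[OF linear_res_deriv] weighted_trace_def scaleR_sum_right)
    qed
    show "cmod (weighted_trace b (res_deriv x h)) \<le> p / c\<^sup>2 * norm h" for x h
      using pt[OF norm_res_deriv_le, of x h] by simp
    show "cmod (weighted_trace b (res (x + h)) - weighted_trace b (res x) - weighted_trace b (res_deriv x h)) \<le> p / c ^ 3 * (norm h)\<^sup>2" for x h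
      using pt[OF res_taylor, of x h] by (simp add: weighted_trace_diff)
    show "(\<integral>\<omega>. (cmod (weighted_trace b (res_deriv x (X \<omega>))))\<^sup>2 \<partial>M) \<le> v * (\<Sum>i\<in>UNIV. (cmod (b i))\<^sup>2) / c ^ 4" for x
    proof -
      define a where "a = res x ** diagm b ** res x"
      have "(\<integral>\<omega>. (cmod (weighted_trace b (res_deriv x (X \<omega>))))\<^sup>2 \<partial>M)
         = (\<integral>\<omega>. (cmod (\<Sum>k\<in>UNIV. \<Sum>m\<in>UNIV. a $ m $ k * X \<omega> $ k $ m))\<^sup>2 \<partial>M)"
        by (intro Bochner_Integration.integral_cong refl)
          (simp add: res_deriv_def weighted_trace_sandwich a_def hermitian_part_hermitian[OF hermitian_X])
      also have "\<dots> \<le> v * (norm a)\<^sup>2" by (rule second_moment_le)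
      also have "(norm a)\<^sup>2 \<le> (norm (diagm b) / c / c)\<^sup>2"
        unfolding a_def using order_trans[OF norm_mult_res_le divide_right_mono[OF norm_res_mult_le]] c_pos
        by (intro power_mono) auto
      also have "\<dots> = (\<Sum>i\<in>UNIV. (cmod (b i))\<^sup>2) / c ^ 4"
        unfolding norm_diagm_power2[symmetric] by (simp add: power2_eq_square power4_eq_xxxx)
      finally show ?thesis using v_pos by (simp add: mult_left_mono)
    qed
  qed (use p c_pos in auto)
  moreover have "0 \<le> 2 * (p / c\<^sup>2) * (p / c ^ 3) * (\<integral>\<omega>. norm (X \<omega>) ^ 3 \<partial>M) + (p / c ^ 3)\<^sup>2 * (\<integral>\<omega>. norm (X \<omega>) ^ 4 \<partial>M)"
    using p c_pos by (intro add_nonneg_nonneg mult_nonneg_nonneg) (auto simp: integral_nonneg_AE)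
  ultimately show ?thesis using that by blast
qed

end

text \<open>Used pointwise under an integral; the optimal weight \<open>a\<close> then reproduces
  the Cauchy--Schwarz inequality for the integrals.\<close>

lemma mult_le_weighted_squares:
  fixes x y a :: real
  assumes "0 < a"
  shows "x * y \<le> (a * x\<^sup>2 + y\<^sup>2 / a) / 2"
proof -
  have "0 \<le> (sqrt a * x - y / sqrt a)\<^sup>2" by simp
  also have "\<dots> = a * x\<^sup>2 + y\<^sup>2 / a - 2 * (x * y)"
    using assms by (simp add: power2_diff power_mult_distrib power_divide)
  finally show ?thesis by simp
qed

lemma matrix_inv_is_diag:
  assumes "invertible A" "is_diag A" "i \<noteq> j"
  shows "matrix_inv A $ i $ j = (0 :: complex)"
proof -
  have A: "A = diagm (\<lambda>i. A $ i $ i)" by (rule is_diag_eq_diagm[OF assms(2)])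
  have "(A ** matrix_inv A) $ i $ j = A $ i $ i * matrix_inv A $ i $ j" for i j
    by (subst A) (simp add: matrix_matrix_mult_def diagm_def if_distrib[of "\<lambda>x. x * _"] cong: if_cong)
  then have "A $ i $ i * matrix_inv A $ i $ j = (if i = j then 1 else 0)" for i j
    by (simp add: matrix_inv_both[OF assms(1)] mat_def)
  from this[of i j] this[of i i] assms(3) show ?thesis by auto
qed

context gaussian_resolvent
begin

section \<open>The mean resolvent and its approximate fixed point equation\<close>

definition mean :: "complex ^ 'n ^ 'n" where
  "mean = (\<chi> i j. \<integral>\<omega>. res (X \<omega>) $ i $ j \<partial>M)"

lemma mean_entry: "mean $ i $ j = (\<integral>\<omega>. res (X \<omega>) $ i $ j \<partial>M)"
  by (simp add: mean_def)

lemma res_entry_lipschitz: "cmod (res H $ i $ j - res H' $ i $ j) \<le> 1 / c\<^sup>2 * norm (H - H')"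
  using order_trans[OF cmod_entry_le_norm[of "res H - res H'"] norm_res_diff_le] by simp

lemma res_entry_borel [measurable]: "(\<lambda>H. res H $ i $ j) \<in> borel_measurable borel"
proof (rule borel_measurable_continuous_onI, rule lipschitz_on_continuous_on[of "1 / c\<^sup>2"], rule lipschitz_onI)
  show "dist (res H $ i $ j) (res H' $ i $ j) \<le> 1 / c\<^sup>2 * dist H H'" for H H'
    unfolding dist_norm by (rule res_entry_lipschitz)
qed simp

lemma res_entry_measurable [measurable]: "(\<lambda>\<omega>. res (X \<omega>) $ i $ j) \<in> borel_measurable M"
  using measurable_compose[OF X_measurable res_entry_borel] .

lemma integrable_res: "integrable M (\<lambda>\<omega>. res (X \<omega>) $ i $ j)"
  by (rule integrable_bounded[OF _ cmod_res_entry_le]) simp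

lemma integrable_res_mult: "integrable M (\<lambda>\<omega>. res (X \<omega>) $ i $ j * res (X \<omega>) $ k $ m)"
proof (rule integrable_bounded)
  show "cmod (res (X \<omega>) $ i $ j * res (X \<omega>) $ k $ m) \<le> (1 / c) * (1 / c)" for \<omega>
    unfolding norm_mult using c_pos by (intro mult_mono cmod_res_entry_le) auto
qed simp

lemma expectation_weighted_trace:
  "(\<integral>\<omega>. weighted_trace b (res (X \<omega>)) \<partial>M) = weighted_trace b mean"
  by (simp add: weighted_trace_def mean_entry integrable_res)

lemma weighted_trace_concentration:
  assumes "0 < (\<Sum>i\<in>UNIV. (cmod (b i))\<^sup>2)" "0 \<le> t"
  shows "measure M {\<omega> \<in> space M. t \<le> cmod (weighted_trace b (res (X \<omega>)) - weighted_trace b mean)}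
    \<le> 2 * exp (- t\<^sup>2 / (2 * (v * (\<Sum>i\<in>UNIV. (cmod (b i))\<^sup>2) / c ^ 4)))"
proof -
  obtain B L C where "0 \<le> C" "noise_bound B L (v * (\<Sum>i\<in>UNIV. (cmod (b i))\<^sup>2) / c ^ 4) C (\<lambda>H. weighted_trace b (res H))"
    by (rule noise_bound_weighted_trace)
  from gaussian_concentration[OF this(2) _ this(1) assms(2), of 0] show ?thesis
    using assms(1) v_pos c_pos by (simp add: smoothing_def expectation_weighted_trace)
qed

lemma weighted_trace_variance:
  "(\<integral>\<omega>. (cmod (weighted_trace b (res (X \<omega>)) - weighted_trace b mean))\<^sup>2 \<partial>M)
    \<le> v * (\<Sum>i\<in>UNIV. (cmod (b i))\<^sup>2) / c ^ 4"
proof -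
  obtain B L C where "0 \<le> C" "noise_bound B L (v * (\<Sum>i\<in>UNIV. (cmod (b i))\<^sup>2) / c ^ 4) C (\<lambda>H. weighted_trace b (res H))"
    by (rule noise_bound_weighted_trace)
  from gaussian_poincare[OF this(2) _ this(1), of 0] show ?thesis
    using v_pos c_pos by (simp add: smoothing_def expectation_weighted_trace sum_nonneg)
qed

lemma weighted_trace_indicator: "weighted_trace (\<lambda>k. if k = i then 1 else 0) A = A $ i $ i"
  by (simp add: weighted_trace_def if_distrib[of "\<lambda>x. x * _"] cong: if_cong)

lemma sum_cmod_indicator: "(\<Sum>k\<in>UNIV. (cmod (if k = i then 1 else 0))\<^sup>2) = 1" for i :: 'n
  by (simp add: if_distrib[of cmod] if_distrib[of "\<lambda>x. x\<^sup>2"] cong: if_cong)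

lemma res_diagonal_concentration:
  assumes "0 \<le> t"
  shows "measure M {\<omega> \<in> space M. t \<le> cmod (res (X \<omega>) $ i $ i - mean $ i $ i)} \<le> 2 * exp (- t\<^sup>2 * c ^ 4 / (2 * v))"
  using weighted_trace_concentration[of "\<lambda>k. if k = i then 1 else 0" t] assms c_pos
  by (simp add: weighted_trace_indicator sum_cmod_indicator)

lemma res_diagonal_variance: "(\<integral>\<omega>. (cmod (res (X \<omega>) $ i $ i - mean $ i $ i))\<^sup>2 \<partial>M) \<le> v / c ^ 4"
  using weighted_trace_variance[of "\<lambda>k. if k = i then 1 else 0"]
  by (simp add: weighted_trace_indicator sum_cmod_indicator)

definition self_energy :: "'n \<Rightarrow> complex ^ 'n ^ 'n \<Rightarrow> complex" where
  "self_energy i A = weighted_trace (\<lambda>j. of_real (\<sigma> i j)) A"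

lemma self_energy_eq: "self_energy i A = (\<Sum>j\<in>UNIV. of_real (\<sigma> i j) * A $ j $ j)"
  by (simp add: self_energy_def weighted_trace_def)

text \<open>The weights are at most \<open>v\<close>, so their squares sum to at most N v^2, to
  which the Poincare inequality adds one more factor v. As v is of order 1/N, averaging gains a
  factor 1/N over the variance of a single entry.\<close>

lemma self_energy_variance:
  "(\<integral>\<omega>. (cmod (self_energy i (res (X \<omega>)) - self_energy i mean))\<^sup>2 \<partial>M) \<le> real CARD('n) * v ^ 3 / c ^ 4"
proof -
  have "(\<Sum>j\<in>UNIV. (cmod (of_real (\<sigma> i j)))\<^sup>2) \<le> (\<Sum>j\<in>(UNIV :: 'n set). v\<^sup>2)"
    using sigma_le sigma_nonneg by (intro sum_mono power_mono) auto
  then have "v * (\<Sum>j\<in>UNIV. (cmod (of_real (\<sigma> i j)))\<^sup>2) / c ^ 4 \<le> v * (\<Sum>j\<in>(UNIV :: 'n set). v\<^sup>2) / c ^ 4"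
    using v_pos c_pos by (intro divide_right_mono mult_left_mono) auto
  also have "\<dots> = real CARD('n) * v ^ 3 / c ^ 4"
    by (simp add: power2_eq_square power3_eq_cube)
  finally show ?thesis unfolding self_energy_def by (rule order_trans[OF weighted_trace_variance])
qed

text \<open>Integration by parts: the derivative of a resolvent entry in direction \<open>X\<close>
  is an entry of the product resolvent, X, resolvent, and the covariance with
  \<open>X $ i $ j\<close> selects the single entry (j, i) of the middle factor.\<close>

lemma expectation_X_res:
  "(\<integral>\<omega>. X \<omega> $ i $ j * res (X \<omega>) $ k $ m \<partial>M) = of_real (\<sigma> i j) * (\<integral>\<omega>. res (X \<omega>) $ k $ j * res (X \<omega>) $ i $ m \<partial>M)"
proof -
  define g where "g H = of_real (\<sigma> i j) * (res H $ k $ j * res H $ i $ m)" for H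
  have "(\<integral>\<omega>. (\<lambda>A. A $ i $ j) (X \<omega>) * (\<lambda>H. res H $ k $ m) (0 + X \<omega>) \<partial>M) = (\<integral>\<omega>. g (0 + X \<omega>) \<partial>M)"
  proof (rule gaussian_integration_by_parts[where f' = "\<lambda>H K. res_deriv H K $ k $ m" and c = "1 / c ^ 3"
        and l = "\<sigma> i j * (2 * (1 / c * (1 / c\<^sup>2)))" and B = "1 / c" and B' = "\<sigma> i j * (1 / c * (1 / c))"])
    show "linear (\<lambda>A :: complex ^ 'n ^ 'n. A $ i $ j)" by (rule linearI) auto
    show "linear (\<lambda>K. res_deriv H K $ k $ m)" for H
      by (rule linearI) (simp_all add: linear_add[OF linear_res_deriv] linear_scale[OF linear_res_deriv])
    show "cmod (res (H + K) $ k $ m - res H $ k $ m - res_deriv H K $ k $ m) \<le> 1 / c ^ 3 * (norm K)\<^sup>2" for H K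
      using order_trans[OF cmod_entry_le_norm[of "res (H + K) - res H - res_deriv H K"] res_taylor] by simp
    show "(\<integral>\<omega>. X \<omega> $ i $ j * res_deriv H (X \<omega>) $ k $ m \<partial>M) = g H" for H
    proof -
      have "(\<integral>\<omega>. X \<omega> $ i $ j * res_deriv H (X \<omega>) $ k $ m \<partial>M)
        = (\<integral>\<omega>. (\<Sum>q\<in>UNIV. \<Sum>p\<in>UNIV. (res H $ k $ p * res H $ q $ m) * (X \<omega> $ i $ j * X \<omega> $ p $ q)) \<partial>M)"
        by (intro Bochner_Integration.integral_cong refl)
          (simp add: res_deriv_def hermitian_part_hermitian[OF hermitian_X] matrix_matrix_mult_def
            sum_distrib_left sum_distrib_right mult_ac)
      also have "\<dots> = (\<Sum>q\<in>UNIV. \<Sum>p\<in>UNIV. (res H $ k $ p * res H $ q $ m) * (\<integral>\<omega>. X \<omega> $ i $ j * X \<omega> $ p $ q \<partial>M))"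
        by (simp add: integrable_X_mult)
      also have "\<dots> = (\<Sum>q\<in>UNIV. if i = q then (\<Sum>p\<in>UNIV. if j = p then (res H $ k $ p * res H $ q $ m) * of_real (\<sigma> i j) else 0) else 0)"
        unfolding covariance by (intro sum.cong refl) (simp add: if_distrib cong: if_cong)
      also have "\<dots> = g H" by (simp add: g_def mult.commute)
      finally show ?thesis .
    qed
    show "cmod (g H) \<le> \<sigma> i j * (1 / c * (1 / c))" for H
      unfolding g_def norm_mult norm_of_real abs_of_nonneg[OF sigma_nonneg]
      using c_pos by (intro mult_left_mono mult_mono cmod_res_entry_le sigma_nonneg) auto
    show "cmod (g H - g H') \<le> \<sigma> i j * (2 * (1 / c * (1 / c\<^sup>2))) * norm (H - H')" for H H'
    proof -
      have "g H - g H' = of_real (\<sigma> i j) * (res H $ k $ j * (res H $ i $ m - res H' $ i $ m)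
          + (res H $ k $ j - res H' $ k $ j) * res H' $ i $ m)"
        by (simp add: g_def algebra_simps)
      moreover have b1: "cmod (res H $ k $ j * (res H $ i $ m - res H' $ i $ m)) \<le> 1 / c * (1 / c\<^sup>2 * norm (H - H'))"
        unfolding norm_mult using c_pos by (intro mult_mono cmod_res_entry_le res_entry_lipschitz) auto
      moreover have b2: "cmod ((res H $ k $ j - res H' $ k $ j) * res H' $ i $ m) \<le> (1 / c\<^sup>2 * norm (H - H')) * (1 / c)"
        unfolding norm_mult using c_pos by (intro mult_mono cmod_res_entry_le res_entry_lipschitz) auto
      ultimately have "cmod (g H - g H') \<le> \<sigma> i j * (1 / c * (1 / c\<^sup>2 * norm (H - H')) + (1 / c\<^sup>2 * norm (H - H')) * (1 / c))"
        by (simp only: norm_mult[of "of_real (\<sigma> i j)"] norm_of_real abs_of_nonneg[OF sigma_nonneg])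
          (intro mult_left_mono order_trans[OF norm_triangle_ineq] add_mono sigma_nonneg b1 b2)
      then show ?thesis by (simp add: algebra_simps)
    qed
    show "cmod (res H $ k $ m) \<le> 1 / c" for H by (rule cmod_res_entry_le)
  qed (use c_pos sigma_nonneg in auto)
  then show ?thesis by (simp add: g_def)
qed

lemma res_equation:
  assumes "\<omega> \<in> space M"
  shows "l i * res (X \<omega>) $ i $ m - (\<Sum>j\<in>UNIV. Y $ i $ j * res (X \<omega>) $ j $ m)
     - (\<Sum>j\<in>UNIV. X \<omega> $ i $ j * res (X \<omega>) $ j $ m) = (if i = m then 1 else 0)"
proof -
  have "((diagm l - (Y + X \<omega>)) ** res (X \<omega>)) $ i $ m = (if i = m then 1 else 0)"
    using matrix_inv_both(1)[OF invertible_shift[of "X \<omega>"]]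
    by (simp add: res_def hermitian_part_hermitian[OF hermitian_X[OF assms]] mat_def)
  moreover have "((diagm l - (Y + X \<omega>)) ** res (X \<omega>)) $ i $ m
      = (diagm l ** res (X \<omega>)) $ i $ m - (Y ** res (X \<omega>)) $ i $ m - (X \<omega> ** res (X \<omega>)) $ i $ m"
    by (simp add: matrix_matrix_mult_def algebra_simps sum_subtractf sum.distrib)
  moreover have "(diagm l ** res (X \<omega>)) $ i $ m = l i * res (X \<omega>) $ i $ m"
    by (simp add: matrix_matrix_mult_def diagm_def if_distrib[of "\<lambda>x. x * _"] cong: if_cong)
  ultimately show ?thesis by (simp add: matrix_matrix_mult_def)
qed

text \<open>Since \<open>self_energy i mean\<close> is the expectation of
  \<open>self_energy i (res (X \<omega>))\<close>, these are covariances between self-energy and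
  resolvent entries.\<close>

definition fluctuation :: "complex ^ 'n ^ 'n" where
  "fluctuation = (\<chi> i m. \<integral>\<omega>. (self_energy i (res (X \<omega>)) - self_energy i mean) * res (X \<omega>) $ i $ m \<partial>M)"

definition mean_pencil :: "complex ^ 'n ^ 'n" where
  "mean_pencil = pencil \<sigma> Y l (\<lambda>j. mean $ j $ j)"

text \<open>Expectation of the defining equation of the resolvent. Integration by parts turns the
  term with \<open>X\<close> into the mean of self-energy times resolvent; replacing it by the
  product of the means costs \<open>fluctuation\<close>.\<close>

lemma schwinger_dyson: "mean_pencil ** mean = mat 1 + fluctuation"
proof -
  have "(mean_pencil ** mean) $ i $ m = (mat 1 + fluctuation) $ i $ m" for i m
  proof -
    define \<delta> :: complex where "\<delta> = (if i = m then 1 else 0)"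
    have X_eq: "(\<Sum>j\<in>UNIV. X \<omega> $ i $ j * res (X \<omega>) $ j $ m)
       = l i * res (X \<omega>) $ i $ m - (\<Sum>j\<in>UNIV. Y $ i $ j * res (X \<omega>) $ j $ m) - \<delta>" if "\<omega> \<in> space M" for \<omega>
      using res_equation[OF that, of i m] by (simp add: \<delta>_def algebra_simps)
    have iX: "integrable M (\<lambda>\<omega>. X \<omega> $ i $ j * res (X \<omega>) $ k $ m)" for j k
    proof (rule Bochner_Integration.integrable_bound)
      show "integrable M (\<lambda>\<omega>. norm (X \<omega>) * (1 / c))" using integrable_norm by simp
      show "AE \<omega> in M. norm (X \<omega> $ i $ j * res (X \<omega>) $ k $ m) \<le> norm (norm (X \<omega>) * (1 / c))"
      proof (rule AE_I2)
        fix \<omega>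
        have "norm (X \<omega> $ i $ j * res (X \<omega>) $ k $ m) \<le> norm (X \<omega>) * (1 / c)"
          unfolding norm_mult by (intro mult_mono cmod_entry_le_norm cmod_res_entry_le) auto
        then show "norm (X \<omega> $ i $ j * res (X \<omega>) $ k $ m) \<le> norm (norm (X \<omega>) * (1 / c))"
          using c_pos by simp
      qed
    qed simp
    \<comment> \<open>\<open>expectation_X_res\<close> with \<open>k = j\<close> produces the
      diagonal entries \<open>res (X \<omega>) $ j $ j\<close>, whose weighted sum is the
      self-energy.\<close>
    have "(\<integral>\<omega>. (\<Sum>j\<in>UNIV. X \<omega> $ i $ j * res (X \<omega>) $ j $ m) \<partial>M)
       = (\<Sum>j\<in>UNIV. of_real (\<sigma> i j) * (\<integral>\<omega>. res (X \<omega>) $ j $ j * res (X \<omega>) $ i $ m \<partial>M))"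
      using iX by (simp add: expectation_X_res)
    also have "\<dots> = (\<integral>\<omega>. self_energy i (res (X \<omega>)) * res (X \<omega>) $ i $ m \<partial>M)"
      unfolding self_energy_eq by (simp add: sum_distrib_right mult.assoc integrable_res_mult)
    finally have 1: "(\<integral>\<omega>. self_energy i (res (X \<omega>)) * res (X \<omega>) $ i $ m \<partial>M)
       = (\<integral>\<omega>. (\<Sum>j\<in>UNIV. X \<omega> $ i $ j * res (X \<omega>) $ j $ m) \<partial>M)" ..
    also have "\<dots> = (\<integral>\<omega>. l i * res (X \<omega>) $ i $ m - (\<Sum>j\<in>UNIV. Y $ i $ j * res (X \<omega>) $ j $ m) - \<delta> \<partial>M)"
      by (intro Bochner_Integration.integral_cong refl X_eq)
    also have "\<dots> = l i * mean $ i $ m - (\<Sum>j\<in>UNIV. Y $ i $ j * mean $ j $ m) - \<delta>"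
      by (simp add: integrable_res mean_entry prob_space)
    finally have SE: "(\<integral>\<omega>. self_energy i (res (X \<omega>)) * res (X \<omega>) $ i $ m \<partial>M)
       = l i * mean $ i $ m - (\<Sum>j\<in>UNIV. Y $ i $ j * mean $ j $ m) - \<delta>" .
    have iS: "integrable M (\<lambda>\<omega>. self_energy i (res (X \<omega>)) * res (X \<omega>) $ i $ m)"
      unfolding self_energy_eq by (simp add: sum_distrib_right mult.assoc integrable_res_mult)
    have "fluctuation $ i $ m = (\<integral>\<omega>. self_energy i (res (X \<omega>)) * res (X \<omega>) $ i $ m - self_energy i mean * res (X \<omega>) $ i $ m \<partial>M)"
      by (simp add: fluctuation_def left_diff_distrib)
    also have "\<dots> = l i * mean $ i $ m - (\<Sum>j\<in>UNIV. Y $ i $ j * mean $ j $ m) - \<delta> - self_energy i mean * mean $ i $ m"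
      using iS by (simp add: SE integrable_res mean_entry)
    finally have fl: "fluctuation $ i $ m = l i * mean $ i $ m - (\<Sum>j\<in>UNIV. Y $ i $ j * mean $ j $ m) - \<delta> - self_energy i mean * mean $ i $ m" .
    have "(mean_pencil ** mean) $ i $ m = (diagm (\<lambda>i. l i - self_energy i mean) ** mean) $ i $ m - (Y ** mean) $ i $ m"
      unfolding mean_pencil_def pencil_def self_energy_eq by (simp add: matrix_mult_diff_right)
    also have "(diagm (\<lambda>i. l i - self_energy i mean) ** mean) $ i $ m = (l i - self_energy i mean) * mean $ i $ m"
      by (simp add: matrix_matrix_mult_def diagm_def if_distrib[of "\<lambda>x. x * _"] cong: if_cong)
    finally show ?thesis
      by (simp add: fl matrix_matrix_mult_def mat_def \<delta>_def algebra_simps)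
  qed
  then show ?thesis by (simp add: vec_eq_iff)
qed

lemma Im_res_neg: "Im (res H $ i $ i) < 0"
  unfolding res_def
  by (intro Im_resolvent_neg hermitian_add hermitian_Y hermitian_hermitian_part) (rule less_le_trans[OF c_pos Im_ge])

lemma Im_mean_nonpos: "Im (mean $ i $ i) \<le> 0"
proof -
  have "Im (mean $ i $ i) = (\<integral>\<omega>. Im (res (X \<omega>) $ i $ i) \<partial>M)"
    unfolding mean_entry using integral_Im[OF integrable_res[of i i]] by simp
  also have "\<dots> \<le> (\<integral>\<omega>. 0 \<partial>M)"
    using integrable_Im[OF integrable_res[of i i]] Im_res_neg by (intro integral_mono) (auto simp: less_imp_le)
  also have "\<dots> = 0" by simp
  finally show ?thesis .
qed

lemma dissipative_mean_pencil: "dissipative c mean_pencil"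
  unfolding mean_pencil_def by (rule dissipative_pencil[OF Im_ge Im_mean_nonpos])

definition dyson_error :: "'n \<Rightarrow> complex" where
  "dyson_error i = mean $ i $ i - matrix_inv mean_pencil $ i $ i"

lemma dyson_error_eq: "dyson_error i = (\<Sum>k\<in>UNIV. matrix_inv mean_pencil $ i $ k * fluctuation $ k $ i)"
proof -
  have inv: "invertible mean_pencil" by (rule dissipative_invertible[OF dissipative_mean_pencil c_pos])
  have "mean = matrix_inv mean_pencil ** (mean_pencil ** mean)"
    by (simp add: matrix_mul_assoc matrix_inv_both[OF inv])
  also have "\<dots> = matrix_inv mean_pencil + matrix_inv mean_pencil ** fluctuation"
    by (simp add: schwinger_dyson matrix_add_ldistrib)
  finally have "mean $ i $ i = matrix_inv mean_pencil $ i $ i + (matrix_inv mean_pencil ** fluctuation) $ i $ i"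
    by (metis vector_add_component)
  then show ?thesis by (simp add: dyson_error_def matrix_matrix_mult_def)
qed

text \<open>
  The approximate equation for the mean is an exact equation at a shifted spectral parameter.
\<close>

lemma dyson_bias:
  assumes sol: "dyson_solution \<sigma> Y l g"
    and err: "\<And>i. cmod (dyson_error i) \<le> \<theta>" and \<delta>: "0 < \<delta>"
    and small: "real CARD('n) * v * \<theta> \<le> (1 - \<delta>) * c"
  shows "cmod (mean $ i $ i - g i) \<le> (1 + real CARD('n) * v / (\<delta> * c\<^sup>2)) * \<theta>"
proof -
  define W where "W = matrix_inv mean_pencil"
  define g' where "g' j = W $ j $ j" for j
  \<comment> \<open>Chosen so that the pencil at \<open>l'\<close> and \<open>g'\<close> is
    \<open>mean_pencil\<close>: passing from \<open>mean\<close> to the diagonal \<open>g'\<close>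
    of its inverse removes \<open>dyson_error\<close>, and this change of the self-energy is
    compensated in the parameter. Hence \<open>g'\<close> is an exact solution at
    \<open>l'\<close>.\<close>
  define l' where "l' j = l j - (\<Sum>k\<in>UNIV. of_real (\<sigma> j k) * dyson_error k)" for j
  have \<theta>: "0 \<le> \<theta>" using err[of undefined] norm_ge_zero order_trans by blast
  have shift: "cmod (\<Sum>k\<in>UNIV. of_real (\<sigma> j k) * dyson_error k) \<le> real CARD('n) * v * \<theta>" for j
  proof -
    have "cmod (\<Sum>k\<in>UNIV. of_real (\<sigma> j k) * dyson_error k) \<le> (\<Sum>k\<in>UNIV. cmod (of_real (\<sigma> j k) * dyson_error k))"
      by (rule norm_sum)
    also have "\<dots> \<le> (\<Sum>k\<in>(UNIV :: 'n set). v * \<theta>)"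
      unfolding norm_mult norm_of_real abs_of_nonneg[OF sigma_nonneg]
      using v_pos by (intro sum_mono mult_mono sigma_le err) auto
    finally show ?thesis by simp
  qed
  \<comment> \<open>The smallness hypothesis caps the shift at \<open>(1 - \<delta>) * c\<close>, so
    the fraction \<open>\<delta>\<close> of the imaginary part survives.\<close>
  have Im_l': "\<delta> * c \<le> Im (l' j)" for j
  proof -
    have "\<bar>Im (\<Sum>k\<in>UNIV. of_real (\<sigma> j k) * dyson_error k)\<bar> \<le> (1 - \<delta>) * c"
      using order_trans[OF abs_Im_le_cmod order_trans[OF shift small]] .
    moreover have "Im (l' j) = Im (l j) - Im (\<Sum>k\<in>UNIV. of_real (\<sigma> j k) * dyson_error k)"
      by (simp only: l'_def minus_complex.sel)
    ultimately show ?thesis using Im_ge[of j] by (simp add: algebra_simps abs_le_iff)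
  qed
  have pos': "0 < Im (l' j)" for j
    using Im_l'[of j] \<delta> c_pos by (meson less_le_trans mult_pos_pos)
  have pencil_eq: "pencil \<sigma> Y l' g' = mean_pencil"
  proof -
    have "l' j - (\<Sum>k\<in>UNIV. of_real (\<sigma> j k) * g' k) = l j - (\<Sum>k\<in>UNIV. of_real (\<sigma> j k) * mean $ k $ k)" for j
      by (simp add: l'_def g'_def W_def dyson_error_def algebra_simps sum_subtractf)
    then show ?thesis by (simp add: pencil_def mean_pencil_def)
  qed
  have sol': "dyson_solution \<sigma> Y l' g'"
    unfolding dyson_solution_def
  proof (intro allI conjI)
    fix j
    show "g' j = matrix_inv (pencil \<sigma> Y l' g') $ j $ j" unfolding pencil_eq by (simp add: g'_def W_def)
    have "0 < Im (l k - (\<Sum>j\<in>UNIV. of_real (\<sigma> k j) * mean $ j $ j))" for k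
      by (rule less_le_trans[OF less_le_trans[OF c_pos Im_ge] Im_pencil_diag_ge]) (rule Im_mean_nonpos)
    then show "Im (g' j) < 0"
      unfolding g'_def W_def mean_pencil_def pencil_def by (rule Im_resolvent_neg[OF hermitian_Y])
  qed
  \<comment> \<open>Lipschitz estimate with lower bounds \<open>\<delta> * c\<close> at
    \<open>l'\<close> and \<open>c\<close> at \<open>l\<close>; together with the error at
    \<open>l\<close> itself it makes up the factor in the claim.\<close>
  have "cmod (g' i - g i) \<le> real CARD('n) * v * \<theta> / (\<delta> * c * c)"
  proof (rule dyson_lipschitz[OF sol' sol Im_l' Im_ge])
    show "cmod (l' j - l j) \<le> real CARD('n) * v * \<theta>" for j
      using shift[of j] by (simp add: l'_def)
  qed (use \<delta> c_pos in auto)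
  moreover have "mean $ i $ i - g i = dyson_error i + (g' i - g i)"
    by (simp add: dyson_error_def g'_def W_def)
  then have "cmod (mean $ i $ i - g i) \<le> cmod (dyson_error i) + cmod (g' i - g i)"
    by (simp only: norm_triangle_ineq)
  ultimately have "cmod (mean $ i $ i - g i) \<le> \<theta> + real CARD('n) * v * \<theta> / (\<delta> * c * c)"
    using err[of i] by linarith
  then show ?thesis by (simp add: power2_eq_square algebra_simps)
qed

section \<open>Size of the error in the equation for the mean\<close>

lemma self_energy_measurable [measurable]: "(\<lambda>\<omega>. self_energy i (res (X \<omega>))) \<in> borel_measurable M"
  unfolding self_energy_eq by measurable

lemma self_energy_deviation_le:
  obtains D where "\<And>\<omega>. cmod (self_energy i (res (X \<omega>)) - self_energy i mean) \<le> D"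
proof -
  have "cmod (self_energy i (res H)) \<le> (\<Sum>j\<in>UNIV. \<sigma> i j * (1 / c))" for H
    unfolding self_energy_eq
    by (intro order_trans[OF norm_sum] sum_mono)
      (simp only: norm_mult norm_of_real abs_of_nonneg[OF sigma_nonneg] mult_left_mono[OF cmod_res_entry_le sigma_nonneg])
  from that[OF order_trans[OF norm_triangle_ineq4 add_right_mono[OF this]]] show ?thesis .
qed

lemma integrable_self_energy_deviation:
  "integrable M (\<lambda>\<omega>. (cmod (self_energy i (res (X \<omega>)) - self_energy i mean))\<^sup>2)"
proof -
  obtain D where D: "\<And>\<omega>. cmod (self_energy i (res (X \<omega>)) - self_energy i mean) \<le> D"
    using self_energy_deviation_le by blast
  show ?thesis
  proof (rule integrable_bounded)
    show "norm ((cmod (self_energy i (res (X \<omega>)) - self_energy i mean))\<^sup>2) \<le> D\<^sup>2" for \<omega>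
      using power_mono[OF D norm_ge_zero, of \<omega> 2] by simp
  qed simp
qed

lemma cmod_res_power2_le: "(cmod (res H $ i $ j))\<^sup>2 \<le> (1 / c)\<^sup>2"
  by (rule power_mono[OF cmod_res_entry_le]) simp

lemma integrable_res_power2: "integrable M (\<lambda>\<omega>. (cmod (res (X \<omega>) $ i $ j))\<^sup>2)"
  by (rule integrable_bounded[where B = "(1 / c)\<^sup>2"]) (use cmod_res_power2_le in auto)

lemma norm_column_inv_le:
  assumes "dissipative c A"
  shows "(\<Sum>k\<in>UNIV. (cmod (matrix_inv A $ k $ i))\<^sup>2) \<le> 1 / c\<^sup>2"
proof -
  have "norm (column i (matrix_inv A)) \<le> 1 / c"
    by (rule norm_column_le) (use dissipative_inv_norm_le[OF assms c_pos] in simp)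
  then have "(norm (column i (matrix_inv A)))\<^sup>2 \<le> (1 / c)\<^sup>2" by (rule power_mono) simp
  then show ?thesis by (simp add: norm_vec_power2 column_def power_divide)
qed

lemma norm_row_inv_le:
  assumes "dissipative c A"
  shows "(\<Sum>k\<in>UNIV. (cmod (matrix_inv A $ i $ k))\<^sup>2) \<le> 1 / c\<^sup>2"
  using norm_column_inv_le[OF dissipative_transpose[OF assms], of i]
  unfolding matrix_inv_transpose[OF dissipative_invertible[OF assms c_pos]] by (simp add: transpose_def)

text \<open>Cauchy--Schwarz jointly over \<open>k\<close> and \<open>\<omega>\<close>. A row of
  \<open>W\<close> and a column of the resolvent both have Euclidean norm at most 1/c, so the sum
  over \<open>k\<close> costs no power of the dimension, and the standard deviation of the
  self-energy supplies the smallness.\<close>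

lemma dyson_error_le: "cmod (dyson_error i) \<le> sqrt (real CARD('n) * v ^ 3) / c ^ 4"
proof -
  define W where "W = matrix_inv mean_pencil"
  define Z where "Z k \<omega> = cmod (self_energy k (res (X \<omega>)) - self_energy k mean)" for k \<omega>
  define V where "V = real CARD('n) * v ^ 3 / c ^ 4"
  \<comment> \<open>The weight balancing the two summands \<open>a * V / c\<^sup>2\<close> and
    \<open>1 / (a * c\<^sup>2)\<close>.\<close>
  define a where "a = 1 / sqrt V"
  have V: "0 < V" using v_pos c_pos by (simp add: V_def)
  have a: "0 < a" using V by (simp add: a_def)
  have ZV: "(\<integral>\<omega>. (Z k \<omega>)\<^sup>2 \<partial>M) \<le> V" for k unfolding Z_def V_def by (rule self_energy_variance)
  have iZ: "integrable M (\<lambda>\<omega>. (Z k \<omega>)\<^sup>2)" for k unfolding Z_def by (rule integrable_self_energy_deviation)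
  have [measurable]: "Z k \<in> borel_measurable M" for k unfolding Z_def by measurable
  have entry_le: "cmod (W $ i $ k * fluctuation $ k $ i)
     \<le> (a * (cmod (W $ i $ k))\<^sup>2 * V + (\<integral>\<omega>. (cmod (res (X \<omega>) $ k $ i))\<^sup>2 \<partial>M) / a) / 2" for k
  proof -
    have "cmod (W $ i $ k * fluctuation $ k $ i)
       = cmod (\<integral>\<omega>. W $ i $ k * ((self_energy k (res (X \<omega>)) - self_energy k mean) * res (X \<omega>) $ k $ i) \<partial>M)"
      by (simp add: fluctuation_def)
    also have "\<dots> \<le> (\<integral>\<omega>. cmod (W $ i $ k * ((self_energy k (res (X \<omega>)) - self_energy k mean) * res (X \<omega>) $ k $ i)) \<partial>M)"
      by (rule integral_norm_bound)
    also have "\<dots> \<le> (\<integral>\<omega>. (a * (cmod (W $ i $ k))\<^sup>2 * (Z k \<omega>)\<^sup>2 + (cmod (res (X \<omega>) $ k $ i))\<^sup>2 / a) / 2 \<partial>M)"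
    proof (rule integral_mono_AE')
      show "integrable M (\<lambda>\<omega>. (a * (cmod (W $ i $ k))\<^sup>2 * (Z k \<omega>)\<^sup>2 + (cmod (res (X \<omega>) $ k $ i))\<^sup>2 / a) / 2)"
        using iZ integrable_res_power2 by simp
      show "AE \<omega> in M. cmod (W $ i $ k * ((self_energy k (res (X \<omega>)) - self_energy k mean) * res (X \<omega>) $ k $ i))
         \<le> (a * (cmod (W $ i $ k))\<^sup>2 * (Z k \<omega>)\<^sup>2 + (cmod (res (X \<omega>) $ k $ i))\<^sup>2 / a) / 2"
        using mult_le_weighted_squares[OF a, of "cmod (W $ i $ k) * Z k _" "cmod (res (X _) $ k $ i)"]
        by (intro AE_I2) (simp add: norm_mult Z_def power_mult_distrib mult.assoc)
      show "AE \<omega> in M. 0 \<le> (a * (cmod (W $ i $ k))\<^sup>2 * (Z k \<omega>)\<^sup>2 + (cmod (res (X \<omega>) $ k $ i))\<^sup>2 / a) / 2"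
        using a by (intro AE_I2) simp
    qed
    also have "\<dots> = (a * (cmod (W $ i $ k))\<^sup>2 * (\<integral>\<omega>. (Z k \<omega>)\<^sup>2 \<partial>M) + (\<integral>\<omega>. (cmod (res (X \<omega>) $ k $ i))\<^sup>2 \<partial>M) / a) / 2"
      using iZ integrable_res_power2 by simp
    also have "\<dots> \<le> (a * (cmod (W $ i $ k))\<^sup>2 * V + (\<integral>\<omega>. (cmod (res (X \<omega>) $ k $ i))\<^sup>2 \<partial>M) / a) / 2"
      using a ZV by (intro divide_right_mono add_right_mono mult_left_mono) auto
    finally show ?thesis .
  qed
  have "cmod (dyson_error i) \<le> (\<Sum>k\<in>UNIV. cmod (W $ i $ k * fluctuation $ k $ i))"
    unfolding dyson_error_eq W_def by (rule norm_sum)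
  also have "\<dots> \<le> (\<Sum>k\<in>UNIV. (a * (cmod (W $ i $ k))\<^sup>2 * V + (\<integral>\<omega>. (cmod (res (X \<omega>) $ k $ i))\<^sup>2 \<partial>M) / a) / 2)"
    by (intro sum_mono entry_le)
  also have "\<dots> = (a * V * (\<Sum>k\<in>UNIV. (cmod (W $ i $ k))\<^sup>2) + (\<integral>\<omega>. (\<Sum>k\<in>UNIV. (cmod (res (X \<omega>) $ k $ i))\<^sup>2) \<partial>M) / a) / 2"
    by (simp add: integrable_res_power2 sum.distrib sum_distrib_left mult_ac flip: sum_divide_distrib)
  also have "\<dots> \<le> (a * V * (1 / c\<^sup>2) + (1 / c\<^sup>2) / a) / 2"
  proof (intro divide_right_mono add_mono mult_left_mono)
    show "(\<Sum>k\<in>UNIV. (cmod (W $ i $ k))\<^sup>2) \<le> 1 / c\<^sup>2"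
      unfolding W_def by (rule norm_row_inv_le[OF dissipative_mean_pencil])
    have "(\<integral>\<omega>. (\<Sum>k\<in>UNIV. (cmod (res (X \<omega>) $ k $ i))\<^sup>2) \<partial>M) \<le> (\<integral>\<omega>. 1 / c\<^sup>2 \<partial>M)"
    proof (rule integral_mono)
      show "(\<Sum>k\<in>UNIV. (cmod (res (X \<omega>) $ k $ i))\<^sup>2) \<le> 1 / c\<^sup>2" for \<omega>
        unfolding res_def by (rule norm_column_inv_le[OF dissipative_shift])
    qed (simp_all add: integrable_res_power2)
    then show "(\<integral>\<omega>. (\<Sum>k\<in>UNIV. (cmod (res (X \<omega>) $ k $ i))\<^sup>2) \<partial>M) \<le> 1 / c\<^sup>2" by (simp add: prob_space)
  qed (use a V in auto)
  also have "\<dots> = sqrt V / c\<^sup>2"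
    using V by (simp add: a_def real_div_sqrt)
  also have "sqrt V = sqrt (real CARD('n) * v ^ 3) / c\<^sup>2"
    using c_pos by (simp add: V_def real_sqrt_divide power4_eq_xxxx real_sqrt_mult power2_eq_square)
  finally show ?thesis by (simp add: power2_eq_square power4_eq_xxxx)
qed

text \<open>For diagonal \<open>Y\<close> the mean pencil is diagonal, so only the covariance of the
  self-energy with \<open>res (X \<omega>) $ i $ i\<close> survives. There both factors may be
  centred and both variances are small, which is where this bound gains over the general
  one.\<close>

lemma dyson_error_diagonal_le:
  assumes "is_diag Y"
  shows "cmod (dyson_error i) \<le> sqrt (real CARD('n)) * v\<^sup>2 / c ^ 5"
proof -
  define W where "W = matrix_inv mean_pencil"
  define Z where "Z \<omega> = self_energy i (res (X \<omega>)) - self_energy i mean" for \<omega>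
  define U where "U \<omega> = res (X \<omega>) $ i $ i - mean $ i $ i" for \<omega>
  have [measurable]: "Z \<in> borel_measurable M" "U \<in> borel_measurable M" unfolding Z_def U_def by measurable
  have "is_diag mean_pencil"
    using assms by (simp add: is_diag_def mean_pencil_def pencil_def diagm_def)
  then have W0: "W $ i $ k = 0" if "k \<noteq> i" for k
    unfolding W_def using that dissipative_invertible[OF dissipative_mean_pencil c_pos] by (intro matrix_inv_is_diag) auto
  have "dyson_error i = W $ i $ i * fluctuation $ i $ i"
    unfolding dyson_error_eq W_def[symmetric] by (subst sum.remove[of _ i]) (simp_all add: W0)
  then have eq: "cmod (dyson_error i) = cmod (W $ i $ i) * cmod (fluctuation $ i $ i)" by (simp add: norm_mult)
  have iZ: "integrable M Z" unfolding Z_def self_energy_eq by (simp add: integrable_res)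
  have Z0: "(\<integral>\<omega>. Z \<omega> \<partial>M) = 0"
    unfolding Z_def using expectation_weighted_trace[of "\<lambda>j. of_real (\<sigma> i j)"]
    by (simp add: self_energy_def prob_space weighted_trace_def integrable_res mean_entry)
  define V1 where "V1 = v / c ^ 4"
  define V2 where "V2 = real CARD('n) * v ^ 3 / c ^ 4"
  have V: "0 < V1" "0 < V2" using v_pos c_pos by (auto simp: V1_def V2_def)
  \<comment> \<open>The optimal weight: both summands of the weighted inequality become
    \<open>sqrt (V1 * V2)\<close>.\<close>
  define a where "a = sqrt (V1 / V2)"
  have a: "0 < a" using V by (simp add: a_def)
  have iZ2: "integrable M (\<lambda>\<omega>. (cmod (Z \<omega>))\<^sup>2)" unfolding Z_def by (rule integrable_self_energy_deviation)
  have iU2: "integrable M (\<lambda>\<omega>. (cmod (U \<omega>))\<^sup>2)"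
  proof (rule integrable_bounded)
    show "norm ((cmod (U \<omega>))\<^sup>2) \<le> (1 / c + cmod (mean $ i $ i))\<^sup>2" for \<omega>
      using power_mono[OF order_trans[OF norm_triangle_ineq4 add_right_mono[OF cmod_res_entry_le]] norm_ge_zero, of "X \<omega>" i i "mean $ i $ i" 2]
      by (simp add: U_def)
  qed simp
  have iZR: "integrable M (\<lambda>\<omega>. Z \<omega> * res (X \<omega>) $ i $ i)"
    unfolding Z_def self_energy_eq
    by (simp add: left_diff_distrib sum_distrib_right mult.assoc integrable_res integrable_res_mult)
  \<comment> \<open>As \<open>Z\<close> has mean 0, a constant may be subtracted from the resolvent
    entry.\<close>
  have "fluctuation $ i $ i = (\<integral>\<omega>. Z \<omega> * res (X \<omega>) $ i $ i - Z \<omega> * mean $ i $ i \<partial>M)"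
    using iZ iZR Z0 by (simp add: fluctuation_def Z_def[symmetric])
  also have "\<dots> = (\<integral>\<omega>. Z \<omega> * U \<omega> \<partial>M)" by (simp add: U_def right_diff_distrib)
  finally have "cmod (fluctuation $ i $ i) \<le> (\<integral>\<omega>. cmod (Z \<omega> * U \<omega>) \<partial>M)"
    using integral_norm_bound by simp
  also have "\<dots> \<le> (\<integral>\<omega>. (a * (cmod (Z \<omega>))\<^sup>2 + (cmod (U \<omega>))\<^sup>2 / a) / 2 \<partial>M)"
  proof (rule integral_mono_AE')
    show "AE \<omega> in M. cmod (Z \<omega> * U \<omega>) \<le> (a * (cmod (Z \<omega>))\<^sup>2 + (cmod (U \<omega>))\<^sup>2 / a) / 2"
      unfolding norm_mult by (intro AE_I2 mult_le_weighted_squares a)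
  qed (use iZ2 iU2 a in auto)
  also have "\<dots> = (a * (\<integral>\<omega>. (cmod (Z \<omega>))\<^sup>2 \<partial>M) + (\<integral>\<omega>. (cmod (U \<omega>))\<^sup>2 \<partial>M) / a) / 2"
    using iZ2 iU2 by simp
  also have "\<dots> \<le> (a * V2 + V1 / a) / 2"
    using a self_energy_variance[of i] res_diagonal_variance[of i]
    by (intro divide_right_mono add_mono mult_left_mono) (auto simp: Z_def U_def V1_def V2_def)
  also have "\<dots> = sqrt (V1 * V2)"
  proof -
    have "a * V2 = sqrt (V1 * V2)" "V1 / a = sqrt (V1 * V2)"
      using V by (simp_all add: a_def real_sqrt_mult real_sqrt_divide field_simps)
    then show ?thesis by simp
  qed
  also have "V1 * V2 = (sqrt (real CARD('n)) * v\<^sup>2 / c ^ 4)\<^sup>2"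
    by (simp add: V1_def V2_def power_mult_distrib power_divide power2_eq_square power3_eq_cube)
  also have "sqrt \<dots> = sqrt (real CARD('n)) * v\<^sup>2 / c ^ 4"
    using c_pos by (simp add: real_sqrt_abs)
  finally have fl: "cmod (fluctuation $ i $ i) \<le> sqrt (real CARD('n)) * v\<^sup>2 / c ^ 4" .
  have "cmod (W $ i $ i) \<le> 1 / c"
    unfolding W_def by (rule cmod_entry_dissipative_inv[OF dissipative_mean_pencil c_pos])
  then have "cmod (dyson_error i) \<le> (1 / c) * (sqrt (real CARD('n)) * v\<^sup>2 / c ^ 4)"
    unfolding eq using fl c_pos by (intro mult_mono) auto
  then show ?thesis by (simp add: eval_nat_numeral)
qed

end

section \<open>Stability of the law of the GUE\<close>

text \<open>The property from \<open>stable_law\<close>, stated for a law, so that it can be carried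
  through linear images and products until the law of the matrix is reached.\<close>

definition stable_measure :: "'b::euclidean_space measure \<Rightarrow> bool" where
  "stable_measure N \<longleftrightarrow> prob_space N \<and> sets N = sets borel \<and>
     (\<forall>a b. 0 < a \<longrightarrow> 0 < b \<longrightarrow> a\<^sup>2 + b\<^sup>2 = 1 \<longrightarrow> distr (N \<Otimes>\<^sub>M N) borel (\<lambda>(x, y). a *\<^sub>R x + b *\<^sub>R y) = N)"

lemma stable_measureD:
  assumes "stable_measure N"
  shows "prob_space N" "sets N = sets borel"
    "0 < a \<Longrightarrow> 0 < b \<Longrightarrow> a\<^sup>2 + b\<^sup>2 = 1 \<Longrightarrow> distr (N \<Otimes>\<^sub>M N) borel (\<lambda>(x, y). a *\<^sub>R x + b *\<^sub>R y) = N"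
  using assms by (auto simp: stable_measure_def)

text \<open>The sum of independent normal variables with standard deviations a s and b s is normal
  with variance (a^2 + b^2) s^2. The two coordinates on the product space serve as independent
  copies.\<close>

lemma stable_measure_normal:
  assumes "prob_space M" and X: "distributed M lborel X (normal_density 0 s)" and s: "0 < s"
  shows "stable_measure (distr M borel X)"
proof -
  interpret prob_space M by fact
  define N where "N = distr M borel X"
  have Xm [measurable]: "X \<in> borel_measurable M" using distributed_measurable[OF X] by simp
  interpret N: prob_space N unfolding N_def by (rule prob_space_distr) simp
  interpret pair: pair_prob_space N N ..
  have setsN [measurable_cong]: "sets N = sets borel" by (simp add: N_def)
  have Neq: "N = density lborel (normal_density 0 s)"
    using distributed_distr_eq_density[OF X] by (simp add: N_def cong: distr_cong)
  have "distr (N \<Otimes>\<^sub>M N) borel fst = distr (N \<Otimes>\<^sub>M N) N fst"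
    by (rule distr_cong) (simp_all add: setsN)
  then have law1: "distr (N \<Otimes>\<^sub>M N) borel fst = N" by (simp only: N.distr_pair_fst)
  have "distr (N \<Otimes>\<^sub>M N) borel snd = distr (distr (N \<Otimes>\<^sub>M N) (N \<Otimes>\<^sub>M N) (\<lambda>(x, y). (y, x))) N fst"
    by (subst distr_distr) (auto simp: comp_def split_beta' setsN intro!: distr_cong)
  then have law2: "distr (N \<Otimes>\<^sub>M N) borel snd = N"
    by (simp only: pair.distr_pair_swap[symmetric] N.distr_pair_fst)
  have lborel: "distr (N \<Otimes>\<^sub>M N) lborel f = distr (N \<Otimes>\<^sub>M N) borel f" for f :: "real \<times> real \<Rightarrow> real"
    by (rule distr_cong) simp_all
  have d1: "distributed (N \<Otimes>\<^sub>M N) lborel fst (normal_density 0 s)"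
    and d2: "distributed (N \<Otimes>\<^sub>M N) lborel snd (normal_density 0 s)"
    unfolding distributed_def lborel law1 law2 by (auto simp: Neq[symmetric])
  have ind: "pair.indep_var borel fst borel snd"
    unfolding pair.indep_var_distribution_eq law1 law2
  proof (intro conjI)
    have "distr (N \<Otimes>\<^sub>M N) (borel \<Otimes>\<^sub>M borel) (\<lambda>x. (fst x, snd x)) = distr (N \<Otimes>\<^sub>M N) (N \<Otimes>\<^sub>M N) (\<lambda>x. x)"
      by (rule distr_cong) (auto intro!: sets_pair_measure_cong simp: setsN)
    then show "N \<Otimes>\<^sub>M N = distr (N \<Otimes>\<^sub>M N) (borel \<Otimes>\<^sub>M borel) (\<lambda>x. (fst x, snd x))" by simp
  qed auto
  have "distr (N \<Otimes>\<^sub>M N) borel (\<lambda>(x, y). a *\<^sub>R x + b *\<^sub>R y) = N" if ab: "0 < a" "0 < b" "a\<^sup>2 + b\<^sup>2 = 1" for a b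
  proof -
    have "distributed (N \<Otimes>\<^sub>M N) lborel (\<lambda>p. a * fst p + b * snd p) (normal_density (0 + 0) (sqrt ((a * s)\<^sup>2 + (b * s)\<^sup>2)))"
    proof (rule pair.add_indep_normal)
      show "pair.indep_var borel (\<lambda>p. a * fst p) borel (\<lambda>p. b * snd p)"
        using pair.indep_var_compose[OF ind, of "\<lambda>x. a * x" borel "\<lambda>x. b * x" borel] by (simp add: comp_def)
      show "distributed (N \<Otimes>\<^sub>M N) lborel (\<lambda>p. a * fst p) (normal_density 0 (a * s))"
        using pair.normal_density_affine[OF d1 s, of a 0] ab by simp
      show "distributed (N \<Otimes>\<^sub>M N) lborel (\<lambda>p. b * snd p) (normal_density 0 (b * s))"
        using pair.normal_density_affine[OF d2 s, of b 0] ab by simp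
    qed (use ab s in auto)
    moreover have "(a * s)\<^sup>2 + (b * s)\<^sup>2 = s\<^sup>2"
      using ab(3) by (simp add: power_mult_distrib flip: distrib_right)
    ultimately have "distributed (N \<Otimes>\<^sub>M N) lborel (\<lambda>p. a * fst p + b * snd p) (normal_density 0 s)"
      using s by simp
    from distributed_distr_eq_density[OF this] show ?thesis
      unfolding lborel Neq[symmetric] by (simp add: split_beta')
  qed
  then show ?thesis
    unfolding N_def[symmetric] stable_measure_def using N.prob_space_axioms setsN by simp
qed

lemma stable_measure_image:
  fixes g :: "'b::euclidean_space \<Rightarrow> 'c::euclidean_space"
  assumes N: "stable_measure N" and g: "linear g"
  shows "stable_measure (distr N borel g)"
proof -
  interpret N: prob_space N by (rule stable_measureD[OF N])
  have setsN [measurable_cong]: "sets N = sets borel" by (rule stable_measureD[OF N])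
  have gm [measurable]: "g \<in> borel_measurable borel"
    by (intro borel_measurable_continuous_onI linear_continuous_on linear_linear[THEN iffD2] g)
  interpret G: prob_space "distr N borel g" by (rule N.prob_space_distr) simp
  have "distr (distr N borel g \<Otimes>\<^sub>M distr N borel g) borel (\<lambda>(x, y). a *\<^sub>R x + b *\<^sub>R y) = distr N borel g"
    if ab: "0 < a" "0 < b" "a\<^sup>2 + b\<^sup>2 = 1" for a b
  proof -
    have "distr (distr N borel g \<Otimes>\<^sub>M distr N borel g) borel (\<lambda>(x, y). a *\<^sub>R x + b *\<^sub>R y)
       = distr (distr (N \<Otimes>\<^sub>M N) (borel \<Otimes>\<^sub>M borel) (\<lambda>(x, y). (g x, g y))) borel (\<lambda>(x, y). a *\<^sub>R x + b *\<^sub>R y)"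
      by (subst pair_measure_distr) (auto intro: G.sigma_finite_measure_axioms)
    also have "\<dots> = distr (N \<Otimes>\<^sub>M N) borel (\<lambda>(x, y). a *\<^sub>R g x + b *\<^sub>R g y)"
      by (subst distr_distr) (auto simp: comp_def split_beta')
    also have "\<dots> = distr (distr (N \<Otimes>\<^sub>M N) borel (\<lambda>(x, y). a *\<^sub>R x + b *\<^sub>R y)) borel g"
      by (subst distr_distr) (auto simp: comp_def split_beta' linear_add[OF g] linear_scale[OF g])
    finally show ?thesis unfolding stable_measureD(3)[OF N ab] .
  qed
  then show ?thesis unfolding stable_measure_def using G.prob_space_axioms by simp
qed

text \<open>It suffices to compare the measures on rectangles. There the indicator factorizes
  coordinatewise, and each factor reduces to stability of \<open>A\<close> or
  \<open>B\<close>.\<close>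

lemma stable_measure_pair:
  fixes A :: "'b::euclidean_space measure" and B :: "'c::euclidean_space measure"
  assumes A: "stable_measure A" and B: "stable_measure B"
  shows "stable_measure (A \<Otimes>\<^sub>M B)"
proof -
  interpret A: prob_space A by (rule stable_measureD[OF A])
  interpret B: prob_space B by (rule stable_measureD[OF B])
  interpret AB: pair_prob_space A B ..
  interpret ABAB: pair_prob_space "A \<Otimes>\<^sub>M B" "A \<Otimes>\<^sub>M B" ..
  have [measurable_cong]: "sets A = sets borel" "sets B = sets borel"
    using stable_measureD(2)[OF A] stable_measureD(2)[OF B] by auto
  have setsAB: "sets (A \<Otimes>\<^sub>M B) = sets borel"
    unfolding borel_prod[symmetric] by (intro sets_pair_measure_cong stable_measureD A B)
  have "A \<Otimes>\<^sub>M B = distr ((A \<Otimes>\<^sub>M B) \<Otimes>\<^sub>M (A \<Otimes>\<^sub>M B)) borel (\<lambda>(x, y). a *\<^sub>R x + b *\<^sub>R y)"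
    if ab: "0 < a" "0 < b" "a\<^sup>2 + b\<^sup>2 = 1" for a b
  proof (rule pair_measure_eqI)
    let ?D = "distr ((A \<Otimes>\<^sub>M B) \<Otimes>\<^sub>M (A \<Otimes>\<^sub>M B)) borel (\<lambda>(x, y). a *\<^sub>R x + b *\<^sub>R y)"
    have mAB: "(\<lambda>(x, y). a *\<^sub>R x + b *\<^sub>R y) \<in> measurable ((A \<Otimes>\<^sub>M B) \<Otimes>\<^sub>M (A \<Otimes>\<^sub>M B)) borel"
    proof -
      have "(\<lambda>(x, y). a *\<^sub>R x + b *\<^sub>R y) \<in> borel_measurable (borel \<Otimes>\<^sub>M borel :: (('b \<times> 'c) \<times> ('b \<times> 'c)) measure)" for a b
        by measurable
      then show ?thesis
        using measurable_cong_sets[OF sets_pair_measure_cong[OF setsAB setsAB] refl] by blast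
    qed
    have law: "emeasure N S = (\<integral>\<^sup>+x. (\<integral>\<^sup>+y. indicator S (a *\<^sub>R x + b *\<^sub>R y) \<partial>N) \<partial>N)"
      if N: "stable_measure N" and S: "S \<in> sets borel" for N :: "'d::euclidean_space measure" and S
    proof -
      interpret N: prob_space N by (rule stable_measureD[OF N])
      interpret NN: pair_prob_space N N ..
      have [measurable_cong]: "sets N = sets borel" by (rule stable_measureD[OF N])
      note S[measurable]
      have "emeasure N S = emeasure (distr (N \<Otimes>\<^sub>M N) borel (\<lambda>(x, y). a *\<^sub>R x + b *\<^sub>R y)) S"
        unfolding stable_measureD(3)[OF N ab] ..
      also have "\<dots> = (\<integral>\<^sup>+p. indicator S p \<partial>distr (N \<Otimes>\<^sub>M N) borel (\<lambda>(x, y). a *\<^sub>R x + b *\<^sub>R y))"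
        by simp
      also have "\<dots> = (\<integral>\<^sup>+p. indicator S (case p of (x, y) \<Rightarrow> a *\<^sub>R x + b *\<^sub>R y) \<partial>(N \<Otimes>\<^sub>M N))"
        by (rule nn_integral_distr) auto
      also have "\<dots> = (\<integral>\<^sup>+x. (\<integral>\<^sup>+y. indicator S (a *\<^sub>R x + b *\<^sub>R y) \<partial>N) \<partial>N)"
        by (subst N.nn_integral_fst[symmetric]) auto
      finally show ?thesis .
    qed
    fix S T assume "S \<in> sets A" "T \<in> sets B"
    then have S[measurable]: "S \<in> sets borel" and T[measurable]: "T \<in> sets borel"
      using stable_measureD(2)[OF A] stable_measureD(2)[OF B] by auto
    define h where "h x = (\<integral>\<^sup>+x'. indicator S (a *\<^sub>R x + b *\<^sub>R x') \<partial>A)" for x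
    define k where "k y = (\<integral>\<^sup>+y'. indicator T (a *\<^sub>R y + b *\<^sub>R y') \<partial>B)" for y
    have [measurable]: "h \<in> borel_measurable borel" unfolding h_def by measurable
    have [measurable]: "k \<in> borel_measurable borel" unfolding k_def by measurable
    have ST: "S \<times> T \<in> sets borel" unfolding borel_prod[symmetric] by (intro pair_measureI S T)
    have "emeasure ?D (S \<times> T) = (\<integral>\<^sup>+p. indicator (S \<times> T) p \<partial>?D)" using ST by simp
    also have "\<dots> = (\<integral>\<^sup>+p. indicator (S \<times> T) (case p of (x, y) \<Rightarrow> a *\<^sub>R x + b *\<^sub>R y) \<partial>((A \<Otimes>\<^sub>M B) \<Otimes>\<^sub>M (A \<Otimes>\<^sub>M B)))"
      by (rule nn_integral_distr[OF mAB]) (use ST in simp)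
    also have "\<dots> = (\<integral>\<^sup>+p. (\<integral>\<^sup>+q. indicator (S \<times> T) (a *\<^sub>R p + b *\<^sub>R q) \<partial>(A \<Otimes>\<^sub>M B)) \<partial>(A \<Otimes>\<^sub>M B))"
    proof (subst AB.P.nn_integral_fst[symmetric])
      show "(\<lambda>p. indicator (S \<times> T) (case p of (x, y) \<Rightarrow> a *\<^sub>R x + b *\<^sub>R y)) \<in> borel_measurable ((A \<Otimes>\<^sub>M B) \<Otimes>\<^sub>M (A \<Otimes>\<^sub>M B))"
        by (rule measurable_compose[OF mAB]) (use ST in simp)
    qed simp
    also have "\<dots> = (\<integral>\<^sup>+p. (case p of (x, y) \<Rightarrow> h x * k y) \<partial>(A \<Otimes>\<^sub>M B))"
    proof (intro nn_integral_cong, clarify)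
      fix x y
      have "(\<integral>\<^sup>+q. indicator (S \<times> T) (a *\<^sub>R (x, y) + b *\<^sub>R q) \<partial>(A \<Otimes>\<^sub>M B))
         = (\<integral>\<^sup>+q. (case q of (x', y') \<Rightarrow> indicator S (a *\<^sub>R x + b *\<^sub>R x') * indicator T (a *\<^sub>R y + b *\<^sub>R y')) \<partial>(A \<Otimes>\<^sub>M B))"
        by (intro nn_integral_cong) (auto split: split_indicator)
      also have "\<dots> = (\<integral>\<^sup>+x'. (\<integral>\<^sup>+y'. indicator S (a *\<^sub>R x + b *\<^sub>R x') * indicator T (a *\<^sub>R y + b *\<^sub>R y') \<partial>B) \<partial>A)"
        by (subst B.nn_integral_fst[symmetric]) auto
      also have "\<dots> = h x * k y"
        by (simp add: nn_integral_cmult nn_integral_multc h_def k_def)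
      finally show "(\<integral>\<^sup>+q. indicator (S \<times> T) (a *\<^sub>R (x, y) + b *\<^sub>R q) \<partial>(A \<Otimes>\<^sub>M B)) = h x * k y" .
    qed
    also have "\<dots> = (\<integral>\<^sup>+x. (\<integral>\<^sup>+y. h x * k y \<partial>B) \<partial>A)"
      by (subst B.nn_integral_fst[symmetric]) auto
    also have "\<dots> = (\<integral>\<^sup>+x. h x \<partial>A) * (\<integral>\<^sup>+y. k y \<partial>B)"
      by (simp add: nn_integral_cmult nn_integral_multc)
    also have "\<dots> = emeasure A S * emeasure B T"
      unfolding h_def k_def by (simp add: law[OF A S] law[OF B T])
    finally show "emeasure A S * emeasure B T = emeasure ?D (S \<times> T)" ..
  qed (simp_all add: A.sigma_finite_measure_axioms B.sigma_finite_measure_axioms setsAB)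
  then show ?thesis
    unfolding stable_measure_def using AB.P.prob_space_axioms setsAB by metis
qed

text \<open>The same factorization on boxes. Families indexed by \<open>I\<close> have no Euclidean
  type here, so the linear combination is written coordinatewise instead of through
  \<open>stable_measure\<close>.\<close>

lemma stable_PiM:
  fixes N :: "'i \<Rightarrow> 'b::euclidean_space measure"
  assumes I: "finite I" and N: "\<And>i. stable_measure (N i)" and ab: "0 < a" "0 < b" "a\<^sup>2 + b\<^sup>2 = 1"
  shows "distr (PiM I N \<Otimes>\<^sub>M PiM I N) (PiM I N) (\<lambda>(x, y). \<lambda>i\<in>I. a *\<^sub>R x i + b *\<^sub>R y i) = PiM I N"
proof -
  interpret prob: prob_space "N i" for i by (rule stable_measureD[OF N])
  interpret product_prob_space N I ..
  interpret P: prob_space "PiM I N" by (rule prob_space_PiM) (rule prob.prob_space_axioms)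
  have [measurable_cong]: "sets (N i) = sets borel" for i by (rule stable_measureD[OF N])
  interpret PP: pair_prob_space "PiM I N" "PiM I N" ..
  let ?T = "\<lambda>(x, y). \<lambda>i\<in>I. a *\<^sub>R x i + b *\<^sub>R y i"
  have T [measurable]: "?T \<in> measurable (PiM I N \<Otimes>\<^sub>M PiM I N) (PiM I N)"
    by measurable
  show ?thesis
  proof (rule PiM_eqI[OF I])
    fix S assume "\<And>i. i \<in> I \<Longrightarrow> S i \<in> sets (N i)"
    then have S [measurable]: "\<And>i. i \<in> I \<Longrightarrow> S i \<in> sets borel" by (simp add: stable_measureD(2)[OF N])
    define f where "f i x y = (indicator (S i) (a *\<^sub>R x + b *\<^sub>R y) :: ennreal)" for i x y
    have [measurable]: "(\<lambda>p. f i (fst p) (snd p)) \<in> borel_measurable (N i \<Otimes>\<^sub>M N i)" if "i \<in> I" for i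
      using S[OF that] unfolding f_def by measurable
    have fm [measurable]: "f i x \<in> borel_measurable (N i)" if "i \<in> I" for i x
      using S[OF that] unfolding f_def by measurable
    have Fm [measurable]: "(\<lambda>x. \<integral>\<^sup>+y. f i x y \<partial>N i) \<in> borel_measurable (N i)" if "i \<in> I" for i
      using S[OF that] unfolding f_def by measurable
    have box: "Pi\<^sub>E I S \<in> sets (PiM I N)"
      using S I by (intro sets_PiM_I_finite) (auto simp: stable_measureD(2)[OF N])
    have "emeasure (distr (PiM I N \<Otimes>\<^sub>M PiM I N) (PiM I N) ?T) (Pi\<^sub>E I S)
       = (\<integral>\<^sup>+z. indicator (Pi\<^sub>E I S) z \<partial>distr (PiM I N \<Otimes>\<^sub>M PiM I N) (PiM I N) ?T)"
      using box by simp
    also have "\<dots> = (\<integral>\<^sup>+p. indicator (Pi\<^sub>E I S) (?T p) \<partial>(PiM I N \<Otimes>\<^sub>M PiM I N))"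
      by (rule nn_integral_distr[OF T]) (use box in simp)
    also have "\<dots> = (\<integral>\<^sup>+x. (\<integral>\<^sup>+y. indicator (Pi\<^sub>E I S) (?T (x, y)) \<partial>PiM I N) \<partial>PiM I N)"
    proof (subst P.nn_integral_fst[symmetric])
      show "(\<lambda>p. indicator (Pi\<^sub>E I S) (?T p)) \<in> borel_measurable (PiM I N \<Otimes>\<^sub>M PiM I N)"
        by (rule measurable_compose[OF T]) (use box in simp)
    qed simp
    also have "\<dots> = (\<integral>\<^sup>+x. (\<integral>\<^sup>+y. (\<Prod>i\<in>I. f i (x i) (y i)) \<partial>PiM I N) \<partial>PiM I N)"
    proof (intro nn_integral_cong)
      fix x y
      show "indicator (Pi\<^sub>E I S) (?T (x, y)) = (\<Prod>i\<in>I. f i (x i) (y i))"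
      proof (cases "\<forall>i\<in>I. a *\<^sub>R x i + b *\<^sub>R y i \<in> S i")
        case True
        then have "?T (x, y) \<in> Pi\<^sub>E I S" by auto
        then show ?thesis using True by (simp add: f_def)
      next
        case False
        then obtain i where i: "i \<in> I" "a *\<^sub>R x i + b *\<^sub>R y i \<notin> S i" by blast
        then have "?T (x, y) \<notin> Pi\<^sub>E I S" by (auto dest: PiE_mem)
        moreover have "(\<Prod>i\<in>I. f i (x i) (y i)) = 0"
          using i I by (intro prod_zero) (auto simp: f_def intro!: bexI[of _ i])
        ultimately show ?thesis by simp
      qed
    qed
    also have "\<dots> = (\<integral>\<^sup>+x. (\<Prod>i\<in>I. \<integral>\<^sup>+y. f i (x i) y \<partial>N i) \<partial>PiM I N)"
      by (intro nn_integral_cong product_nn_integral_prod I fm)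
    also have "\<dots> = (\<Prod>i\<in>I. \<integral>\<^sup>+x. (\<integral>\<^sup>+y. f i x y \<partial>N i) \<partial>N i)"
      by (intro product_nn_integral_prod I Fm)
    also have "\<dots> = (\<Prod>i\<in>I. emeasure (N i) (S i))"
    proof (rule prod.cong[OF refl])
      fix i assume i: "i \<in> I"
      have "emeasure (N i) (S i) = emeasure (distr (N i \<Otimes>\<^sub>M N i) borel (\<lambda>(x, y). a *\<^sub>R x + b *\<^sub>R y)) (S i)"
        unfolding stable_measureD(3)[OF N ab] ..
      also have "\<dots> = (\<integral>\<^sup>+p. indicator (S i) p \<partial>distr (N i \<Otimes>\<^sub>M N i) borel (\<lambda>(x, y). a *\<^sub>R x + b *\<^sub>R y))"
        using S[OF i] by simp
      also have "\<dots> = (\<integral>\<^sup>+p. f i (fst p) (snd p) \<partial>(N i \<Otimes>\<^sub>M N i))"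
        using S[OF i] by (subst nn_integral_distr) (auto simp: f_def split_beta')
      also have "\<dots> = (\<integral>\<^sup>+x. (\<integral>\<^sup>+y. f i x y \<partial>N i) \<partial>N i)"
        using i by (subst prob.nn_integral_fst[symmetric]) auto
      finally show "(\<integral>\<^sup>+x. (\<integral>\<^sup>+y. f i x y \<partial>N i) \<partial>N i) = emeasure (N i) (S i)" ..
    qed
    finally show "emeasure (distr (PiM I N \<Otimes>\<^sub>M PiM I N) (PiM I N) ?T) (Pi\<^sub>E I S) = (\<Prod>i\<in>I. emeasure (N i) (S i))" .
  qed simp
qed

lemma borel_measurable_matrix:
  fixes f :: "'b \<Rightarrow> complex ^ 'n ^ 'm"
  assumes [measurable]: "\<And>i j. (\<lambda>x. f x $ i $ j) \<in> borel_measurable M"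
  shows "f \<in> borel_measurable M"
proof -
  have "f x = (\<Sum>i\<in>UNIV. \<Sum>j\<in>UNIV. axis i (axis j (f x $ i $ j)))" for x
  proof -
    have "(\<Sum>i\<in>UNIV. \<Sum>j\<in>UNIV. axis i (axis j (f x $ i $ j))) $ a $ b
      = (\<Sum>i\<in>UNIV. if a = i then (\<Sum>j\<in>UNIV. if b = j then f x $ i $ j else 0) else 0)" for a b
      unfolding sum_component by (intro sum.cong refl) (auto simp: axis_def)
    then show ?thesis by (simp add: vec_eq_iff)
  qed
  moreover have "(\<lambda>z. axis i (axis j z) :: complex ^ 'n ^ 'm) \<in> borel_measurable borel" for i j
  proof (rule borel_measurable_continuous_onI, rule linear_continuous_on, subst linear_linear, rule linearI)
    show "axis i (axis j (y + z)) = (axis i (axis j y) + axis i (axis j z) :: complex ^ 'n ^ 'm)" for y z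
      by (simp add: vec_eq_iff axis_def)
    show "axis i (axis j (r *\<^sub>R z)) = (r *\<^sub>R axis i (axis j z) :: complex ^ 'n ^ 'm)" for r z
      by (simp add: vec_eq_iff axis_def)
  qed
  then have "(\<lambda>x. \<Sum>i\<in>UNIV. \<Sum>j\<in>UNIV. axis i (axis j (f x $ i $ j))) \<in> borel_measurable M"
    by measurable
  ultimately show ?thesis by (simp add: fun_eq_iff[symmetric])
qed

lemma normal_moment_integrable:
  assumes "0 < s" "distributed M lborel X (normal_density 0 s)"
  shows "integrable M (\<lambda>\<omega>. X \<omega> ^ k)"
  using distributed_integrable[OF assms(2), of "\<lambda>x. x ^ k"] integrable_normal_moment[OF assms(1), of 0 k] by simp

lemma borel_measurable_cnj [measurable]: "cnj \<in> borel_measurable borel"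
  by (intro borel_measurable_continuous_onI continuous_intros)

lemma cmod_power4_le: "cmod z ^ 4 \<le> 2 * Re z ^ 4 + 2 * Im z ^ 4"
proof -
  have "cmod z ^ 4 = ((Re z)\<^sup>2 + (Im z)\<^sup>2)\<^sup>2"
    by (simp add: cmod_power2[symmetric] flip: power_mult)
  also have "\<dots> = 2 * Re z ^ 4 + 2 * Im z ^ 4 - ((Re z)\<^sup>2 - (Im z)\<^sup>2)\<^sup>2"
    by (simp add: power2_eq_square power4_eq_xxxx algebra_simps)
  finally show ?thesis by simp
qed

section \<open>The Gaussian entries: stability, moments and covariances\<close>

locale gue = prob_space M for M :: "'a measure" +
  fixes x :: "'n::{finite, linorder} \<Rightarrow> 'n \<Rightarrow> 'a \<Rightarrow> complex"
  assumes x_swap: "\<omega> \<in> space M \<Longrightarrow> x j i \<omega> = cnj (x i j \<omega>)"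
    and x_indep: "indep_vars (\<lambda>_. borel) (\<lambda>(i, j). x i j) {(i, j). j \<le> i}"
    and x_diag: "distributed M lborel (\<lambda>\<omega>. Re (x i i \<omega>)) (normal_density 0 1)"
    and x_Re_Im: "j < i \<Longrightarrow> indep_var borel (\<lambda>\<omega>. Re (x i j \<omega>)) borel (\<lambda>\<omega>. Im (x i j \<omega>))"
    and x_Re: "j < i \<Longrightarrow> distributed M lborel (\<lambda>\<omega>. Re (x i j \<omega>)) (normal_density 0 (sqrt (1 / 2)))"
    and x_Im: "j < i \<Longrightarrow> distributed M lborel (\<lambda>\<omega>. Im (x i j \<omega>)) (normal_density 0 (sqrt (1 / 2)))"

lemma gue_entries_imp_gue: "gue_entries M x \<Longrightarrow> gue M x"
  unfolding gue_entries_def gue_def gue_axioms_def by blast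

context gue
begin

lemma x_measurable [measurable]: "x i j \<in> borel_measurable M"
proof -
  have lower: "x i j \<in> borel_measurable M" if "j \<le> i" for i j
    using x_indep that unfolding indep_vars_def by auto
  show ?thesis
  proof (cases "j \<le> i")
    case False
    have "(\<lambda>\<omega>. cnj (x j i \<omega>)) \<in> borel_measurable M"
      by (rule measurable_compose[OF lower borel_measurable_cnj]) (use False in simp)
    then show ?thesis by (rule measurable_cong[THEN iffD1, rotated]) (simp add: x_swap[of _ j i])
  qed (rule lower)
qed

lemma Im_x_diag: "\<omega> \<in> space M \<Longrightarrow> Im (x i i \<omega>) = 0"
  using x_swap[of \<omega> i i] by (simp add: complex_eq_iff)

text \<open>A diagonal entry is the image of a real normal variable under
  \<open>complex_of_real\<close>; below the diagonal independence makes the law an image of the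
  product of two real normal laws.\<close>

lemma stable_law_lower:
  assumes "j \<le> i" shows "stable_measure (distr M borel (x i j))"
proof (cases "j = i")
  case True
  have "stable_measure (distr (distr M borel (\<lambda>\<omega>. Re (x i i \<omega>))) borel complex_of_real)"
    by (intro stable_measure_image stable_measure_normal[OF prob_space_axioms x_diag] linearI)
      (simp_all add: scaleR_conv_of_real)
  also have "distr (distr M borel (\<lambda>\<omega>. Re (x i i \<omega>))) borel complex_of_real = distr M borel (x i i)"
    by (subst distr_distr) (auto intro!: distr_cong simp: comp_def complex_eq_iff Im_x_diag)
  finally show ?thesis using True by simp
next
  case False
  then have ji: "j < i" using assms by simp
  let ?R = "\<lambda>\<omega>. Re (x i j \<omega>)" and ?I = "\<lambda>\<omega>. Im (x i j \<omega>)"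
  have "stable_measure (distr (distr M borel ?R \<Otimes>\<^sub>M distr M borel ?I) borel (\<lambda>(u, v). Complex u v))"
    by (intro stable_measure_image stable_measure_pair stable_measure_normal[OF prob_space_axioms x_Re[OF ji]]
        stable_measure_normal[OF prob_space_axioms x_Im[OF ji]] linearI) (auto simp: complex_eq_iff)
  also have "distr M borel ?R \<Otimes>\<^sub>M distr M borel ?I = distr M (borel \<Otimes>\<^sub>M borel) (\<lambda>\<omega>. (?R \<omega>, ?I \<omega>))"
    using x_Re_Im[OF ji] unfolding indep_var_distribution_eq by simp
  also have "distr \<dots> borel (\<lambda>(u, v). Complex u v) = distr M borel (x i j)"
  proof (subst distr_distr)
    have "(\<lambda>p :: real \<times> real. Complex (fst p) (snd p)) \<in> borel_measurable borel"
      by (intro borel_measurable_continuous_onI continuous_intros)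
    then show "(\<lambda>(u, v). Complex u v) \<in> borel_measurable (borel \<Otimes>\<^sub>M borel)"
      unfolding borel_prod by (simp add: split_beta')
  qed (auto simp: comp_def)
  finally show ?thesis .
qed

lemma stable_law_entry: "stable_measure (distr M borel (x i j))"
proof (cases "j \<le> i")
  case False
  have "stable_measure (distr (distr M borel (x j i)) borel cnj)"
    by (intro stable_measure_image stable_law_lower linearI) (use False in auto)
  also have "distr (distr M borel (x j i)) borel cnj = distr M borel (x i j)"
    by (subst distr_distr) (auto intro!: distr_cong simp: comp_def x_swap[of _ i j])
  finally show ?thesis .
qed (rule stable_law_lower)

lemma integrable_Re_power: "integrable M (\<lambda>\<omega>. Re (x i j \<omega>) ^ k)"
proof -
  have lower: "integrable M (\<lambda>\<omega>. Re (x i j \<omega>) ^ k)" if "j \<le> i" for i j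
    using that normal_moment_integrable[OF _ x_diag] normal_moment_integrable[OF _ x_Re] by (cases "j = i") auto
  show ?thesis
  proof (cases "j \<le> i")
    case False
    then have "integrable M (\<lambda>\<omega>. Re (x j i \<omega>) ^ k)" by (intro lower) simp
    then show ?thesis by (rule Bochner_Integration.integrable_cong[THEN iffD1, rotated -1]) (simp_all add: x_swap[of _ j i])
  qed (rule lower)
qed

lemma integrable_Im_power:
  assumes "0 < k" shows "integrable M (\<lambda>\<omega>. Im (x i j \<omega>) ^ k)"
proof -
  have lower: "integrable M (\<lambda>\<omega>. Im (x i j \<omega>) ^ k)" if "j \<le> i" for i j
  proof (cases "j = i")
    case True
    have "integrable M (\<lambda>\<omega>. Im (x i i \<omega>) ^ k) \<longleftrightarrow> integrable M (\<lambda>\<omega>. 0 :: real)"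
      using assms by (intro Bochner_Integration.integrable_cong) (simp_all add: Im_x_diag)
    then show ?thesis using True by simp
  qed (use that normal_moment_integrable[OF _ x_Im] in auto)
  show ?thesis
  proof (cases "j \<le> i")
    case False
    then have "integrable M (\<lambda>\<omega>. (-1) ^ k * Im (x j i \<omega>) ^ k)" by (intro integrable_mult_right lower) simp
    then show ?thesis
      by (rule Bochner_Integration.integrable_cong[THEN iffD1, rotated -1])
        (simp_all add: x_swap[of _ j i] power_minus[of "Im _"])
  qed (rule lower)
qed

lemma integrable_x: "integrable M (x i j)"
proof -
  have "integrable M (\<lambda>\<omega>. complex_of_real (Re (x i j \<omega>)) + \<i> * complex_of_real (Im (x i j \<omega>)))"
    using integrable_Re_power[of i j 1] integrable_Im_power[of 1 i j] by simp
  then show ?thesis by (simp flip: complex_eq)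
qed

lemma expectation_x_lower:
  assumes "j \<le> i" shows "(\<integral>\<omega>. x i j \<omega> \<partial>M) = 0"
proof -
  have "(\<integral>\<omega>. Re (x i j \<omega>) \<partial>M) = 0"
    using assms normal_distributed_expectation[OF _ x_diag] normal_distributed_expectation[OF _ x_Re]
    by (cases "j = i") auto
  moreover have "(\<integral>\<omega>. Im (x i j \<omega>) \<partial>M) = 0"
  proof (cases "j = i")
    case True
    have "(\<integral>\<omega>. Im (x i i \<omega>) \<partial>M) = (\<integral>\<omega>. 0 \<partial>M)"
      by (intro Bochner_Integration.integral_cong refl Im_x_diag)
    then show ?thesis using True by simp
  qed (use assms normal_distributed_expectation[OF _ x_Im] in auto)
  ultimately show ?thesis
    using integral_Re[OF integrable_x, of i j] integral_Im[OF integrable_x, of i j] by (simp add: complex_eq_iff)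
qed

lemma expectation_x: "(\<integral>\<omega>. x i j \<omega> \<partial>M) = 0"
proof (cases "j \<le> i")
  case False
  have "(\<integral>\<omega>. x i j \<omega> \<partial>M) = (\<integral>\<omega>. cnj (x j i \<omega>) \<partial>M)"
    by (intro Bochner_Integration.integral_cong refl) (simp add: x_swap[of _ i j])
  then show ?thesis using expectation_x_lower[of i j] False by simp
qed (rule expectation_x_lower)

text \<open>The functions \<open>f\<close> and \<open>g\<close> are there to be the identity or
  conjugation: entries above the diagonal are conjugates of independent ones below.\<close>

lemma lower_product_expectation:
  assumes p: "p \<in> {(i, j). j \<le> i}" and q: "q \<in> {(i, j). j \<le> i}" and ne: "p \<noteq> q"
    and [measurable]: "f \<in> borel_measurable borel" "g \<in> borel_measurable borel"
    and int: "integrable M (\<lambda>\<omega>. f (case_prod x p \<omega>))" "integrable M (\<lambda>\<omega>. g (case_prod x q \<omega>))"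
  shows "(\<integral>\<omega>. f (case_prod x p \<omega>) * g (case_prod x q \<omega>) \<partial>M) =
    (\<integral>\<omega>. f (case_prod x p \<omega>) \<partial>M) * (\<integral>\<omega>. (g (case_prod x q \<omega>) :: complex) \<partial>M)"
proof -
  have "indep_var borel ((\<lambda>h. f (h p)) \<circ> (\<lambda>\<omega>. restrict (\<lambda>i. (case i of (i, j) \<Rightarrow> x i j) \<omega>) {p}))
     borel ((\<lambda>h. g (h q)) \<circ> (\<lambda>\<omega>. restrict (\<lambda>i. (case i of (i, j) \<Rightarrow> x i j) \<omega>) {q}))"
    by (rule indep_var_compose[OF indep_var_restrict[OF x_indep]]) (use p q ne in auto)
  then have "indep_var borel (\<lambda>\<omega>. f (case_prod x p \<omega>)) borel (\<lambda>\<omega>. g (case_prod x q \<omega>))"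
    by (simp add: comp_def)
  then show ?thesis using int by (rule indep_var_lebesgue_integral)
qed

text \<open>The second claim, the vanishing of the unconjugated square, uses that real and imaginary
  part are independent, centred and of equal variance.\<close>

lemma lower_second_moment:
  assumes "j \<le> i"
  shows "(\<integral>\<omega>. x i j \<omega> * cnj (x i j \<omega>) \<partial>M) = 1" "j \<noteq> i \<Longrightarrow> (\<integral>\<omega>. x i j \<omega> * x i j \<omega> \<partial>M) = 0"
proof -
  have var: "(\<integral>\<omega>. (Z \<omega>)\<^sup>2 \<partial>M) = s\<^sup>2" if "distributed M lborel Z (normal_density 0 s)" "0 < s" for Z s
    using normal_distributed_variance[OF that(2,1)] normal_distributed_expectation[OF that(2,1)] by simp
  have sq: "integrable M (\<lambda>\<omega>. (Re (x i j \<omega>))\<^sup>2)" "integrable M (\<lambda>\<omega>. (Im (x i j \<omega>))\<^sup>2)"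
    using integrable_Re_power[of i j 2] integrable_Im_power[of 2 i j] by auto
  have "(\<integral>\<omega>. x i j \<omega> * cnj (x i j \<omega>) \<partial>M) = (\<integral>\<omega>. complex_of_real ((Re (x i j \<omega>))\<^sup>2 + (Im (x i j \<omega>))\<^sup>2) \<partial>M)"
    by (simp add: complex_mult_cnj)
  also have "\<dots> = complex_of_real ((\<integral>\<omega>. (Re (x i j \<omega>))\<^sup>2 \<partial>M) + (\<integral>\<omega>. (Im (x i j \<omega>))\<^sup>2 \<partial>M))"
    unfolding integral_complex_of_real using sq by simp
  also have "\<dots> = 1"
  proof (cases "j = i")
    case True
    have "(\<integral>\<omega>. (Im (x i i \<omega>))\<^sup>2 \<partial>M) = (\<integral>\<omega>. 0 \<partial>M)"
      by (intro Bochner_Integration.integral_cong refl) (simp add: Im_x_diag)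
    then show ?thesis using True var[OF x_diag] by simp
  next
    case False
    then have "j < i" using assms by simp
    then show ?thesis using var[OF x_Re[OF \<open>j < i\<close>]] var[OF x_Im[OF \<open>j < i\<close>]] by (simp flip: of_real_add)
  qed
  finally show "(\<integral>\<omega>. x i j \<omega> * cnj (x i j \<omega>) \<partial>M) = 1" .
  assume "j \<noteq> i"
  then have ji: "j < i" using assms by simp
  have iR: "integrable M (\<lambda>\<omega>. Re (x i j \<omega>))" and iI: "integrable M (\<lambda>\<omega>. Im (x i j \<omega>))"
    using integrable_Re_power[of i j 1] integrable_Im_power[of 1 i j] by auto
  have RI: "integrable M (\<lambda>\<omega>. Re (x i j \<omega>) * Im (x i j \<omega>))" "(\<integral>\<omega>. Re (x i j \<omega>) * Im (x i j \<omega>) \<partial>M) = 0"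
    using indep_var_integrable[OF x_Re_Im[OF ji] iR iI] indep_var_lebesgue_integral[OF x_Re_Im[OF ji] iR iI]
      normal_distributed_expectation[OF _ x_Re[OF ji]] by auto
  have "(\<integral>\<omega>. x i j \<omega> * x i j \<omega> \<partial>M) = (\<integral>\<omega>. complex_of_real ((Re (x i j \<omega>))\<^sup>2 - (Im (x i j \<omega>))\<^sup>2)
      + 2 * \<i> * complex_of_real (Re (x i j \<omega>) * Im (x i j \<omega>)) \<partial>M)"
    by (intro Bochner_Integration.integral_cong refl) (simp add: complex_eq_iff power2_eq_square)
  also have "\<dots> = complex_of_real ((\<integral>\<omega>. (Re (x i j \<omega>))\<^sup>2 \<partial>M) - (\<integral>\<omega>. (Im (x i j \<omega>))\<^sup>2 \<partial>M))
      + 2 * \<i> * complex_of_real (\<integral>\<omega>. Re (x i j \<omega>) * Im (x i j \<omega>) \<partial>M)"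
    using sq RI(1) by (simp del: of_real_mult of_real_diff of_real_power)
  also have "\<dots> = 0" using var[OF x_Re[OF ji]] var[OF x_Im[OF ji]] RI(2) by simp
  finally show "(\<integral>\<omega>. x i j \<omega> * x i j \<omega> \<partial>M) = 0" .
qed

lemma expectation_x_mult:
  "(\<integral>\<omega>. x i j \<omega> * x k m \<omega> \<partial>M) = (if i = m \<and> j = k then 1 else 0)"
proof -
  \<comment> \<open>Every entry is the identity or conjugation, recorded by \<open>f\<close>,
    applied to its representative at \<open>lo i j\<close> in the lower triangle.\<close>
  define lo where "lo i j = (if j \<le> i then (i, j) else (j, i))" for i j :: 'n
  define f where "f i j = (if j \<le> i then id else cnj)" for i j :: 'n
  have [measurable]: "f i j \<in> borel_measurable borel" for i j by (simp add: f_def id_def)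
  have x_eq: "x i j \<omega> = f i j (case_prod x (lo i j) \<omega>)" if "\<omega> \<in> space M" for i j \<omega>
    using x_swap[OF that, of i j] by (simp add: f_def lo_def)
  have lo_in: "lo i j \<in> {(i, j). j \<le> i}" for i j by (auto simp: lo_def)
  have int: "integrable M (\<lambda>\<omega>. f i j (case_prod x (lo i j) \<omega>))" for i j
    using integrable_x[of i j] by (rule Bochner_Integration.integrable_cong[THEN iffD1, rotated -1]) (simp_all add: x_eq)
  have zero: "(\<integral>\<omega>. f i j (case_prod x (lo i j) \<omega>) \<partial>M) = 0" for i j
    using expectation_x[of i j] by (simp add: x_eq cong: Bochner_Integration.integral_cong)
  have eq: "(\<integral>\<omega>. x i j \<omega> * x k m \<omega> \<partial>M)
     = (\<integral>\<omega>. f i j (case_prod x (lo i j) \<omega>) * f k m (case_prod x (lo k m) \<omega>) \<partial>M)"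
    by (intro Bochner_Integration.integral_cong refl) (simp only: x_eq)
  \<comment> \<open>Distinct representatives are independent and centred. The same one occurs either
    transposed, giving the mean of |x|^2, or in equal position off the diagonal, giving the mean of
    x^2 or of its conjugate, which is 0.\<close>
  consider "lo i j \<noteq> lo k m" | "i = m" "j = k" | "i = k" "j = m" "i \<noteq> j"
  proof -
    have "i = m \<and> j = k \<or> i = k \<and> j = m" if "lo i j = lo k m"
      using that by (auto simp: lo_def split: if_splits)
    then show thesis using that by blast
  qed
  then show ?thesis
  proof cases
    case 1
    have "(\<integral>\<omega>. f i j (case_prod x (lo i j) \<omega>) * f k m (case_prod x (lo k m) \<omega>) \<partial>M) = 0"
      using lower_product_expectation[OF lo_in lo_in 1, of "f i j" "f k m"] int zero by simp
    moreover have "\<not> (i = m \<and> j = k)" using 1 by (auto simp: lo_def split: if_splits)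
    ultimately show ?thesis unfolding eq by simp
  next
    case 2
    have "(\<integral>\<omega>. x i j \<omega> * x j i \<omega> \<partial>M) = 1"
    proof (cases "j \<le> i")
      case True
      have "(\<integral>\<omega>. x i j \<omega> * x j i \<omega> \<partial>M) = (\<integral>\<omega>. x i j \<omega> * cnj (x i j \<omega>) \<partial>M)"
        by (intro Bochner_Integration.integral_cong refl) (simp add: x_swap[of _ j i])
      then show ?thesis using lower_second_moment(1)[OF True] by simp
    next
      case False
      have "(\<integral>\<omega>. x i j \<omega> * x j i \<omega> \<partial>M) = (\<integral>\<omega>. x j i \<omega> * cnj (x j i \<omega>) \<partial>M)"
        by (intro Bochner_Integration.integral_cong refl) (simp add: x_swap[of _ i j] mult.commute)
      then show ?thesis using lower_second_moment(1)[of i j] False by simp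
    qed
    then show ?thesis using 2 by simp
  next
    case 3
    have "(\<integral>\<omega>. x i j \<omega> * x k m \<omega> \<partial>M) = 0"
    proof (cases "j \<le> i")
      case True
      then show ?thesis using 3 lower_second_moment(2)[of j i] by simp
    next
      case False
      have "(\<integral>\<omega>. x i j \<omega> * x k m \<omega> \<partial>M) = (\<integral>\<omega>. cnj (x j i \<omega> * x j i \<omega>) \<partial>M)"
        using 3 by (intro Bochner_Integration.integral_cong refl) (simp add: x_swap[of _ m k])
      then show ?thesis using False 3 lower_second_moment(2)[of i j] by (simp del: complex_cnj_mult)
    qed
    then show ?thesis using 3 by auto
  qed
qed

end

section \<open>The law of the random matrix\<close>

lemma gue_matrix_entry:
  "gue_matrix \<Gamma> x \<omega> $ i $ j = complex_of_real (sqrt (scaled_profile \<Gamma> i j)) * x i j \<omega>"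
  by (simp add: gue_matrix_def scaled_profile_def real_sqrt_divide)

lemma (in gue) gue_matrix_measurable [measurable]: "gue_matrix \<Gamma> x \<in> borel_measurable M"
  by (rule borel_measurable_matrix) (simp add: gue_matrix_entry)

lemma (in gue) integrable_norm_gue_matrix4: "integrable M (\<lambda>\<omega>. norm (gue_matrix \<Gamma> x \<omega>) ^ 4)"
proof (rule Bochner_Integration.integrable_bound)
  let ?h = "\<lambda>\<omega>. real (card (UNIV :: ('n \<times> 'n) set)) *
     (\<Sum>(i, j)\<in>UNIV. \<bar>sqrt (scaled_profile \<Gamma> i j)\<bar> ^ 4 * (2 * Re (x i j \<omega>) ^ 4 + 2 * Im (x i j \<omega>) ^ 4))"
  show "integrable M ?h"
    by (simp add: split_beta' integrable_Re_power integrable_Im_power)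
  have "norm (gue_matrix \<Gamma> x \<omega>) ^ 4 \<le> ?h \<omega>" for \<omega>
  proof -
    have "norm (gue_matrix \<Gamma> x \<omega>) ^ 4 = ((norm (gue_matrix \<Gamma> x \<omega>))\<^sup>2)\<^sup>2" by (simp flip: power_mult)
    also have "(norm (gue_matrix \<Gamma> x \<omega>))\<^sup>2 = (\<Sum>(i, j)\<in>UNIV. (cmod (gue_matrix \<Gamma> x \<omega> $ i $ j))\<^sup>2)"
      unfolding norm_matrix_power2 by (simp add: sum.cartesian_product UNIV_Times_UNIV)
    also have "\<dots>\<^sup>2 \<le> real (card (UNIV :: ('n \<times> 'n) set)) * (\<Sum>(i, j)\<in>UNIV. ((cmod (gue_matrix \<Gamma> x \<omega> $ i $ j))\<^sup>2)\<^sup>2)"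
      using sum_squared_le_sum_of_squares[of "\<lambda>(i, j). (cmod (gue_matrix \<Gamma> x \<omega> $ i $ j))\<^sup>2" UNIV] by (simp add: split_beta' mult.commute)
    also have "\<dots> \<le> ?h \<omega>"
    proof (intro mult_left_mono sum_mono, clarify)
      fix i j
      have "((cmod (gue_matrix \<Gamma> x \<omega> $ i $ j))\<^sup>2)\<^sup>2 = \<bar>sqrt (scaled_profile \<Gamma> i j)\<bar> ^ 4 * cmod (x i j \<omega>) ^ 4"
        by (simp add: gue_matrix_entry norm_mult power_mult_distrib flip: power_mult)
      then show "((cmod (gue_matrix \<Gamma> x \<omega> $ i $ j))\<^sup>2)\<^sup>2
         \<le> \<bar>sqrt (scaled_profile \<Gamma> i j)\<bar> ^ 4 * (2 * Re (x i j \<omega>) ^ 4 + 2 * Im (x i j \<omega>) ^ 4)"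
        using cmod_power4_le by (simp add: mult_left_mono)
    qed simp
    finally show ?thesis .
  qed
  then show "AE \<omega> in M. norm (norm (gue_matrix \<Gamma> x \<omega>) ^ 4) \<le> norm (?h \<omega>)"
  proof (intro AE_I2)
    fix \<omega>
    have "norm (norm (gue_matrix \<Gamma> x \<omega>) ^ 4) = norm (gue_matrix \<Gamma> x \<omega>) ^ 4" by simp
    also have "\<dots> \<le> ?h \<omega>" by fact
    also have "\<dots> \<le> norm (?h \<omega>)" unfolding real_norm_def by (rule abs_ge_self)
    finally show "norm (norm (gue_matrix \<Gamma> x \<omega>) ^ 4) \<le> norm (?h \<omega>)" .
  qed
qed measurable

text \<open>
  The matrix is the image under a real-linear map of its independent lower triangular entries, whose
  joint law is a product of stable laws.
\<close>

lemma (in gue) gue_matrix_stable: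
  assumes ab: "0 < a" "0 < b" "a\<^sup>2 + b\<^sup>2 = 1"
  shows "distr (M \<Otimes>\<^sub>M M) borel (\<lambda>(u, v). a *\<^sub>R gue_matrix \<Gamma> x u + b *\<^sub>R gue_matrix \<Gamma> x v)
    = distr M borel (gue_matrix \<Gamma> x)"
proof -
  define I where "I = {(i :: 'n, j). j \<le> i}"
  define N where "N p = distr M borel (case_prod x p)" for p
  define P where "P = PiM I N"
  define \<xi> where "\<xi> \<omega> = (\<lambda>p\<in>I. case_prod x p \<omega>)" for \<omega>
  \<comment> \<open>Because of the conjugates above the diagonal, this map is linear over the reals
    only; the coefficients \<open>a\<close> and \<open>b\<close> are real.\<close>
  define A where "A y = (\<chi> i j. complex_of_real (sqrt (scaled_profile \<Gamma> i j)) *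
      (if j \<le> i then y (i, j) else cnj (y (j, i))) :: complex ^ 'n::{finite,linorder} ^ 'n::{finite,linorder})" for y
  define T where "T = (\<lambda>(y, z). \<lambda>p\<in>I. a *\<^sub>R y p + b *\<^sub>R z p :: complex)"
  have stN: "stable_measure (N p)" for p by (simp add: N_def split_beta' stable_law_entry)
  interpret N: prob_space "N p" for p by (rule stable_measureD[OF stN])
  interpret P: prob_space P unfolding P_def by (rule prob_space_PiM) (rule N.prob_space_axioms)
  have setsN [measurable_cong]: "sets (N p) = sets borel" for p by (rule stable_measureD[OF stN])
  have setsP: "sets P = sets (PiM I (\<lambda>_. borel))" unfolding P_def by (rule sets_PiM_cong) (simp_all add: setsN)
  have cm: "case_prod x p \<in> borel_measurable M" for p by (cases p) simp
  have "(\<lambda>\<omega>. \<lambda>p\<in>I. case_prod x p \<omega>) \<in> measurable M (PiM I N)"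
    by (rule measurable_restrict) (use cm in \<open>simp add: measurable_cong_sets[OF refl setsN]\<close>)
  then have \<xi>m [measurable]: "\<xi> \<in> measurable M P" unfolding \<xi>_def P_def .
  have comp [measurable]: "(\<lambda>y. y p) \<in> borel_measurable P" if "p \<in> I" for p
    using measurable_component_singleton[OF that, of N] unfolding P_def by (simp add: measurable_cong_sets[OF refl setsN])
  have Am [measurable]: "A \<in> borel_measurable P"
  proof (rule borel_measurable_matrix)
    show "(\<lambda>y. A y $ i $ j) \<in> borel_measurable P" for i j
    proof (cases "j \<le> i")
      case True
      then have "(\<lambda>y. y (i, j)) \<in> borel_measurable P" by (intro comp) (simp add: I_def)
      then show ?thesis using True by (simp add: A_def)
    next
      case False
      then have "(\<lambda>y. y (j, i)) \<in> borel_measurable P" by (intro comp) (simp add: I_def)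
      then show ?thesis using False by (simp add: A_def)
    qed
  qed
  have Tm [measurable]: "T \<in> measurable (P \<Otimes>\<^sub>M P) P" unfolding T_def P_def by measurable
  \<comment> \<open>Independence of the lower triangular entries, read as a statement on their joint
    law.\<close>
  have law: "distr M P \<xi> = P"
  proof -
    have "I \<noteq> {}" by (auto simp: I_def)
    then have "distr M (PiM I (\<lambda>_. borel)) (\<lambda>\<omega>. \<lambda>p\<in>I. case_prod x p \<omega>) = PiM I (\<lambda>p. distr M borel (case_prod x p))"
      using x_indep unfolding I_def[symmetric] by (rule indep_vars_iff_distr_eq_PiM'[THEN iffD1, OF _ cm])
    then show ?thesis
      unfolding \<xi>_def P_def N_def[abs_def] using setsP by (subst distr_cong[OF refl _ refl]) (simp_all add: P_def N_def[abs_def])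
  qed
  have X_eq: "gue_matrix \<Gamma> x \<omega> = A (\<xi> \<omega>)" if "\<omega> \<in> space M" for \<omega>
  proof -
    have "gue_matrix \<Gamma> x \<omega> $ i $ j = A (\<xi> \<omega>) $ i $ j" for i j
      using x_swap[OF that, of j i] linear[of i j] by (cases "j \<le> i") (auto simp: gue_matrix_entry A_def \<xi>_def I_def)
    then show ?thesis by (simp add: vec_eq_iff)
  qed
  have lin: "a *\<^sub>R A y + b *\<^sub>R A z = A (T (y, z))" for y z
    by (auto simp: vec_eq_iff A_def T_def I_def) (auto simp: algebra_simps scaleR_conv_of_real)
  \<comment> \<open>The combination of two matrices is \<open>A\<close> after the coordinatewise
    combination \<open>T\<close> of two entry families; \<open>T\<close> preserves the product law,
    so what remains is the law of one matrix.\<close>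
  have "distr (M \<Otimes>\<^sub>M M) borel (\<lambda>(u, v). a *\<^sub>R gue_matrix \<Gamma> x u + b *\<^sub>R gue_matrix \<Gamma> x v)
     = distr (M \<Otimes>\<^sub>M M) borel (A \<circ> T \<circ> (\<lambda>(u, v). (\<xi> u, \<xi> v)))"
    by (rule distr_cong) (auto simp: space_pair_measure X_eq lin)
  also have "\<dots> = distr (distr (distr M P \<xi> \<Otimes>\<^sub>M distr M P \<xi>) P T) borel A"
  proof -
    have "distr M P \<xi> \<Otimes>\<^sub>M distr M P \<xi> = distr (M \<Otimes>\<^sub>M M) (P \<Otimes>\<^sub>M P) (\<lambda>(u, v). (\<xi> u, \<xi> v))"
      by (rule pair_measure_distr) (simp_all add: law P.sigma_finite_measure_axioms)
    then show ?thesis by (simp add: distr_distr comp_assoc)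
  qed
  also have "distr (distr M P \<xi> \<Otimes>\<^sub>M distr M P \<xi>) P T = P"
    unfolding law using stable_PiM[of I N, OF _ stN ab] by (simp add: P_def T_def I_def)
  also have "distr P borel A = distr (distr M P \<xi>) borel A" by (simp only: law)
  also have "\<dots> = distr M borel (A \<circ> \<xi>)" by (rule distr_distr) measurable
  also have "\<dots> = distr M borel (gue_matrix \<Gamma> x)" by (rule distr_cong) (simp_all add: X_eq)
  finally show ?thesis .
qed

section \<open>The deviation bound\<close>

text \<open>The deterministic bias from \<open>dyson_bias\<close> is subtracted, so the event forces
  some diagonal entry to be at least \<open>t\<close> away from its mean; then a union bound over
  the entries.\<close>

lemma (in gaussian_resolvent) deviation_probability:
  assumes sol: "dyson_solution \<sigma> Y l g"
    and err: "\<And>i. cmod (dyson_error i) \<le> \<theta>" and \<delta>: "0 < \<delta>"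
    and small: "real CARD('n) * v * \<theta> \<le> (1 - \<delta>) * c" and t: "0 \<le> t"
  shows "measure M {\<omega> \<in> space M. \<exists>i. t + (1 + real CARD('n) * v / (\<delta> * c\<^sup>2)) * \<theta> \<le> cmod (res (X \<omega>) $ i $ i - g i)}
    \<le> 2 * real CARD('n) * exp (- t\<^sup>2 * c ^ 4 / (2 * v))"
proof -
  define S where "S i = {\<omega> \<in> space M. t \<le> cmod (res (X \<omega>) $ i $ i - mean $ i $ i)}" for i
  have S: "S i \<in> sets M" for i unfolding S_def by measurable
  have "t \<le> cmod (res H $ i $ i - mean $ i $ i)"
    if "t + (1 + real CARD('n) * v / (\<delta> * c\<^sup>2)) * \<theta> \<le> cmod (res H $ i $ i - g i)" for H i
  proof -
    have "cmod (res H $ i $ i - g i) \<le> cmod (res H $ i $ i - mean $ i $ i) + cmod (mean $ i $ i - g i)"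
      using norm_triangle_ineq[of "res H $ i $ i - mean $ i $ i" "mean $ i $ i - g i"] by simp
    then show ?thesis using that dyson_bias[OF sol err \<delta> small, of i] by linarith
  qed
  then have "measure M {\<omega> \<in> space M. \<exists>i. t + (1 + real CARD('n) * v / (\<delta> * c\<^sup>2)) * \<theta> \<le> cmod (res (X \<omega>) $ i $ i - g i)}
     \<le> measure M (\<Union>i. S i)"
    using S by (intro finite_measure_mono) (auto simp: S_def)
  also have "\<dots> \<le> (\<Sum>i\<in>UNIV. measure M (S i))"
    using S by (intro finite_measure_subadditive_finite) auto
  also have "\<dots> \<le> (\<Sum>i\<in>(UNIV :: 'n set). 2 * exp (- t\<^sup>2 * c ^ 4 / (2 * v)))"
    unfolding S_def by (intro sum_mono res_diagonal_concentration t)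
  finally show ?thesis by simp
qed

section \<open>Norms of diagonal matrices and the Loewner order\<close>

lemma opnorm_diagm_ge: "cmod (f i) \<le> opnorm (diagm f)"
proof -
  have "norm (diagm f *v axis i 1) \<le> onorm ((*v) (diagm f)) * norm (axis i 1 :: complex ^ 'a)"
    by (rule onorm) simp
  moreover have "cmod (f i) \<le> norm (diagm f *v axis i 1)"
    using Finite_Cartesian_Product.norm_nth_le[of "diagm f *v axis i 1" i] by (simp add: diagm_mult_vec axis_def)
  ultimately show ?thesis by (simp add: opnorm_def norm_axis_one_complex)
qed

lemma opnorm_diagm_le:
  assumes "\<And>i. cmod (f i) \<le> K"
  shows "opnorm (diagm f) \<le> K"
  unfolding opnorm_def
proof (rule onorm_le)
  have K: "0 \<le> K" using assms[of undefined] norm_ge_zero order_trans by blast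
  fix v :: "complex ^ 'a"
  have "(norm (diagm f *v v))\<^sup>2 = (\<Sum>i\<in>UNIV. (cmod (f i) * cmod (v $ i))\<^sup>2)"
    by (simp add: norm_vec_power2 diagm_mult_vec norm_mult)
  also have "\<dots> \<le> (\<Sum>i\<in>UNIV. (K * cmod (v $ i))\<^sup>2)"
    by (intro sum_mono power_mono mult_right_mono assms) auto
  also have "\<dots> = (K * norm v)\<^sup>2"
    by (simp add: norm_vec_power2 power_mult_distrib sum_distrib_left)
  finally show "norm (diagm f *v v) \<le> K * norm v"
    using K by (auto intro: power2_le_imp_le)
qed

text \<open>The operator norm of a diagonal matrix is the maximum of finitely many moduli, so a
  large norm is witnessed by one entry.\<close>

lemma opnorm_diagm_attained:
  assumes "e \<le> opnorm (diagm f)" shows "\<exists>i. e \<le> cmod (f i)"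
proof -
  have "opnorm (diagm f) \<le> Max (range (\<lambda>i. cmod (f i)))" by (intro opnorm_diagm_le Max_ge) auto
  moreover have "Max (range (\<lambda>i. cmod (f i))) \<in> range (\<lambda>i. cmod (f i))" by (intro Max_in) auto
  ultimately show ?thesis using assms by (metis (no_types, lifting) image_iff order_trans)
qed

lemma Im_mat_diag:
  assumes "is_diag L" shows "Im_mat L = diagm (\<lambda>i. complex_of_real (Im (L $ i $ i)))"
  using assms by (auto simp: vec_eq_iff Im_mat_def adjm_def diagm_def is_diag_def complex_eq_iff Re_divide Im_divide)

lemma matrix_inv_diagm:
  assumes "\<And>i. f i \<noteq> 0" shows "matrix_inv (diagm f) = diagm (\<lambda>i. 1 / f i)"
proof (rule matrix_inv_eqI)
  show "diagm f ** diagm (\<lambda>i. 1 / f i) = mat 1"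
    using assms by (simp add: vec_eq_iff matrix_matrix_mult_def diagm_def mat_def if_distrib[of "\<lambda>x. x * _"] cong: if_cong)
qed

lemma inv_Im_norm_Dplus:
  assumes "L \<in> Dplus" shows "inv_Im_norm L = opnorm (diagm (\<lambda>i. complex_of_real (1 / Im (L $ i $ i))))"
proof -
  have "0 < Im (L $ i $ i)" for i using assms by (simp add: Dplus_def)
  then have "Im (L $ i $ i) \<noteq> 0" for i by (rule less_imp_neq[THEN not_sym])
  then show ?thesis
    using assms by (simp add: inv_Im_norm_def Im_mat_diag matrix_inv_diagm Dplus_def)
qed

lemma loewner_ge_scalar:
  assumes "is_diag L" "Im_mat L \<succeq>\<^sub>L mat (complex_of_real \<kappa>)"
  shows "\<kappa> \<le> Im (L $ i $ i)"
proof -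
  let ?D = "diagm (\<lambda>i. complex_of_real (Im (L $ i $ i) - \<kappa>))"
  have "Im_mat L - mat (complex_of_real \<kappa>) = ?D"
    unfolding Im_mat_diag[OF assms(1)] by (simp add: vec_eq_iff diagm_def mat_def)
  then have "0 \<le> Re (\<Sum>j\<in>UNIV. cnj (axis i 1 $ j) * (?D *v axis i 1) $ j)"
    using assms(2) unfolding loewner_ge_def psd_def by metis
  also have "(\<Sum>j\<in>UNIV. cnj (axis i 1 $ j) * (?D *v axis i 1) $ j) = complex_of_real (Im (L $ i $ i) - \<kappa>)"
    unfolding diagm_mult_vec axis_def
    by (simp add: if_distrib[of cnj] if_distrib[of "\<lambda>x. x * _"] cong: if_cong)
  finally show ?thesis by simp
qed

text \<open>The norm is the reciprocal of the smallest imaginary part. Hence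
  \<open>1 / inv_Im_norm L\<close> is the best value for the constant \<open>c\<close> of
  \<open>gaussian_resolvent\<close>, and any Loewner lower bound is at most this value.\<close>

lemma inv_Im_norm_bounds:
  assumes "L \<in> Dplus"
  shows "0 < inv_Im_norm L" "1 / inv_Im_norm L \<le> Im (L $ i $ i)"
    and "Im_mat L \<succeq>\<^sub>L mat (complex_of_real \<kappa>) \<Longrightarrow> 0 < \<kappa> \<Longrightarrow> \<kappa> \<le> 1 / inv_Im_norm L"
proof -
  have pos: "0 < Im (L $ i $ i)" for i using assms by (simp add: Dplus_def)
  have ge: "1 / Im (L $ i $ i) \<le> inv_Im_norm L" for i
    using opnorm_diagm_ge[of "\<lambda>i. complex_of_real (1 / Im (L $ i $ i))" i] pos[of i]
    unfolding inv_Im_norm_Dplus[OF assms] norm_of_real by simp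
  then show s: "0 < inv_Im_norm L"
    by (rule less_le_trans[rotated]) (use pos in simp)
  show "1 / inv_Im_norm L \<le> Im (L $ i $ i)" using ge[of i] pos[of i] s by (simp add: field_simps)
  assume \<kappa>: "Im_mat L \<succeq>\<^sub>L mat (complex_of_real \<kappa>)" "0 < \<kappa>"
  have "inv_Im_norm L \<le> 1 / \<kappa>"
    unfolding inv_Im_norm_Dplus[OF assms]
  proof (rule opnorm_diagm_le)
    fix i
    have "is_diag L" using assms by (simp add: Dplus_def)
    then have "\<kappa> \<le> Im (L $ i $ i)" by (rule loewner_ge_scalar[OF _ \<kappa>(1)])
    then show "cmod (complex_of_real (1 / Im (L $ i $ i))) \<le> 1 / \<kappa>"
      using \<kappa>(2) pos[of i] unfolding norm_of_real by (simp add: frac_le)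
  qed
  then show "\<kappa> \<le> 1 / inv_Im_norm L" using s \<kappa>(2) by (simp add: field_simps)
qed

lemma gamma_max_power2:
  assumes "variance_profile \<Gamma>"
  shows "(gamma_max \<Gamma>)\<^sup>2 = Max (range (\<lambda>(i, j). \<Gamma> $ i $ j))" "\<Gamma> $ i $ j \<le> (gamma_max \<Gamma>)\<^sup>2"
proof -
  have le: "\<Gamma> $ i $ j \<le> Max (range (\<lambda>(i, j). \<Gamma> $ i $ j))" for i j by (rule Max_ge) auto
  have "0 \<le> \<Gamma> $ i $ j" for i j using assms by (simp add: variance_profile_def)
  then have "0 \<le> Max (range (\<lambda>(i, j). \<Gamma> $ i $ j))" using le order_trans by blast
  then show "(gamma_max \<Gamma>)\<^sup>2 = Max (range (\<lambda>(i, j). \<Gamma> $ i $ j))" by (simp add: gamma_max_def)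
  then show "\<Gamma> $ i $ j \<le> (gamma_max \<Gamma>)\<^sup>2" using le by simp
qed

lemma (in gue) gaussian_resolvent_gue_matrix:
  assumes "variance_profile \<Gamma>" "hermitian Y" "0 < gamma_max \<Gamma>" "0 < c" "\<And>i. c \<le> Im (l i)"
  shows "gaussian_resolvent M (gue_matrix \<Gamma> x) (scaled_profile \<Gamma>) Y l c ((gamma_max \<Gamma>)\<^sup>2 / real CARD('n))"
proof -
  have nonneg: "0 \<le> scaled_profile \<Gamma> i j" for i j
    using assms(1) by (simp add: scaled_profile_def variance_profile_def)
  have sym: "scaled_profile \<Gamma> i j = scaled_profile \<Gamma> j i" for i j
  proof -
    have "transpose \<Gamma> $ i $ j = \<Gamma> $ i $ j" using assms(1) by (simp add: variance_profile_def)
    then show ?thesis by (simp add: scaled_profile_def transpose_def)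
  qed
  interpret stable_law M "gue_matrix \<Gamma> x"
    by unfold_locales (simp_all add: gue_matrix_stable integrable_norm_gue_matrix4)
  interpret dyson "scaled_profile \<Gamma>" Y by (rule dyson_scaled_profile) fact+
  show ?thesis
  proof unfold_locales
    show "hermitian (gue_matrix \<Gamma> x \<omega>)" if "\<omega> \<in> space M" for \<omega>
      unfolding hermitian_iff_entries gue_matrix_entry
    proof (intro allI)
      show "cnj (complex_of_real (sqrt (scaled_profile \<Gamma> j i)) * x j i \<omega>) = complex_of_real (sqrt (scaled_profile \<Gamma> i j)) * x i j \<omega>" for i j
        using x_swap[OF that, of j i] sym[of i j] by simp
    qed
    show "(\<integral>\<omega>. gue_matrix \<Gamma> x \<omega> $ i $ j * gue_matrix \<Gamma> x \<omega> $ k $ m \<partial>M)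
       = (if i = m \<and> j = k then complex_of_real (scaled_profile \<Gamma> i j) else 0)" for i j k m
    proof -
      let ?s = "\<lambda>i j. complex_of_real (sqrt (scaled_profile \<Gamma> i j))"
      have "(\<integral>\<omega>. gue_matrix \<Gamma> x \<omega> $ i $ j * gue_matrix \<Gamma> x \<omega> $ k $ m \<partial>M)
         = (\<integral>\<omega>. (?s i j * ?s k m) * (x i j \<omega> * x k m \<omega>) \<partial>M)"
        by (simp add: gue_matrix_entry mult_ac)
      also have "\<dots> = (?s i j * ?s k m) * (if i = m \<and> j = k then 1 else 0)"
        by (simp add: expectation_x_mult)
      also have "\<dots> = (if i = m \<and> j = k then complex_of_real (scaled_profile \<Gamma> i j) else 0)"
        using nonneg[of i j] sym[of i j] by (auto simp flip: of_real_mult)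
      finally show ?thesis .
    qed
    show "scaled_profile \<Gamma> i j \<le> (gamma_max \<Gamma>)\<^sup>2 / real CARD('n)" for i j
      unfolding scaled_profile_def by (intro divide_right_mono gamma_max_power2 assms) simp
  qed (use assms in auto)
qed

text \<open>Common part of both probability bounds, with the error bound \<open>\<theta>\<close> as
  parameter. The hypothesis on \<open>dyson_error\<close> is conditional on the locale, so that the
  estimates proved there can be used to discharge it.\<close>

lemma gue_deviation:
  fixes \<Gamma> :: "real ^ 'n::{finite,linorder} ^ 'n::{finite,linorder}"
    and Y :: "complex ^ 'n::{finite,linorder} ^ 'n::{finite,linorder}"
  assumes G: "variance_profile \<Gamma>" and Y: "hermitian Y" and x: "gue_entries M x" and pos: "0 < gamma_max \<Gamma>"
    and L: "L \<in> Dplus" and \<delta>: "0 < \<delta>" and d: "1 < d"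
    and err: "\<And>i. gaussian_resolvent M (gue_matrix \<Gamma> x) (scaled_profile \<Gamma>) Y (\<lambda>i. L $ i $ i) (1 / inv_Im_norm L)
        ((gamma_max \<Gamma>)\<^sup>2 / real CARD('n)) \<Longrightarrow>
      cmod (gaussian_resolvent.dyson_error M (gue_matrix \<Gamma> x) (scaled_profile \<Gamma>) Y (\<lambda>i. L $ i $ i) i) \<le> \<theta>"
    and small: "(gamma_max \<Gamma>)\<^sup>2 * \<theta> * inv_Im_norm L \<le> 1 - \<delta>"
    and \<epsilon>: "sqrt 2 * gamma_max \<Gamma> * sqrt (d * ln (real CARD('n)) / real CARD('n)) * (inv_Im_norm L)\<^sup>2
      + (1 + (gamma_max \<Gamma>)\<^sup>2 / \<delta> * (inv_Im_norm L)\<^sup>2) * \<theta> \<le> \<epsilon>"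
  shows "measure M {\<omega> \<in> space M. opnorm (stieltjes (gue_matrix \<Gamma> x \<omega> + Y) L - G_box \<Gamma> Y L) \<ge> \<epsilon>}
    \<le> 4 * real CARD('n) powr (1 - d)"
proof -
  define N where "N = real CARD('n)"
  define s where "s = inv_Im_norm L"
  define \<gamma> where "\<gamma> = gamma_max \<Gamma>"
  have N: "1 \<le> N" "0 < N" by (simp_all add: N_def Suc_le_eq)
  have s: "0 < s" unfolding s_def by (rule inv_Im_norm_bounds[OF L])
  have \<gamma>: "0 < \<gamma>" using pos by (simp add: \<gamma>_def)
  have Ld: "is_diag L" using L by (simp add: Dplus_def)
  interpret gue M x by (rule gue_entries_imp_gue[OF x])
  have gr: "gaussian_resolvent M (gue_matrix \<Gamma> x) (scaled_profile \<Gamma>) Y (\<lambda>i. L $ i $ i) (1 / inv_Im_norm L) ((gamma_max \<Gamma>)\<^sup>2 / real CARD('n))"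
    using s inv_Im_norm_bounds(2)[OF L] by (intro gaussian_resolvent_gue_matrix G Y pos) (simp_all add: s_def)
  interpret gr: gaussian_resolvent M "gue_matrix \<Gamma> x" "scaled_profile \<Gamma>" Y "\<lambda>i. L $ i $ i" "1 / inv_Im_norm L" "(gamma_max \<Gamma>)\<^sup>2 / real CARD('n)"
    by (rule gr)
  \<comment> \<open>Makes the exponent of the concentration bound equal to
    \<open>- (d * ln N)\<close> for variance \<open>\<gamma>\<^sup>2 * s ^ 4 / N\<close>.\<close>
  define t where "t = sqrt 2 * \<gamma> * sqrt (d * ln N / N) * s\<^sup>2"
  have lnN: "0 \<le> d * ln N" using N d by simp
  have t0: "0 \<le> t" using \<gamma> lnN N by (simp add: t_def)
  have "G_box \<Gamma> Y L = diagm (\<lambda>i. G_box \<Gamma> Y L $ i $ i)"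
    by (rule is_diag_eq_diagm[OF dyson_solution_G_box(2)[OF G Y L]])
  have res_eq: "gr.res (gue_matrix \<Gamma> x \<omega>) = matrix_inv (L - (gue_matrix \<Gamma> x \<omega> + Y))" if "\<omega> \<in> space M" for \<omega>
    using is_diag_eq_diagm[OF Ld] by (simp add: gr.res_def hermitian_part_hermitian[OF gr.hermitian_X[OF that]] add.commute)
  have diff_eq: "stieltjes (gue_matrix \<Gamma> x \<omega> + Y) L - G_box \<Gamma> Y L
      = diagm (\<lambda>i. gr.res (gue_matrix \<Gamma> x \<omega>) $ i $ i - G_box \<Gamma> Y L $ i $ i)" if "\<omega> \<in> space M" for \<omega>
    using dyson_solution_G_box(2)[OF G Y L] unfolding stieltjes_def diag_part_def res_eq[OF that]
    by (auto simp: vec_eq_iff diagm_def is_diag_def)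
  have \<beta>: "(1 + real CARD('n) * ((gamma_max \<Gamma>)\<^sup>2 / real CARD('n)) / (\<delta> * (1 / inv_Im_norm L)\<^sup>2)) * \<theta> = (1 + \<gamma>\<^sup>2 / \<delta> * s\<^sup>2) * \<theta>"
    using s \<delta> by (simp add: \<gamma>_def s_def power_divide)
  have small': "real CARD('n) * ((gamma_max \<Gamma>)\<^sup>2 / real CARD('n)) * \<theta> \<le> (1 - \<delta>) * (1 / inv_Im_norm L)"
    using small s by (simp add: s_def field_simps)
  have "measure M {\<omega> \<in> space M. opnorm (stieltjes (gue_matrix \<Gamma> x \<omega> + Y) L - G_box \<Gamma> Y L) \<ge> \<epsilon>}
     \<le> measure M {\<omega> \<in> space M. \<exists>i. t + (1 + \<gamma>\<^sup>2 / \<delta> * s\<^sup>2) * \<theta> \<le> cmod (gr.res (gue_matrix \<Gamma> x \<omega>) $ i $ i - G_box \<Gamma> Y L $ i $ i)}"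
  proof (rule finite_measure_mono)
    show "{\<omega> \<in> space M. opnorm (stieltjes (gue_matrix \<Gamma> x \<omega> + Y) L - G_box \<Gamma> Y L) \<ge> \<epsilon>}
      \<subseteq> {\<omega> \<in> space M. \<exists>i. t + (1 + \<gamma>\<^sup>2 / \<delta> * s\<^sup>2) * \<theta> \<le> cmod (gr.res (gue_matrix \<Gamma> x \<omega>) $ i $ i - G_box \<Gamma> Y L $ i $ i)}"
    proof (intro subsetI CollectI conjI)
      fix \<omega> assume \<omega>: "\<omega> \<in> {\<omega> \<in> space M. opnorm (stieltjes (gue_matrix \<Gamma> x \<omega> + Y) L - G_box \<Gamma> Y L) \<ge> \<epsilon>}"
      then show "\<omega> \<in> space M" by simp
      have "t + (1 + \<gamma>\<^sup>2 / \<delta> * s\<^sup>2) * \<theta> \<le> \<epsilon>" using \<epsilon> by (simp add: t_def \<gamma>_def s_def N_def)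
      then have "t + (1 + \<gamma>\<^sup>2 / \<delta> * s\<^sup>2) * \<theta> \<le> opnorm (diagm (\<lambda>i. gr.res (gue_matrix \<Gamma> x \<omega>) $ i $ i - G_box \<Gamma> Y L $ i $ i))"
        using \<omega> diff_eq[of \<omega>] by auto
      then show "\<exists>i. t + (1 + \<gamma>\<^sup>2 / \<delta> * s\<^sup>2) * \<theta> \<le> cmod (gr.res (gue_matrix \<Gamma> x \<omega>) $ i $ i - G_box \<Gamma> Y L $ i $ i)"
        by (rule opnorm_diagm_attained)
    qed
    show "{\<omega> \<in> space M. \<exists>i. t + (1 + \<gamma>\<^sup>2 / \<delta> * s\<^sup>2) * \<theta> \<le> cmod (gr.res (gue_matrix \<Gamma> x \<omega>) $ i $ i - G_box \<Gamma> Y L $ i $ i)} \<in> events"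
      by measurable
  qed
  also have "\<dots> \<le> 2 * real CARD('n) * exp (- t\<^sup>2 * (1 / inv_Im_norm L) ^ 4 / (2 * ((gamma_max \<Gamma>)\<^sup>2 / real CARD('n))))"
    unfolding \<beta>[symmetric]
    by (rule gr.deviation_probability[OF dyson_solution_G_box(1)[OF G Y L] err[OF gr] \<delta> small' t0])
  also have "- t\<^sup>2 * (1 / inv_Im_norm L) ^ 4 / (2 * ((gamma_max \<Gamma>)\<^sup>2 / real CARD('n))) = - (d * ln N)"
  proof -
    have "t\<^sup>2 = 2 * \<gamma>\<^sup>2 * (d * ln N / N) * s ^ 4"
      using lnN N by (simp add: t_def power_mult_distrib flip: power_mult)
    then show ?thesis using s \<gamma> N by (simp add: s_def[symmetric] \<gamma>_def[symmetric] N_def[symmetric] power_divide)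
  qed
  also have "2 * real CARD('n) * exp (- (d * ln N)) = 2 * N powr (1 - d)"
    using N by (simp add: powr_def left_diff_distrib exp_diff exp_minus divide_inverse N_def[symmetric])
  also have "\<dots> \<le> 4 * real CARD('n) powr (1 - d)" by (simp add: N_def)
  finally show ?thesis .
qed

lemma power_powr: "0 < x \<Longrightarrow> (x powr y) ^ k = x powr (y * real k)" for x :: real
  by (simp add: powr_powr flip: powr_realpow)

lemma power_root_le:
  fixes \<kappa> s r :: real
  assumes "0 < s" "0 < \<kappa>" "\<kappa> \<le> 1 / s" "\<kappa> ^ k = r" shows "r * s ^ k \<le> 1"
proof -
  have "(\<kappa> * s) ^ k \<le> 1 ^ k" using assms by (intro power_mono) (auto simp: field_simps)
  then show ?thesis using assms(4) by (simp add: power_mult_distrib)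
qed

theorem theorem1p1:
  fixes \<Gamma> :: "real ^ 'n::{finite,linorder} ^ 'n::{finite,linorder}"
    and Y :: "complex ^ 'n::{finite,linorder} ^ 'n::{finite,linorder}"
    and M :: "'a measure"
    and x :: "'n \<Rightarrow> 'n \<Rightarrow> 'a \<Rightarrow> complex"
  assumes "variance_profile \<Gamma>"
    and "hermitian Y"
    and "gue_entries M x"
  shows
    "(\<exists>!G. fixed_point_solution \<Gamma> Y G)
     \<and>
     (gamma_max \<Gamma> > 0 \<longrightarrow>
       (\<forall>\<delta> d :: real. \<forall>\<Lambda> \<in> Dplus. 0 < \<delta> \<longrightarrow> \<delta> < 1 \<longrightarrow> d > 1 \<longrightarrow>
          Im_mat \<Lambda> \<succeq>\<^sub>L
            mat (complex_of_real (gamma_max \<Gamma> * (2 / (real CARD('n) * (1 - \<delta>))) powr (1/5))) \<longrightarrow>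
          measure M {\<omega> \<in> space M.
            opnorm (stieltjes (gue_matrix \<Gamma> x \<omega> + Y) \<Lambda> - G_box \<Gamma> Y \<Lambda>) \<ge> eps_general \<Gamma> \<Lambda> \<delta> d}
          \<le> 4 * real CARD('n) powr (1 - d)))
     \<and>
     (gamma_max \<Gamma> > 0 \<longrightarrow> is_diag Y \<longrightarrow>
       (\<forall>\<delta> d :: real. \<forall>\<Lambda> \<in> Dplus. 0 < \<delta> \<longrightarrow> \<delta> < 1 \<longrightarrow> d > 1 \<longrightarrow>
          Im_mat \<Lambda> \<succeq>\<^sub>L
            mat (complex_of_real
              (gamma_max \<Gamma> * real CARD('n) powr (-1/4) * (1 - \<delta>) powr (-1/6))) \<longrightarrow>
          measure M {\<omega> \<in> space M.
            opnorm (stieltjes (gue_matrix \<Gamma> x \<omega> + Y) \<Lambda> - G_box \<Gamma> Y \<Lambda>) \<ge> eps_diagonal \<Gamma> \<Lambda> \<delta> d}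
          \<le> 4 * real CARD('n) powr (1 - d)))"
proof (intro conjI impI allI ballI)
  show "\<exists>!G. fixed_point_solution \<Gamma> Y G" by (rule ex1_fixed_point_solution[OF assms(1,2)])
next
  fix \<delta> d :: real and L :: "complex ^ 'n::{finite,linorder} ^ 'n::{finite,linorder}"
  assume pos: "gamma_max \<Gamma> > 0" and L: "L \<in> Dplus" and \<delta>: "0 < \<delta>" "\<delta> < 1" and d: "1 < d"
    and ge: "Im_mat L \<succeq>\<^sub>L mat (complex_of_real (gamma_max \<Gamma> * (2 / (real CARD('n) * (1 - \<delta>))) powr (1/5)))"
  define N where "N = real CARD('n)"
  define s where "s = inv_Im_norm L"
  define \<gamma> where "\<gamma> = gamma_max \<Gamma>"
  have N: "1 \<le> N" "0 < N" by (simp_all add: N_def Suc_le_eq)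
  have s: "0 < s" unfolding s_def by (rule inv_Im_norm_bounds[OF L])
  have \<gamma>: "0 < \<gamma>" using pos by (simp add: \<gamma>_def)
  \<comment> \<open>The bound of \<open>dyson_error_le\<close> for variance bound
    \<open>\<gamma>\<^sup>2 / N\<close> and \<open>c = 1 / s\<close>: half of the corresponding term
    in \<open>eps_general\<close>.\<close>
  define \<theta> where "\<theta> = \<gamma> ^ 3 * s ^ 4 / N"
  define \<kappa> where "\<kappa> = \<gamma> * (2 / (N * (1 - \<delta>))) powr (1 / 5)"
  have q: "0 < 2 / (N * (1 - \<delta>))" using N \<delta> by simp
  then have "0 < (2 / (N * (1 - \<delta>))) powr (1 / 5)" unfolding powr_gt_zero by linarith
  then have \<kappa>: "0 < \<kappa>" using \<gamma> by (simp add: \<kappa>_def)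
  have "\<kappa> \<le> 1 / s"
    unfolding s_def by (rule inv_Im_norm_bounds(3)[OF L]) (use ge \<kappa> in \<open>simp_all add: \<kappa>_def \<gamma>_def N_def\<close>)
  \<comment> \<open>The fifth power of \<open>\<kappa> * s \<le> 1\<close> bounds
    \<open>\<gamma>\<^sup>2 * \<theta> * s\<close> by \<open>(1 - \<delta>) / 2\<close>, which is
    stronger than the smallness condition of \<open>gue_deviation\<close>.\<close>
  moreover have "\<kappa> ^ 5 = \<gamma> ^ 5 * (2 / (N * (1 - \<delta>)))"
    unfolding \<kappa>_def power_mult_distrib power_powr[OF q] using q by (simp add: powr_one)
  ultimately have "\<gamma> ^ 5 * (2 / (N * (1 - \<delta>))) * s ^ 5 \<le> 1" by (rule power_root_le[OF s \<kappa>])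
  then have "2 * (\<gamma> ^ 5 * s ^ 5 / N) \<le> 1 - \<delta>" using N \<delta> by (simp add: field_simps)
  moreover have "0 \<le> \<gamma> ^ 5 * s ^ 5 / N" using \<gamma> s N by simp
  ultimately have "\<gamma> ^ 5 * s ^ 5 / N \<le> 1 - \<delta>" by linarith
  then have small: "\<gamma>\<^sup>2 * \<theta> * s \<le> 1 - \<delta>"
    by (simp add: \<theta>_def eval_nat_numeral mult_ac)
  show "measure M {\<omega> \<in> space M. opnorm (stieltjes (gue_matrix \<Gamma> x \<omega> + Y) L - G_box \<Gamma> Y L) \<ge> eps_general \<Gamma> L \<delta> d}
    \<le> 4 * real CARD('n) powr (1 - d)"
  proof (rule gue_deviation[OF assms pos L \<delta>(1) d _ small[unfolded \<gamma>_def s_def]])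
    fix i
    assume "gaussian_resolvent M (gue_matrix \<Gamma> x) (scaled_profile \<Gamma>) Y (\<lambda>i. L $ i $ i) (1 / inv_Im_norm L) ((gamma_max \<Gamma>)\<^sup>2 / real CARD('n))"
    then interpret gr: gaussian_resolvent M "gue_matrix \<Gamma> x" "scaled_profile \<Gamma>" Y "\<lambda>i. L $ i $ i" "1 / inv_Im_norm L" "(gamma_max \<Gamma>)\<^sup>2 / real CARD('n)" .
    have "sqrt (N * (\<gamma>\<^sup>2 / N) ^ 3) = \<gamma> ^ 3 / N"
    proof (rule real_sqrt_unique)
      show "(\<gamma> ^ 3 / N)\<^sup>2 = N * (\<gamma>\<^sup>2 / N) ^ 3" using N by (simp add: eval_nat_numeral)
    qed (use \<gamma> N in simp)
    then show "cmod (gr.dyson_error i) \<le> \<theta>"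
      using gr.dyson_error_le[of i] s by (simp add: \<theta>_def N_def \<gamma>_def s_def power_divide)
  next
    have "(1 + \<gamma>\<^sup>2 / \<delta> * s\<^sup>2) * \<theta> \<le> (1 + \<gamma>\<^sup>2 / \<delta> * s\<^sup>2) * (2 * \<gamma> ^ 3 * s ^ 4 / N)"
      using \<delta> \<gamma> s N by (intro mult_left_mono) (auto simp: \<theta>_def divide_right_mono)
    then show "sqrt 2 * gamma_max \<Gamma> * sqrt (d * ln (real CARD('n)) / real CARD('n)) * (inv_Im_norm L)\<^sup>2
        + (1 + (gamma_max \<Gamma>)\<^sup>2 / \<delta> * (inv_Im_norm L)\<^sup>2) * \<theta> \<le> eps_general \<Gamma> L \<delta> d"
      by (simp add: eps_general_def \<gamma>_def s_def N_def)
  qed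
next
  fix \<delta> d :: real and L :: "complex ^ 'n::{finite,linorder} ^ 'n::{finite,linorder}"
  assume pos: "gamma_max \<Gamma> > 0" and Y: "is_diag Y" and L: "L \<in> Dplus" and \<delta>: "0 < \<delta>" "\<delta> < 1" and d: "1 < d"
    and ge: "Im_mat L \<succeq>\<^sub>L mat (complex_of_real (gamma_max \<Gamma> * real CARD('n) powr (-1/4) * (1 - \<delta>) powr (-1/6)))"
  define N where "N = real CARD('n)"
  define s where "s = inv_Im_norm L"
  define \<gamma> where "\<gamma> = gamma_max \<Gamma>"
  have N: "1 \<le> N" "0 < N" by (simp_all add: N_def Suc_le_eq)
  have s: "0 < s" unfolding s_def by (rule inv_Im_norm_bounds[OF L])
  have \<gamma>: "0 < \<gamma>" using pos by (simp add: \<gamma>_def)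
  \<comment> \<open>The bound of \<open>dyson_error_diagonal_le\<close>, where sqrt N (gamma^2 /
    N)^2 = gamma^4 / N^(3/2); it is exactly the term in \<open>eps_diagonal\<close>.\<close>
  define \<theta> where "\<theta> = \<gamma> ^ 4 * (s ^ 5 / N powr (3 / 2))"
  define \<kappa> where "\<kappa> = \<gamma> * N powr (-1/4) * (1 - \<delta>) powr (-1/6)"
  have \<kappa>: "0 < \<kappa>" using \<gamma> N \<delta> by (simp add: \<kappa>_def)
  have "\<kappa> \<le> 1 / s"
    unfolding s_def by (rule inv_Im_norm_bounds(3)[OF L]) (use ge \<kappa> in \<open>simp_all add: \<kappa>_def \<gamma>_def N_def\<close>)
  \<comment> \<open>The exponents -1/4 and -1/6 become -3/2 and -1, so the sixth power of
    \<open>\<kappa> * s \<le> 1\<close> is precisely the smallness condition.\<close>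
  moreover have "\<kappa> ^ 6 = \<gamma> ^ 6 * (1 / (N powr (3 / 2) * (1 - \<delta>)))"
    using N \<delta> by (simp add: \<kappa>_def power_mult_distrib power_divide power_powr powr_minus_divide)
  ultimately have "\<gamma> ^ 6 * (1 / (N powr (3 / 2) * (1 - \<delta>))) * s ^ 6 \<le> 1" by (rule power_root_le[OF s \<kappa>])
  then have "\<gamma> ^ 6 * s ^ 6 / N powr (3 / 2) \<le> 1 - \<delta>" using N \<delta> by (simp add: field_simps)
  then have small: "\<gamma>\<^sup>2 * \<theta> * s \<le> 1 - \<delta>"
    by (simp add: \<theta>_def eval_nat_numeral mult_ac)
  show "measure M {\<omega> \<in> space M. opnorm (stieltjes (gue_matrix \<Gamma> x \<omega> + Y) L - G_box \<Gamma> Y L) \<ge> eps_diagonal \<Gamma> L \<delta> d}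
    \<le> 4 * real CARD('n) powr (1 - d)"
  proof (rule gue_deviation[OF assms pos L \<delta>(1) d _ small[unfolded \<gamma>_def s_def]])
    fix i
    assume "gaussian_resolvent M (gue_matrix \<Gamma> x) (scaled_profile \<Gamma>) Y (\<lambda>i. L $ i $ i) (1 / inv_Im_norm L) ((gamma_max \<Gamma>)\<^sup>2 / real CARD('n))"
    then interpret gr: gaussian_resolvent M "gue_matrix \<Gamma> x" "scaled_profile \<Gamma>" Y "\<lambda>i. L $ i $ i" "1 / inv_Im_norm L" "(gamma_max \<Gamma>)\<^sup>2 / real CARD('n)" .
    have "N powr (3 / 2) = N * sqrt N"
      using N powr_add[of N 1 "1 / 2"] by (simp add: powr_half_sqrt)
    then have "sqrt N * (\<gamma>\<^sup>2 / N)\<^sup>2 = \<gamma> ^ 4 / N powr (3 / 2)"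
      using N by (simp add: power_divide power2_eq_square power4_eq_xxxx field_simps)
    then show "cmod (gr.dyson_error i) \<le> \<theta>"
      using gr.dyson_error_diagonal_le[OF Y, of i] s by (simp add: \<theta>_def N_def \<gamma>_def s_def power_divide)
  next
    show "sqrt 2 * gamma_max \<Gamma> * sqrt (d * ln (real CARD('n)) / real CARD('n)) * (inv_Im_norm L)\<^sup>2
        + (1 + (gamma_max \<Gamma>)\<^sup>2 / \<delta> * (inv_Im_norm L)\<^sup>2) * \<theta> \<le> eps_diagonal \<Gamma> L \<delta> d"
      by (simp add: eps_diagonal_def \<theta>_def \<gamma>_def s_def N_def)
  qed
qed

end
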